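(* There exists a $\Delta_0$ formula $\Xi(x)$ defining a (polynomial-time recognizable) set of $\Sigma^1_1\wedge\Pi^1_1$ sentences, in the language with one unary function symbol $f$ and one individual constant $c$, such that $\mathsf{RCA}^*_0$ proves: "for every structure $\mathbb{A}=\langle A,f,c\rangle$, $\mathbb{A}$ is isomorphic to $\langle \mathbb{N},S,0\rangle$ if and only if $\mathbb{A}\models\xi$ for all $\xi$ such that $\Xi(\xi)$".
   Context: Theories. $\mathsf{RCA}^*_0$ is the theory in the language of second-order arithmetic consisting of the usual basic arithmetical axioms, $\Delta^0_1$ comprehension, induction for $\Delta^0_0$ formulas (bounded formulas, set parameters allowed), and the axiom $\exp$ stating totality of exponentiation. A $\Delta_0$ formula is a bounded first-order formula with no set variables. Structures and satisfaction inside the theory. $\mathbb{N}$ is the set of all numbers (defined by $x=x$), $S$ is successor. A structure $\mathbb{A}=\langle A,f,c\rangle$ is given by a set $A\subseteq\mathbb{N}$, a function $f\colon A\to A$ (its graph, coded as a set of pairs) and $c\in A$; isomorphisms are functions coded by sets. Second-order logic allows quantification over relations of any arity and has the standard (full) semantics: first-order quantifiers range over elements of $A$ and second-order quantifiers over $k$-ary relations range over all sets (of the theory) coding $k$-ary relations on $A$. A $\Sigma^1_1$ (resp. $\Pi^1_1$) sentence is a block of existential (resp. universal) second-order quantifiers followed by a first-order formula, up to logical equivalence; a $\Sigma^1_1\wedge\Pi^1_1$ sentence is a conjunction of one of each. Sentences are identified with their Gödel numbers, so in a nonstandard model of $\mathsf{RCA}^*_0$ the set defined by $\Xi$ may contain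 sentences of nonstandard length. Satisfaction has its usual Tarskian meaning: for a fixed standard sentence $\xi$, $\mathbb{A}\models\xi$ is the formula of second-order arithmetic obtained from $\xi$ by interpreting the symbols $f$ and $c$ by the function and constant of $\mathbb{A}$, restricting first-order quantifiers to elements of $A$, and restricting second-order quantifiers over $k$-ary relations to sets coding $k$-ary relations on $A$; for a (possibly nonstandard-length) first-order sentence $\exists a_0\ldots\exists a_x\,\theta$ with $\theta$ quantifier-free, $\mathbb{A}\models\exists a_0\ldots\exists a_x\,\theta$ means that there is a coded finite sequence $\langle a_0,\ldots,a_x\rangle$ of elements of $A$ under which $\theta$ is true. *)

theory Defs
  imports Main
begin

section \<open>The language of second-order arithmetic\<close>

text \<open>
  Two-sorted first-order logic (numbers and sets) in the style of Smullyan and Fitting: quantifiers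
  bind named variables \<open>Nm x\<close>, whereas parameters \<open>Par a\<close> are never bound and serve as
  eigenvariables in derivations.  A name is a string with a list of indices; the indices are used for
  families of variables, such as the variables that translate the variables of the
  object language below.  Equality is primitive for numbers only.
\<close>

type_synonym name = "string \<times> nat list"

datatype var = Nm name | Par nat

datatype trm =
    Var var
  | Zero ("\<^bold>0")
  | One ("\<^bold>1")
  | Plus trm trm (infixl "\<^bold>+" 65)
  | Times trm trm (infixl "\<^bold>*" 70)

datatype fm =
    Fls ("\<^bold>\<bottom>")
  | Eq trm trm (infix "\<^bold>=" 50)
  | Less trm trm (infix "\<^bold><" 50)
  | Mem trm var (infix "\<^bold>\<in>" 50)
  | Imp fm fm (infixr "\<^bold>\<longrightarrow>" 25)
  | AllN name fm
  | AllS name fm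

definition Neg :: "fm \<Rightarrow> fm" ("\<^bold>\<not> _" [40] 40) where
  "Neg \<phi> = (\<phi> \<^bold>\<longrightarrow> \<^bold>\<bottom>)"
definition And :: "fm \<Rightarrow> fm \<Rightarrow> fm" (infixr "\<^bold>\<and>" 35) where
  "And \<phi> \<psi> = (\<^bold>\<not> (\<phi> \<^bold>\<longrightarrow> \<^bold>\<not> \<psi>))"
definition Or :: "fm \<Rightarrow> fm \<Rightarrow> fm" (infixr "\<^bold>\<or>" 30) where
  "Or \<phi> \<psi> = (\<^bold>\<not> \<phi> \<^bold>\<longrightarrow> \<psi>)"
definition Iff :: "fm \<Rightarrow> fm \<Rightarrow> fm" (infix "\<^bold>\<longleftrightarrow>" 25) where
  "Iff \<phi> \<psi> = ((\<phi> \<^bold>\<longrightarrow> \<psi>) \<^bold>\<and> (\<psi> \<^bold>\<longrightarrow> \<phi>))"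
definition ExN :: "name \<Rightarrow> fm \<Rightarrow> fm" where
  "ExN x \<phi> = (\<^bold>\<not> AllN x (\<^bold>\<not> \<phi>))"
definition ExS :: "name \<Rightarrow> fm \<Rightarrow> fm" where
  "ExS X \<phi> = (\<^bold>\<not> AllS X (\<^bold>\<not> \<phi>))"

definition Conj :: "fm list \<Rightarrow> fm" where
  "Conj \<phi>s = foldr And \<phi>s (\<^bold>\<not> \<^bold>\<bottom>)"
definition Disj :: "fm list \<Rightarrow> fm" where
  "Disj \<phi>s = foldr Or \<phi>s \<^bold>\<bottom>"

primrec vars_trm :: "trm \<Rightarrow> var set" where
  "vars_trm (Var v) = {v}"
| "vars_trm \<^bold>0 = {}"
| "vars_trm \<^bold>1 = {}"
| "vars_trm (s \<^bold>+ t) = vars_trm s \<union> vars_trm t"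
| "vars_trm (s \<^bold>* t) = vars_trm s \<union> vars_trm t"

text \<open>Free number variables and free set variables, parameters included.\<close>

primrec fnv :: "fm \<Rightarrow> var set" where
  "fnv \<^bold>\<bottom> = {}"
| "fnv (s \<^bold>= t) = vars_trm s \<union> vars_trm t"
| "fnv (s \<^bold>< t) = vars_trm s \<union> vars_trm t"
| "fnv (s \<^bold>\<in> X) = vars_trm s"
| "fnv (\<phi> \<^bold>\<longrightarrow> \<psi>) = fnv \<phi> \<union> fnv \<psi>"
| "fnv (AllN x \<phi>) = fnv \<phi> - {Nm x}"
| "fnv (AllS X \<phi>) = fnv \<phi>"

primrec fsv :: "fm \<Rightarrow> var set" where
  "fsv \<^bold>\<bottom> = {}"
| "fsv (s \<^bold>= t) = {}"
| "fsv (s \<^bold>< t) = {}"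
| "fsv (s \<^bold>\<in> X) = {X}"
| "fsv (\<phi> \<^bold>\<longrightarrow> \<psi>) = fsv \<phi> \<union> fsv \<psi>"
| "fsv (AllN x \<phi>) = fsv \<phi>"
| "fsv (AllS X \<phi>) = fsv \<phi> - {Nm X}"

definition sentence :: "fm \<Rightarrow> bool" where
  "sentence \<phi> \<longleftrightarrow> fnv \<phi> = {} \<and> fsv \<phi> = {}"

primrec subst_trm :: "name \<Rightarrow> trm \<Rightarrow> trm \<Rightarrow> trm" where
  "subst_trm x t (Var v) = (if v = Nm x then t else Var v)"
| "subst_trm x t \<^bold>0 = \<^bold>0"
| "subst_trm x t \<^bold>1 = \<^bold>1"
| "subst_trm x t (r \<^bold>+ s) = subst_trm x t r \<^bold>+ subst_trm x t s"
| "subst_trm x t (r \<^bold>* s) = subst_trm x t r \<^bold>* subst_trm x t s"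

text \<open>
  Substitution does not rename bound variables.  It is only used with terms that contain no name
  other than the substituted one, so that no capture can occur.
\<close>

primrec substN :: "name \<Rightarrow> trm \<Rightarrow> fm \<Rightarrow> fm" where
  "substN x t \<^bold>\<bottom> = \<^bold>\<bottom>"
| "substN x t (r \<^bold>= s) = (subst_trm x t r \<^bold>= subst_trm x t s)"
| "substN x t (r \<^bold>< s) = (subst_trm x t r \<^bold>< subst_trm x t s)"
| "substN x t (r \<^bold>\<in> X) = (subst_trm x t r \<^bold>\<in> X)"
| "substN x t (\<phi> \<^bold>\<longrightarrow> \<psi>) = (substN x t \<phi> \<^bold>\<longrightarrow> substN x t \<psi>)"
| "substN x t (AllN y \<phi>) = AllN y (if y = x then \<phi> else substN x t \<phi>)"
| "substN x t (AllS Y \<phi>) = AllS Y (substN x t \<phi>)"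

primrec substS :: "name \<Rightarrow> var \<Rightarrow> fm \<Rightarrow> fm" where
  "substS X Z \<^bold>\<bottom> = \<^bold>\<bottom>"
| "substS X Z (r \<^bold>= s) = (r \<^bold>= s)"
| "substS X Z (r \<^bold>< s) = (r \<^bold>< s)"
| "substS X Z (r \<^bold>\<in> Y) = (r \<^bold>\<in> (if Y = Nm X then Z else Y))"
| "substS X Z (\<phi> \<^bold>\<longrightarrow> \<psi>) = (substS X Z \<phi> \<^bold>\<longrightarrow> substS X Z \<psi>)"
| "substS X Z (AllN y \<phi>) = AllN y (substS X Z \<phi>)"
| "substS X Z (AllS Y \<phi>) = AllS Y (if Y = X then \<phi> else substS X Z \<phi>)"


section \<open>Provability\<close>

inductive derives :: "fm set \<Rightarrow> fm \<Rightarrow> bool" (infix "\<turnstile>" 20) where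
  Assm: "\<phi> \<in> \<Gamma> \<Longrightarrow> \<Gamma> \<turnstile> \<phi>"
| ImpI: "insert \<phi> \<Gamma> \<turnstile> \<psi> \<Longrightarrow> \<Gamma> \<turnstile> (\<phi> \<^bold>\<longrightarrow> \<psi>)"
| ImpE: "\<Gamma> \<turnstile> (\<phi> \<^bold>\<longrightarrow> \<psi>) \<Longrightarrow> \<Gamma> \<turnstile> \<phi> \<Longrightarrow> \<Gamma> \<turnstile> \<psi>"
| Contr: "insert (\<^bold>\<not> \<phi>) \<Gamma> \<turnstile> \<^bold>\<bottom> \<Longrightarrow> \<Gamma> \<turnstile> \<phi>"
| AllNI: "\<Gamma> \<turnstile> substN x (Var (Par a)) \<phi> \<Longrightarrow> Par a \<notin> fnv \<phi> \<Longrightarrow> \<forall>\<gamma>\<in>\<Gamma>. Par a \<notin> fnv \<gamma>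
    \<Longrightarrow> \<Gamma> \<turnstile> AllN x \<phi>"
| AllNE: "\<Gamma> \<turnstile> AllN x \<phi> \<Longrightarrow> vars_trm t \<subseteq> range Par \<Longrightarrow> \<Gamma> \<turnstile> substN x t \<phi>"
| AllSI: "\<Gamma> \<turnstile> substS X (Par a) \<phi> \<Longrightarrow> Par a \<notin> fsv \<phi> \<Longrightarrow> \<forall>\<gamma>\<in>\<Gamma>. Par a \<notin> fsv \<gamma>
    \<Longrightarrow> \<Gamma> \<turnstile> AllS X \<phi>"
| AllSE: "\<Gamma> \<turnstile> AllS X \<phi> \<Longrightarrow> \<Gamma> \<turnstile> substS X (Par a) \<phi>"
| EqI: "\<Gamma> \<turnstile> (t \<^bold>= t)"
| EqE: "\<Gamma> \<turnstile> (s \<^bold>= t) \<Longrightarrow> \<Gamma> \<turnstile> substN x s \<phi> \<Longrightarrow> vars_trm s \<subseteq> range Par \<Longrightarrow> vars_trm t \<subseteq> range Par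
    \<Longrightarrow> \<Gamma> \<turnstile> substN x t \<phi>"


section \<open>The theory \<open>RCA\<^sup>*\<^sub>0\<close>\<close>

text \<open>
  \<open>sigma00\<close>: formulas with bounded number quantifiers only; set variables may occur free.
\<close>

inductive sigma00 :: "fm \<Rightarrow> bool" where
  "sigma00 \<^bold>\<bottom>"
| "sigma00 (s \<^bold>= t)"
| "sigma00 (s \<^bold>< t)"
| "sigma00 (s \<^bold>\<in> X)"
| "sigma00 \<phi> \<Longrightarrow> sigma00 \<psi> \<Longrightarrow> sigma00 (\<phi> \<^bold>\<longrightarrow> \<psi>)"
| "sigma00 \<phi> \<Longrightarrow> Nm x \<notin> vars_trm t \<Longrightarrow> sigma00 (AllN x (Var (Nm x) \<^bold>< t \<^bold>\<longrightarrow> \<phi>))"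
| "sigma00 \<phi> \<Longrightarrow> Nm x \<notin> vars_trm t \<Longrightarrow> sigma00 (ExN x (Var (Nm x) \<^bold>< t \<^bold>\<and> \<phi>))"

text \<open>A \<open>\<Delta>\<^sub>0\<close> formula has no set variables at all; \<open>x\<close> is its only free variable.\<close>

definition delta0_in :: "name \<Rightarrow> fm \<Rightarrow> bool" where
  "delta0_in x \<phi> \<longleftrightarrow> sigma00 \<phi> \<and> fsv \<phi> = {} \<and> fnv \<phi> \<subseteq> {Nm x}"

abbreviation nv :: "string \<Rightarrow> trm" where "nv s \<equiv> Var (Nm (s, []))"
abbreviation sv :: "string \<Rightarrow> var" where "sv s \<equiv> Nm (s, [])"

definition alls :: "string list \<Rightarrow> fm \<Rightarrow> fm" where
  "alls xs \<phi> = foldr (\<lambda>s. AllN (s, [])) xs \<phi>"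
definition exs :: "string list \<Rightarrow> fm \<Rightarrow> fm" where
  "exs xs \<phi> = foldr (\<lambda>s. ExN (s, [])) xs \<phi>"

definition Leq :: "trm \<Rightarrow> trm \<Rightarrow> fm" (infix "\<^bold>\<le>" 50) where
  "Leq s t = (s \<^bold>< t \<^bold>\<or> s \<^bold>= t)"

definition basic_axioms :: "fm set" where
  "basic_axioms = {
     alls [''x''] (\<^bold>\<not> (nv ''x'' \<^bold>+ \<^bold>1 \<^bold>= \<^bold>0)),
     alls [''x'', ''y''] (nv ''x'' \<^bold>+ \<^bold>1 \<^bold>= nv ''y'' \<^bold>+ \<^bold>1 \<^bold>\<longrightarrow> nv ''x'' \<^bold>= nv ''y''),
     alls [''x''] (nv ''x'' \<^bold>+ \<^bold>0 \<^bold>= nv ''x''),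
     alls [''x'', ''y''] (nv ''x'' \<^bold>+ (nv ''y'' \<^bold>+ \<^bold>1) \<^bold>= (nv ''x'' \<^bold>+ nv ''y'') \<^bold>+ \<^bold>1),
     alls [''x''] (nv ''x'' \<^bold>* \<^bold>0 \<^bold>= \<^bold>0),
     alls [''x'', ''y''] (nv ''x'' \<^bold>* (nv ''y'' \<^bold>+ \<^bold>1) \<^bold>= nv ''x'' \<^bold>* nv ''y'' \<^bold>+ nv ''x''),
     alls [''x''] (\<^bold>\<not> nv ''x'' \<^bold>< \<^bold>0),
     alls [''x'', ''y''] (nv ''x'' \<^bold>< nv ''y'' \<^bold>+ \<^bold>1 \<^bold>\<longleftrightarrow> nv ''x'' \<^bold>< nv ''y'' \<^bold>\<or> nv ''x'' \<^bold>= nv ''y'')}"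

definition induction_ax :: "name \<Rightarrow> fm \<Rightarrow> fm" where
  "induction_ax x \<phi> =
     (substN x \<^bold>0 \<phi> \<^bold>\<and> AllN x (\<phi> \<^bold>\<longrightarrow> substN x (Var (Nm x) \<^bold>+ \<^bold>1) \<phi>) \<^bold>\<longrightarrow> AllN x \<phi>)"

text \<open>\<open>\<Delta>\<^sup>0\<^sub>1\<close> comprehension, for \<open>\<exists>m \<theta>\<close> and \<open>\<forall>m' \<theta>'\<close> with \<open>\<theta>, \<theta>'\<close> bounded.\<close>

definition comprehension_ax :: "name \<Rightarrow> name \<Rightarrow> name \<Rightarrow> name \<Rightarrow> fm \<Rightarrow> fm \<Rightarrow> fm" where
  "comprehension_ax X n m m' \<theta> \<theta>' =
     (AllN n (ExN m \<theta> \<^bold>\<longleftrightarrow> AllN m' \<theta>') \<^bold>\<longrightarrow> ExS X (AllN n (Var (Nm n) \<^bold>\<in> Nm X \<^bold>\<longleftrightarrow> ExN m \<theta>)))"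

text \<open>The pairing function \<open>(s, t) \<mapsto> (s + t)\<^sup>2 + s\<close>, which is injective.\<close>

definition pr :: "trm \<Rightarrow> trm \<Rightarrow> trm" where
  "pr s t = (s \<^bold>+ t) \<^bold>* (s \<^bold>+ t) \<^bold>+ s"

text \<open>
  \<open>expo s t\<close> says \<open>t = 2\<^sup>s\<close>: some set consists of pairs \<open>(j, u)\<close> each of which is \<open>(0, 1)\<close> or
  arises from an earlier pair \<open>(i, w)\<close> of the set as \<open>(i + 1, 2 w)\<close>, and contains \<open>(s, t)\<close>.  Over the
  basic axioms with bounded induction and \<open>\<Delta>\<^sup>0\<^sub>1\<close> comprehension this is equivalent to the usual
  \<open>\<Delta>\<^sub>0\<close> definition of the graph of exponentiation.
\<close>

definition expo :: "trm \<Rightarrow> trm \<Rightarrow> fm" where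
  "expo s t = ExS (''E'', [])
     (pr s t \<^bold>\<in> sv ''E'' \<^bold>\<and>
      alls [''j'', ''u''] (pr (nv ''j'') (nv ''u'') \<^bold>\<in> sv ''E'' \<^bold>\<longrightarrow>
         (nv ''j'' \<^bold>= \<^bold>0 \<^bold>\<and> nv ''u'' \<^bold>= \<^bold>1) \<^bold>\<or>
         exs [''i'', ''w''] (nv ''j'' \<^bold>= nv ''i'' \<^bold>+ \<^bold>1 \<^bold>\<and> nv ''u'' \<^bold>= nv ''w'' \<^bold>+ nv ''w'' \<^bold>\<and>
            pr (nv ''i'') (nv ''w'') \<^bold>\<in> sv ''E'')))"

definition exp_axiom :: fm where
  "exp_axiom = alls [''x''] (exs [''y''] (expo (nv ''x'') (nv ''y'')))"

definition RCA_star_instances :: "fm set" where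
  "RCA_star_instances = basic_axioms \<union> {exp_axiom}
     \<union> {induction_ax x \<phi> | x \<phi>. sigma00 \<phi>}
     \<union> {comprehension_ax X n m m' \<theta> \<theta>' | X n m m' \<theta> \<theta>'.
          sigma00 \<theta> \<and> sigma00 \<theta>' \<and> Nm X \<notin> fsv \<theta>}"

text \<open>The axioms are the universal closures of the instances.\<close>

definition RCA_star :: "fm set" where
  "RCA_star = {\<phi>. sentence \<phi> \<and>
     (\<exists>xs Xs. \<exists>\<psi>\<in>RCA_star_instances. \<phi> = foldr AllN xs (foldr AllS Xs \<psi>))}"


section \<open>Truth in the standard model\<close>

primrec val_trm :: "(var \<Rightarrow> nat) \<Rightarrow> trm \<Rightarrow> nat" where
  "val_trm e (Var v) = e v"
| "val_trm e \<^bold>0 = 0"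
| "val_trm e \<^bold>1 = 1"
| "val_trm e (s \<^bold>+ t) = val_trm e s + val_trm e t"
| "val_trm e (s \<^bold>* t) = val_trm e s * val_trm e t"

primrec standard_truth :: "(var \<Rightarrow> nat) \<Rightarrow> (var \<Rightarrow> nat set) \<Rightarrow> fm \<Rightarrow> bool" where
  "standard_truth e E \<^bold>\<bottom> = False"
| "standard_truth e E (s \<^bold>= t) = (val_trm e s = val_trm e t)"
| "standard_truth e E (s \<^bold>< t) = (val_trm e s < val_trm e t)"
| "standard_truth e E (s \<^bold>\<in> X) = (val_trm e s \<in> E X)"
| "standard_truth e E (\<phi> \<^bold>\<longrightarrow> \<psi>) = (standard_truth e E \<phi> \<longrightarrow> standard_truth e E \<psi>)"
| "standard_truth e E (AllN x \<phi>) = (\<forall>n. standard_truth (e(Nm x := n)) E \<phi>)"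
| "standard_truth e E (AllS X \<phi>) = (\<forall>A. standard_truth e (E(Nm X := A)) \<phi>)"

text \<open>The set of numbers defined by a formula whose only free variable is the number variable \<open>x\<close>.\<close>

definition defined_set :: "name \<Rightarrow> fm \<Rightarrow> nat set" where
  "defined_set x \<phi> = {n. standard_truth ((\<lambda>_. 0)(Nm x := n)) (\<lambda>_. {}) \<phi>}"


section \<open>Second-order sentences in one function symbol \<open>f\<close> and one constant \<open>c\<close>\<close>

text \<open>
  \<open>ORel i ts\<close> applies the relation variable with index \<open>i\<close> and arity \<open>length ts\<close>; the
  quantifiers \<open>OExR k i\<close> and \<open>OAllR k i\<close> bind the relation variable with index \<open>i\<close> and arity \<open>k\<close>.
\<close>

datatype otm = OVar nat | OC | OF otm

datatype ofm =
    OEq otm otm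
  | ORel nat "otm list"
  | ONot ofm
  | OAnd ofm ofm
  | OEx nat ofm
  | OAll nat ofm
  | OExR nat nat ofm
  | OAllR nat nat ofm

primrec otm_vars :: "otm \<Rightarrow> nat set" where
  "otm_vars (OVar i) = {i}"
| "otm_vars OC = {}"
| "otm_vars (OF t) = otm_vars t"

primrec ofm_fv :: "ofm \<Rightarrow> nat set" where
  "ofm_fv (OEq s t) = otm_vars s \<union> otm_vars t"
| "ofm_fv (ORel i ts) = (\<Union>t\<in>set ts. otm_vars t)"
| "ofm_fv (ONot \<phi>) = ofm_fv \<phi>"
| "ofm_fv (OAnd \<phi> \<psi>) = ofm_fv \<phi> \<union> ofm_fv \<psi>"
| "ofm_fv (OEx i \<phi>) = ofm_fv \<phi> - {i}"
| "ofm_fv (OAll i \<phi>) = ofm_fv \<phi> - {i}"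
| "ofm_fv (OExR k i \<phi>) = ofm_fv \<phi>"
| "ofm_fv (OAllR k i \<phi>) = ofm_fv \<phi>"

primrec ofm_frv :: "ofm \<Rightarrow> (nat \<times> nat) set" where
  "ofm_frv (OEq s t) = {}"
| "ofm_frv (ORel i ts) = {(length ts, i)}"
| "ofm_frv (ONot \<phi>) = ofm_frv \<phi>"
| "ofm_frv (OAnd \<phi> \<psi>) = ofm_frv \<phi> \<union> ofm_frv \<psi>"
| "ofm_frv (OEx i \<phi>) = ofm_frv \<phi>"
| "ofm_frv (OAll i \<phi>) = ofm_frv \<phi>"
| "ofm_frv (OExR k i \<phi>) = ofm_frv \<phi> - {(k, i)}"
| "ofm_frv (OAllR k i \<phi>) = ofm_frv \<phi> - {(k, i)}"

primrec first_order :: "ofm \<Rightarrow> bool" where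
  "first_order (OEq s t) = True"
| "first_order (ORel i ts) = True"
| "first_order (ONot \<phi>) = first_order \<phi>"
| "first_order (OAnd \<phi> \<psi>) = (first_order \<phi> \<and> first_order \<psi>)"
| "first_order (OEx i \<phi>) = first_order \<phi>"
| "first_order (OAll i \<phi>) = first_order \<phi>"
| "first_order (OExR k i \<phi>) = False"
| "first_order (OAllR k i \<phi>) = False"

inductive sigma11 :: "ofm \<Rightarrow> bool" where
  "first_order \<phi> \<Longrightarrow> sigma11 \<phi>"
| "sigma11 \<phi> \<Longrightarrow> sigma11 (OExR k i \<phi>)"

inductive pi11 :: "ofm \<Rightarrow> bool" where
  "first_order \<phi> \<Longrightarrow> pi11 \<phi>"
| "pi11 \<phi> \<Longrightarrow> pi11 (OAllR k i \<phi>)"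

text \<open>
  A \<open>\<Sigma>\<^sup>1\<^sub>1\<close> or \<open>\<Pi>\<^sup>1\<^sub>1\<close> sentence standing alone is admitted; it is equivalent to its conjunction with
  a valid first-order sentence.
\<close>

definition sigma11_pi11_sentence :: "ofm \<Rightarrow> bool" where
  "sigma11_pi11_sentence \<phi> \<longleftrightarrow> ofm_fv \<phi> = {} \<and> ofm_frv \<phi> = {} \<and>
     (sigma11 \<phi> \<or> pi11 \<phi> \<or> (\<exists>\<sigma> \<pi>. \<phi> = OAnd \<sigma> \<pi> \<and> sigma11 \<sigma> \<and> pi11 \<pi>))"

text \<open>
  Goedel numbers: a hexadecimal digit for the outermost constructor, below the code of its arguments.
\<close>

definition pr_nat :: "nat \<Rightarrow> nat \<Rightarrow> nat" where
  "pr_nat m n = (m + n) * (m + n) + m"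

primrec code_otm :: "otm \<Rightarrow> nat" where
  "code_otm (OVar i) = 16 * i"
| "code_otm OC = 1"
| "code_otm (OF t) = 16 * code_otm t + 2"

primrec code_ofm :: "ofm \<Rightarrow> nat" where
  "code_ofm (OEq s t) = 16 * pr_nat (code_otm s) (code_otm t) + 3"
| "code_ofm (ORel i ts) =
     16 * pr_nat i (foldr (\<lambda>t c. Suc (pr_nat (code_otm t) c)) ts 0) + 4"
| "code_ofm (ONot \<phi>) = 16 * code_ofm \<phi> + 5"
| "code_ofm (OAnd \<phi> \<psi>) = 16 * pr_nat (code_ofm \<phi>) (code_ofm \<psi>) + 6"
| "code_ofm (OEx i \<phi>) = 16 * pr_nat i (code_ofm \<phi>) + 7"
| "code_ofm (OAll i \<phi>) = 16 * pr_nat i (code_ofm \<phi>) + 8"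
| "code_ofm (OExR k i \<phi>) = 16 * pr_nat k (pr_nat i (code_ofm \<phi>)) + 9"
| "code_ofm (OAllR k i \<phi>) = 16 * pr_nat k (pr_nat i (code_ofm \<phi>)) + 10"


section \<open>Structures and satisfaction inside the theory\<close>

text \<open>
  A structure is given by the set variables \<open>''A''\<close> and \<open>''F''\<close> (domain and graph of the function)
  and the number variable \<open>''c''\<close>.  None of these is bound in the formulas of this section.
\<close>

definition is_structure :: fm where
  "is_structure = Conj [
     nv ''c'' \<^bold>\<in> sv ''A'',
     alls [''p''] (nv ''p'' \<^bold>\<in> sv ''F'' \<^bold>\<longrightarrow> exs [''a'', ''b'']
        (nv ''a'' \<^bold>\<in> sv ''A'' \<^bold>\<and> nv ''b'' \<^bold>\<in> sv ''A'' \<^bold>\<and> nv ''p'' \<^bold>= pr (nv ''a'') (nv ''b''))),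
     alls [''a''] (nv ''a'' \<^bold>\<in> sv ''A'' \<^bold>\<longrightarrow> exs [''b''] (pr (nv ''a'') (nv ''b'') \<^bold>\<in> sv ''F'' \<^bold>\<and>
        alls [''d''] (pr (nv ''a'') (nv ''d'') \<^bold>\<in> sv ''F'' \<^bold>\<longrightarrow> nv ''d'' \<^bold>= nv ''b'')))]"

text \<open>\<open>''H''\<close> is (the graph of) a bijection of the domain with all numbers that respects \<open>f\<close> and \<open>c\<close>.\<close>

definition isomorphic_to_N :: fm where
  "isomorphic_to_N = ExS (''H'', []) (Conj [
     alls [''p''] (nv ''p'' \<^bold>\<in> sv ''H'' \<^bold>\<longrightarrow> exs [''a'', ''n'']
        (nv ''a'' \<^bold>\<in> sv ''A'' \<^bold>\<and> nv ''p'' \<^bold>= pr (nv ''a'') (nv ''n''))),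
     alls [''a''] (nv ''a'' \<^bold>\<in> sv ''A'' \<^bold>\<longrightarrow> exs [''n''] (pr (nv ''a'') (nv ''n'') \<^bold>\<in> sv ''H'' \<^bold>\<and>
        alls [''m''] (pr (nv ''a'') (nv ''m'') \<^bold>\<in> sv ''H'' \<^bold>\<longrightarrow> nv ''m'' \<^bold>= nv ''n''))),
     alls [''a'', ''b'', ''n''] (pr (nv ''a'') (nv ''n'') \<^bold>\<in> sv ''H'' \<^bold>\<and> pr (nv ''b'') (nv ''n'') \<^bold>\<in> sv ''H''
        \<^bold>\<longrightarrow> nv ''a'' \<^bold>= nv ''b''),
     alls [''n''] (exs [''a''] (pr (nv ''a'') (nv ''n'') \<^bold>\<in> sv ''H'')),
     pr (nv ''c'') \<^bold>0 \<^bold>\<in> sv ''H'',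
     alls [''a'', ''b'', ''n''] (pr (nv ''a'') (nv ''n'') \<^bold>\<in> sv ''H'' \<^bold>\<and> pr (nv ''a'') (nv ''b'') \<^bold>\<in> sv ''F''
        \<^bold>\<longrightarrow> pr (nv ''b'') (nv ''n'' \<^bold>+ \<^bold>1) \<^bold>\<in> sv ''H'')])"

subsection \<open>Fixed standard sentences\<close>

text \<open>
  The object variable with index \<open>i\<close> becomes \<open>(''v'', [i])\<close>, and the relation variable with arity \<open>k\<close>
  and index \<open>i\<close> becomes the set variable \<open>(''R'', [k, i])\<close>, a \<open>k\<close>-tuple being coded by iterated
  pairing.  \<open>tr_tm l t z\<close> says that \<open>z\<close> is the value of \<open>t\<close>.
\<close>

abbreviation iv :: "string \<Rightarrow> nat \<Rightarrow> trm" where "iv s i \<equiv> Var (Nm (s, [i]))"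

primrec tr_tm :: "nat \<Rightarrow> otm \<Rightarrow> trm \<Rightarrow> fm" where
  "tr_tm l (OVar i) z = (z \<^bold>= iv ''v'' i)"
| "tr_tm l OC z = (z \<^bold>= nv ''c'')"
| "tr_tm l (OF t) z = ExN (''u'', [l])
     (iv ''u'' l \<^bold>\<in> sv ''A'' \<^bold>\<and> tr_tm (Suc l) t (iv ''u'' l) \<^bold>\<and> pr (iv ''u'' l) z \<^bold>\<in> sv ''F'')"

fun tuple :: "trm list \<Rightarrow> trm" where
  "tuple [] = \<^bold>0"
| "tuple [t] = t"
| "tuple (t # ts) = pr t (tuple ts)"

definition ex_tuple_in_A :: "string \<Rightarrow> nat \<Rightarrow> fm \<Rightarrow> fm" where
  "ex_tuple_in_A s k \<phi> = foldr (\<lambda>j. ExN (s, [j])) [0..<k]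
     (Conj (map (\<lambda>j. iv s j \<^bold>\<in> sv ''A'') [0..<k]) \<^bold>\<and> \<phi>)"

definition relation_on_A :: "nat \<Rightarrow> var \<Rightarrow> fm" where
  "relation_on_A k R = alls [''p''] (nv ''p'' \<^bold>\<in> R \<^bold>\<longrightarrow>
     ex_tuple_in_A ''a'' k (nv ''p'' \<^bold>= tuple (map (iv ''a'') [0..<k])))"

primrec tr :: "ofm \<Rightarrow> fm" where
  "tr (OEq s t) = exs [''z'']
     (nv ''z'' \<^bold>\<in> sv ''A'' \<^bold>\<and> tr_tm 0 s (nv ''z'') \<^bold>\<and> tr_tm 0 t (nv ''z''))"
| "tr (ORel i ts) = ex_tuple_in_A ''z'' (length ts)
     (Conj (map2 (\<lambda>j t. tr_tm 0 t (iv ''z'' j)) [0..<length ts] ts) \<^bold>\<and>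
      tuple (map (iv ''z'') [0..<length ts]) \<^bold>\<in> Nm (''R'', [length ts, i]))"
| "tr (ONot \<phi>) = (\<^bold>\<not> tr \<phi>)"
| "tr (OAnd \<phi> \<psi>) = (tr \<phi> \<^bold>\<and> tr \<psi>)"
| "tr (OEx i \<phi>) = ExN (''v'', [i]) (iv ''v'' i \<^bold>\<in> sv ''A'' \<^bold>\<and> tr \<phi>)"
| "tr (OAll i \<phi>) = AllN (''v'', [i]) (iv ''v'' i \<^bold>\<in> sv ''A'' \<^bold>\<longrightarrow> tr \<phi>)"
| "tr (OExR k i \<phi>) = ExS (''R'', [k, i]) (relation_on_A k (Nm (''R'', [k, i])) \<^bold>\<and> tr \<phi>)"
| "tr (OAllR k i \<phi>) = AllS (''R'', [k, i]) (relation_on_A k (Nm (''R'', [k, i])) \<^bold>\<longrightarrow> tr \<phi>)"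

subsection \<open>Existential first-order sentences of arbitrary length\<close>

primrec numeral_trm :: "nat \<Rightarrow> trm" where
  "numeral_trm 0 = \<^bold>0"
| "numeral_trm (Suc n) = numeral_trm n \<^bold>+ \<^bold>1"

definition tag :: "nat \<Rightarrow> trm \<Rightarrow> trm" where
  "tag d t = numeral_trm 16 \<^bold>* t \<^bold>+ numeral_trm d"

text \<open>
  Finite sets and finite sequences are coded by numbers in the usual way: \<open>s \<^bold>\<in>\<^sub>c t\<close> says that the
  binary digit of \<open>t\<close> with weight \<open>2\<^sup>s\<close> is one.  The names \<open>''bp''\<close>, \<open>''bq''\<close>, \<open>''br''\<close> are reserved for
  this formula, i.e. must not occur in \<open>s\<close> and \<open>t\<close>.
\<close>

definition in_code :: "trm \<Rightarrow> trm \<Rightarrow> fm" (infix "\<^bold>\<in>\<^sub>c" 50) where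
  "in_code s t = exs [''bp'', ''bq'', ''br''] (Conj [expo s (nv ''bp''), nv ''br'' \<^bold>< nv ''bp'',
     t \<^bold>= nv ''bq'' \<^bold>* (nv ''bp'' \<^bold>+ nv ''bp'') \<^bold>+ (nv ''bp'' \<^bold>+ nv ''br'')])"

text \<open>
  \<open>''x''\<close> is the code of \<open>\<exists>v\<^sub>0 \<dots> \<exists>v\<^sub>n \<theta>\<close>, where \<open>e\<close> is the code of \<open>\<theta>\<close>: \<open>''w''\<close> codes a set of pairs
  \<open>(i, y)\<close> where \<open>y\<close> is what remains of \<open>''x''\<close> after removing the first \<open>i\<close> quantifiers.
\<close>

definition existential_prefix :: fm where
  "existential_prefix = exs [''w''] (
     pr (nv ''n'' \<^bold>+ \<^bold>1) (nv ''e'') \<^bold>\<in>\<^sub>c nv ''w'' \<^bold>\<and>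
     alls [''i'', ''y''] (pr (nv ''i'') (nv ''y'') \<^bold>\<in>\<^sub>c nv ''w'' \<^bold>\<longrightarrow>
        (nv ''i'' \<^bold>= \<^bold>0 \<^bold>\<and> nv ''y'' \<^bold>= nv ''x'') \<^bold>\<or>
        exs [''j'', ''u''] (Conj [nv ''i'' \<^bold>= nv ''j'' \<^bold>+ \<^bold>1, pr (nv ''j'') (nv ''u'') \<^bold>\<in>\<^sub>c nv ''w'',
           nv ''u'' \<^bold>= tag 7 (pr (nv ''j'') (nv ''y''))])))"

text \<open>\<open>''s''\<close> codes a sequence \<open>\<langle>a\<^sub>0, \<dots>, a\<^sub>n\<rangle>\<close> of elements of the structure.\<close>

definition assignment :: fm where
  "assignment =
    (alls [''p''] (nv ''p'' \<^bold>\<in>\<^sub>c nv ''s'' \<^bold>\<longrightarrow> exs [''i'', ''a''] (Conj [nv ''i'' \<^bold>\<le> nv ''n'',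
        nv ''a'' \<^bold>\<in> sv ''A'', nv ''p'' \<^bold>= pr (nv ''i'') (nv ''a'')])) \<^bold>\<and>
     alls [''i''] (nv ''i'' \<^bold>\<le> nv ''n'' \<^bold>\<longrightarrow> exs [''a''] (pr (nv ''i'') (nv ''a'') \<^bold>\<in>\<^sub>c nv ''s'' \<^bold>\<and>
        alls [''b''] (pr (nv ''i'') (nv ''b'') \<^bold>\<in>\<^sub>c nv ''s'' \<^bold>\<longrightarrow> nv ''b'' \<^bold>= nv ''a''))))"

text \<open>
  Tarski's clauses for terms and for quantifier-free formulas.  \<open>''T''\<close> codes a finite set of pairs
  (code of a term, its value), \<open>''V''\<close> one of pairs (code of a formula, its truth value \<open>0\<close> or \<open>1\<close>); every
  pair is justified by the clause for the outermost constructor.  Codes of arguments are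
  smaller, so the clauses determine the values.  In particular all members are codes of terms and of
  quantifier-free formulas in \<open>v\<^sub>0, \<dots>, v\<^sub>n\<close>.
\<close>

definition term_values :: fm where
  "term_values = alls [''y'', ''r''] (pr (nv ''y'') (nv ''r'') \<^bold>\<in>\<^sub>c nv ''T'' \<^bold>\<longrightarrow> Disj [
     exs [''i''] (nv ''y'' \<^bold>= tag 0 (nv ''i'') \<^bold>\<and> pr (nv ''i'') (nv ''r'') \<^bold>\<in>\<^sub>c nv ''s''),
     nv ''y'' \<^bold>= tag 1 \<^bold>0 \<^bold>\<and> nv ''r'' \<^bold>= nv ''c'',
     exs [''t'', ''q''] (Conj [nv ''y'' \<^bold>= tag 2 (nv ''t''), pr (nv ''t'') (nv ''q'') \<^bold>\<in>\<^sub>c nv ''T'',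
        pr (nv ''q'') (nv ''r'') \<^bold>\<in> sv ''F''])])"

definition truth_values :: fm where
  "truth_values = alls [''y'', ''r''] (pr (nv ''y'') (nv ''r'') \<^bold>\<in>\<^sub>c nv ''V'' \<^bold>\<longrightarrow>
     (nv ''r'' \<^bold>= \<^bold>0 \<^bold>\<or> nv ''r'' \<^bold>= \<^bold>1) \<^bold>\<and> Disj [
     exs [''t'', ''t1'', ''q'', ''q1''] (Conj [nv ''y'' \<^bold>= tag 3 (pr (nv ''t'') (nv ''t1'')),
        pr (nv ''t'') (nv ''q'') \<^bold>\<in>\<^sub>c nv ''T'', pr (nv ''t1'') (nv ''q1'') \<^bold>\<in>\<^sub>c nv ''T'',
        nv ''r'' \<^bold>= \<^bold>1 \<^bold>\<longleftrightarrow> nv ''q'' \<^bold>= nv ''q1'']),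
     exs [''t'', ''q''] (Conj [nv ''y'' \<^bold>= tag 5 (nv ''t''), pr (nv ''t'') (nv ''q'') \<^bold>\<in>\<^sub>c nv ''V'',
        nv ''r'' \<^bold>= \<^bold>1 \<^bold>\<longleftrightarrow> nv ''q'' \<^bold>= \<^bold>0]),
     exs [''t'', ''t1'', ''q'', ''q1''] (Conj [nv ''y'' \<^bold>= tag 6 (pr (nv ''t'') (nv ''t1'')),
        pr (nv ''t'') (nv ''q'') \<^bold>\<in>\<^sub>c nv ''V'', pr (nv ''t1'') (nv ''q1'') \<^bold>\<in>\<^sub>c nv ''V'',
        nv ''r'' \<^bold>= \<^bold>1 \<^bold>\<longleftrightarrow> (nv ''q'' \<^bold>= \<^bold>1 \<^bold>\<and> nv ''q1'' \<^bold>= \<^bold>1)])])"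

definition sat_existential :: fm where
  "sat_existential = exs [''n'', ''e'', ''s'', ''T'', ''V''] (Conj [existential_prefix, assignment,
     term_values, truth_values, pr (nv ''e'') \<^bold>1 \<^bold>\<in>\<^sub>c nv ''V''])"

subsection \<open>The formalized equivalence\<close>

text \<open>
  \<open>sat \<Phi>\<close> says that the structure satisfies the sentence \<open>''x''\<close>, which is one of
  the standard sentences in the list \<open>\<Phi>\<close> or an existential first-order sentence of
  possibly nonstandard length; it is false of any other \<open>''x''\<close>.  Hence \<open>characterizes_N \<Xi> \<Phi>\<close>, instantiated with
  the natural numbers, implies that everything satisfying \<open>\<Xi>\<close> is of one of the two kinds.
\<close>

definition sat :: "ofm list \<Rightarrow> fm" where
  "sat \<Phi> = (Disj (map (\<lambda>\<xi>. nv ''x'' \<^bold>= numeral_trm (code_ofm \<xi>) \<^bold>\<and> tr \<xi>) \<Phi>) \<^bold>\<or> sat_existential)"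

definition characterizes_N :: "fm \<Rightarrow> ofm list \<Rightarrow> fm" where
  "characterizes_N \<Xi> \<Phi> = AllS (''A'', []) (AllS (''F'', []) (alls [''c''] (is_structure \<^bold>\<longrightarrow>
     (isomorphic_to_N \<^bold>\<longleftrightarrow> alls [''x''] (\<Xi> \<^bold>\<longrightarrow> sat \<Phi>)))))"


section \<open>Polynomial-time recognizability\<close>

text \<open>
  Deterministic Turing machines with one two-way infinite tape.  Cells contain input letters
  \<open>Inl a\<close> or working symbols \<open>Inr j\<close>; \<open>Inr 0\<close> is the blank.  States are numbers; \<open>0\<close> accepts, \<open>1\<close> rejects
  (both halt), and \<open>2\<close> is initial.  The Boolean in a transition says whether the head moves right.
\<close>

record 'a turing =
  n_states :: nat
  n_work :: nat
  trans :: "nat \<Rightarrow> 'a + nat \<Rightarrow> nat \<times> ('a + nat) \<times> bool"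

definition tape_symbols :: "'a turing \<Rightarrow> ('a + nat) set" where
  "tape_symbols M = range Inl \<union> Inr ` {..<n_work M}"

definition turing_ok :: "'a::finite turing \<Rightarrow> bool" where
  "turing_ok M \<longleftrightarrow> 2 < n_states M \<and> 0 < n_work M \<and>
     (\<forall>q<n_states M. \<forall>a\<in>tape_symbols M.
        case trans M q a of (q', b, _) \<Rightarrow> q' < n_states M \<and> b \<in> tape_symbols M)"

type_synonym 'a config = "nat \<times> (int \<Rightarrow> 'a + nat) \<times> int"

definition step :: "'a turing \<Rightarrow> 'a config \<Rightarrow> 'a config" where
  "step M = (\<lambda>(q, tape, h). if q \<le> 1 then (q, tape, h) else
     case trans M q (tape h) of (q', b, right) \<Rightarrow>
       (q', tape(h := b), if right then h + 1 else h - 1))"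

definition initial :: "'a list \<Rightarrow> 'a config" where
  "initial w = (2, (\<lambda>i. if 0 \<le> i \<and> i < int (length w) then Inl (w ! nat i) else Inr 0), 0)"

definition polytime_recognizable :: "'a::finite list set \<Rightarrow> bool" where
  "polytime_recognizable L \<longleftrightarrow> (\<exists>M d. turing_ok M \<and>
     (\<forall>w. fst ((step M ^^ (length w ^ d + d)) (initial w)) = (if w \<in> L then 0 else 1)))"

text \<open>
  Sentences as words over a finite alphabet, in Polish notation.  Indices and arities are written in
  unary: \<open>v\<^sub>i\<close> is \<open>v\<close> followed by \<open>i\<close> strokes, and a relation variable is \<open>R\<close> followed by one mark for each
  argument place and then by the strokes of its index.  Recognizability of a set of sentences is measured by the length of these
  words; the length of a Goedel number may be exponential in it, because of iterated pairing.
\<close>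

datatype letter =
  L_v | L_stroke | L_c | L_f | L_eq | L_R | L_place | L_not | L_and | L_ex | L_all

instance letter :: finite
proof
  have "UNIV = {L_v, L_stroke, L_c, L_f, L_eq, L_R, L_place, L_not, L_and, L_ex, L_all}"
    using letter.exhaust by blast
  then show "finite (UNIV :: letter set)" by (metis finite.emptyI finite.insertI)
qed

definition word_var :: "nat \<Rightarrow> letter list" where
  "word_var i = L_v # replicate i L_stroke"

definition word_rel :: "nat \<Rightarrow> nat \<Rightarrow> letter list" where
  "word_rel k i = L_R # replicate k L_place @ replicate i L_stroke"

primrec word_otm :: "otm \<Rightarrow> letter list" where
  "word_otm (OVar i) = word_var i"
| "word_otm OC = [L_c]"
| "word_otm (OF t) = L_f # word_otm t"

primrec word :: "ofm \<Rightarrow> letter list" where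
  "word (OEq s t) = L_eq # word_otm s @ word_otm t"
| "word (ORel i ts) = word_rel (length ts) i @ concat (map word_otm ts)"
| "word (ONot \<phi>) = L_not # word \<phi>"
| "word (OAnd \<phi> \<psi>) = L_and # word \<phi> @ word \<psi>"
| "word (OEx i \<phi>) = L_ex # word_var i @ word \<phi>"
| "word (OAll i \<phi>) = L_all # word_var i @ word \<phi>"
| "word (OExR k i \<phi>) = L_ex # word_rel k i @ word \<phi>"
| "word (OAllR k i \<phi>) = L_all # word_rel k i @ word \<phi>"

end

theory Submission
  imports Defs "HOL-Library.Countable_Set"
begin

text \<open>
  Derivability in \<open>RCA\<^sup>*\<^sub>0\<close> is reduced, by a Henkin completeness theorem, to truth in an arbitrary model, which
  is then treated as an ordered semiring together with its family of sets.

  Besides the fixed \<open>\<Pi>\<^sup>1\<^sub>1\<close> sentence \<open>peano_sentence\<close>, the set consists of the sentences \<open>\<exists>v\<^sub>0. v\<^sub>0 = f\<^sup>n c\<close>, with \<open>n\<close> possibly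
  nonstandard.  The truth of the latter yields for each \<open>n\<close> a coded table of the values \<open>f\<^sup>k c\<close>, \<open>k \<le> n\<close>, and hence a
  definable map \<open>h\<close> from all numbers to the structure with \<open>h 0 = c\<close> and \<open>h (n + 1) = f (h n)\<close>.  For surjectivity,
  consider \<open>P\<^sub>b = {h k | k \<le> b}\<close> for those numbers \<open>b\<close> that are elements of the structure: \<open>peano_sentence\<close> applies to
  this family and says that it covers the structure.  Conversely, \<open>peano_sentence\<close> holds in the numbers by
  the pigeonhole principle, since a family of initial segments that all omit \<open>m\<close> cannot be injective.
\<close>

section \<open>Henkin semantics and completeness\<close>

text \<open>The obstacle is the absence of Sigma^0_1 induction. "There is a table of the values f^k
  c for k \<le> n" is a Sigma^0_1 statement about n, so no available induction proves it for every
  n, although each table extends by one entry. The sentences \<open>reach_sentence n\<close> supply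
  what is missing: satisfaction of a sentence of nonstandard length asks for a coded evaluation of
  its subterms, and for f^n c this evaluation is the table. The same weakness shapes the arithmetic
  inside the model. An induction formula must be bounded, so a recursion is justified only where an
  exponential bound on its partial results is known beforehand. Exponentiation itself enters only
  through sets that witness single values, and must be recovered as a decidable function before it
  may occur freely in inductions. Goedel's divisibility coding, which decodes without
  exponentiation, bridges that gap; the binary coding used by the satisfaction predicate becomes
  available afterwards.\<close>

instance var :: countable by countable_datatype
instance trm :: countable by countable_datatype
instance fm :: countable by countable_datatype

text \<open>Set quantifiers range over the family \<open>sets\<close>, not over all subsets of the
  carrier. This is a two-sorted first-order semantics, for which completeness is available.\<close>

record 'a henkin =
  zer :: 'a
  un :: 'a
  add :: "'a \<Rightarrow> 'a \<Rightarrow> 'a"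
  mul :: "'a \<Rightarrow> 'a \<Rightarrow> 'a"
  lt :: "'a \<Rightarrow> 'a \<Rightarrow> bool"
  sets :: "'a set set"

primrec val :: "'a henkin \<Rightarrow> (var \<Rightarrow> 'a) \<Rightarrow> trm \<Rightarrow> 'a" where
  "val M \<rho> (Var v) = \<rho> v"
| "val M \<rho> \<^bold>0 = zer M"
| "val M \<rho> \<^bold>1 = un M"
| "val M \<rho> (s \<^bold>+ t) = add M (val M \<rho> s) (val M \<rho> t)"
| "val M \<rho> (s \<^bold>* t) = mul M (val M \<rho> s) (val M \<rho> t)"

primrec holds :: "'a henkin \<Rightarrow> (var \<Rightarrow> 'a) \<Rightarrow> (var \<Rightarrow> 'a set) \<Rightarrow> fm \<Rightarrow> bool" where
  "holds M \<rho> S \<^bold>\<bottom> \<longleftrightarrow> False"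
| "holds M \<rho> S (s \<^bold>= t) \<longleftrightarrow> val M \<rho> s = val M \<rho> t"
| "holds M \<rho> S (s \<^bold>< t) \<longleftrightarrow> lt M (val M \<rho> s) (val M \<rho> t)"
| "holds M \<rho> S (s \<^bold>\<in> X) \<longleftrightarrow> val M \<rho> s \<in> S X"
| "holds M \<rho> S (\<phi> \<^bold>\<longrightarrow> \<psi>) \<longleftrightarrow> (holds M \<rho> S \<phi> \<longrightarrow> holds M \<rho> S \<psi>)"
| "holds M \<rho> S (AllN x \<phi>) \<longleftrightarrow> (\<forall>a. holds M (\<rho>(Nm x := a)) S \<phi>)"
| "holds M \<rho> S (AllS X \<phi>) \<longleftrightarrow> (\<forall>A\<in>sets M. holds M \<rho> (S(Nm X := A)) \<phi>)"

definition valid_in :: "'a henkin \<Rightarrow> fm \<Rightarrow> bool" where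
  "valid_in M \<phi> \<longleftrightarrow> (\<forall>\<rho> S. range S \<subseteq> sets M \<longrightarrow> holds M \<rho> S \<phi>)"

lemma holds_connectives [simp]:
  "holds M \<rho> S (\<^bold>\<not> \<phi>) \<longleftrightarrow> \<not> holds M \<rho> S \<phi>"
  "holds M \<rho> S (\<phi> \<^bold>\<and> \<psi>) \<longleftrightarrow> holds M \<rho> S \<phi> \<and> holds M \<rho> S \<psi>"
  "holds M \<rho> S (\<phi> \<^bold>\<or> \<psi>) \<longleftrightarrow> holds M \<rho> S \<phi> \<or> holds M \<rho> S \<psi>"
  "holds M \<rho> S (\<phi> \<^bold>\<longleftrightarrow> \<psi>) \<longleftrightarrow> (holds M \<rho> S \<phi> \<longleftrightarrow> holds M \<rho> S \<psi>)"
  "holds M \<rho> S (ExN x \<phi>) \<longleftrightarrow> (\<exists>a. holds M (\<rho>(Nm x := a)) S \<phi>)"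
  "holds M \<rho> S (ExS X \<phi>) \<longleftrightarrow> (\<exists>A\<in>sets M. holds M \<rho> (S(Nm X := A)) \<phi>)"
  by (auto simp: Neg_def And_def Or_def Iff_def ExN_def ExS_def)

lemma val_cong: "(\<And>v. v \<in> vars_trm t \<Longrightarrow> \<rho> v = \<rho>' v) \<Longrightarrow> val M \<rho> t = val M \<rho>' t"
  by (induction t) auto

lemma holds_cong:
  "(\<And>v. v \<in> fnv \<phi> \<Longrightarrow> \<rho> v = \<rho>' v) \<Longrightarrow> (\<And>v. v \<in> fsv \<phi> \<Longrightarrow> S v = S' v)
    \<Longrightarrow> holds M \<rho> S \<phi> = holds M \<rho>' S' \<phi>"
proof (induction \<phi> arbitrary: \<rho> \<rho>' S S')
  case (AllN x \<phi>)
  have "holds M (\<rho>(Nm x := a)) S \<phi> = holds M (\<rho>'(Nm x := a)) S' \<phi>" for a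
    by (rule AllN.IH) (use AllN.prems in auto)
  then show ?case by simp
next
  case (AllS X \<phi>)
  have "holds M \<rho> (S(Nm X := A)) \<phi> = holds M \<rho>' (S'(Nm X := A)) \<phi>" for A
    by (rule AllS.IH) (use AllS.prems in auto)
  then show ?case by simp
next
  case (Imp \<phi> \<psi>)
  have "holds M \<rho> S \<phi> = holds M \<rho>' S' \<phi>" "holds M \<rho> S \<psi> = holds M \<rho>' S' \<psi>"
    by (auto intro!: Imp.IH Imp.prems)
  then show ?case by simp
next
  case (Eq s t)
  then show ?case by (metis Un_iff fnv.simps(2) holds.simps(2) val_cong)
next
  case (Less s t)
  then show ?case by (metis Un_iff fnv.simps(3) holds.simps(3) val_cong)
next
  case (Mem s X)
  then show ?case by (metis fnv.simps(4) fsv.simps(4) holds.simps(4) insertI1 val_cong)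
qed simp

lemma val_subst: "val M \<rho> (subst_trm x t s) = val M (\<rho>(Nm x := val M \<rho> t)) s"
  by (induction s) auto

text \<open>The term may contain \<open>Nm x\<close> itself because the induction axiom replaces x
  by x + 1. Any other bound name y is absent from the term, so nothing is captured.\<close>

lemma holds_substN:
  "vars_trm t \<subseteq> insert (Nm x) (range Par) \<Longrightarrow>
    holds M \<rho> S (substN x t \<phi>) = holds M (\<rho>(Nm x := val M \<rho> t)) S \<phi>"
proof (induction \<phi> arbitrary: \<rho> S)
  case (AllN y \<phi>)
  have "val M (\<rho>(Nm y := a)) t = val M \<rho> t" if "y \<noteq> x" for a
    by (rule val_cong) (use that AllN.prems in auto)
  moreover have "(\<rho>(Nm y := a, Nm x := b)) = \<rho>(Nm x := b, Nm y := a)" if "y \<noteq> x" for a b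
    using that by (simp add: fun_upd_twist)
  ultimately show ?case using AllN
    by (cases "y = x") (simp_all only: substN.simps holds.simps if_True if_False fun_upd_upd simp_thms)
qed (auto simp: val_subst)

lemma holds_substS:
  "holds M \<rho> S (substS X (Par a) \<phi>) = holds M \<rho> (S(Nm X := S (Par a))) \<phi>"
proof (induction \<phi> arbitrary: \<rho> S)
  case (AllS Y \<phi>)
  have "(S(Nm Y := A, Nm X := B)) = S(Nm X := B, Nm Y := A)" if "Y \<noteq> X" for A B
    using that by (simp add: fun_upd_twist)
  then show ?case using AllS
    by (cases "Y = X") (simp_all only: substS.simps holds.simps if_True if_False fun_upd_upd simp_thms
        fun_upd_other var.simps)
qed auto

section \<open>Consistent sets and their Henkin extensions\<close>

definition fresh_pars :: "fm set \<Rightarrow> nat set" where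
  "fresh_pars \<Gamma> = {a. \<forall>\<gamma>\<in>\<Gamma>. Par a \<notin> fnv \<gamma> \<and> Par a \<notin> fsv \<gamma>}"

lemma finite_vars: "finite (vars_trm t)" "finite (fnv \<phi>)" "finite (fsv \<phi>)"
proof -
  show *: "finite (vars_trm t)" for t by (induction t) auto
  show "finite (fnv \<phi>)" by (induction \<phi>) (auto simp: *)
  show "finite (fsv \<phi>)" by (induction \<phi>) auto
qed

lemma infinite_fresh_pars_insert:
  assumes "infinite (fresh_pars \<Gamma>)" shows "infinite (fresh_pars (insert \<phi> \<Gamma>))"
proof -
  have "fresh_pars (insert \<phi> \<Gamma>) = fresh_pars \<Gamma> - Par -` (fnv \<phi> \<union> fsv \<phi>)"
    by (auto simp: fresh_pars_def)
  moreover have "finite (Par -` (fnv \<phi> \<union> fsv \<phi>))"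
    by (intro finite_vimageI) (auto simp: finite_vars inj_def)
  ultimately show ?thesis using assms by simp
qed

lemma derives_contra: "\<Gamma> \<turnstile> (\<^bold>\<not> \<phi>) \<Longrightarrow> \<Gamma> \<turnstile> \<phi> \<Longrightarrow> \<Gamma> \<turnstile> \<^bold>\<bottom>"
  unfolding Neg_def by (rule ImpE)

text \<open>If the negated instance at a fresh parameter were contradictory, the instance would be
  derivable, and generalization over the parameter would give the universal formula whose negation
  is in \<Gamma>. A single new formula uses up finitely many parameters, so infinitely many stay
  fresh.\<close>

lemma henkin_witness:
  assumes con: "\<not> (\<Gamma> \<turnstile> \<^bold>\<bottom>)" and inf: "infinite (fresh_pars \<Gamma>)" and "\<phi> \<in> \<Gamma>"
  obtains \<Delta> where "\<Gamma> \<subseteq> \<Delta>" "\<not> (\<Delta> \<turnstile> \<^bold>\<bottom>)" "infinite (fresh_pars \<Delta>)"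
    "\<And>x \<psi>. \<phi> = (\<^bold>\<not> AllN x \<psi>) \<Longrightarrow> \<exists>a. (\<^bold>\<not> substN x (Var (Par a)) \<psi>) \<in> \<Delta>"
    "\<And>X \<psi>. \<phi> = (\<^bold>\<not> AllS X \<psi>) \<Longrightarrow> \<exists>a. (\<^bold>\<not> substS X (Par a) \<psi>) \<in> \<Delta>"
proof -
  obtain a where a: "a \<in> fresh_pars \<Gamma>"
    using inf infinite_imp_nonempty by blast
  consider (N) x \<psi> where "\<phi> = (\<^bold>\<not> AllN x \<psi>)" | (S) X \<psi> where "\<phi> = (\<^bold>\<not> AllS X \<psi>)"
    | (no) "\<nexists>x \<psi>. \<phi> = (\<^bold>\<not> AllN x \<psi>)" "\<nexists>X \<psi>. \<phi> = (\<^bold>\<not> AllS X \<psi>)" by blast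
  then show ?thesis
  proof cases
    case N
    let ?\<chi> = "substN x (Var (Par a)) \<psi>"
    have "\<not> (insert (\<^bold>\<not> ?\<chi>) \<Gamma> \<turnstile> \<^bold>\<bottom>)"
    proof
      assume "insert (\<^bold>\<not> ?\<chi>) \<Gamma> \<turnstile> \<^bold>\<bottom>"
      then have "\<Gamma> \<turnstile> ?\<chi>" by (rule Contr)
      moreover have "Par a \<notin> fnv \<psi>" using a assms(3) N by (auto simp: fresh_pars_def Neg_def)
      ultimately have "\<Gamma> \<turnstile> AllN x \<psi>" using a by (intro AllNI) (auto simp: fresh_pars_def)
      then show False using con Assm[OF assms(3)] N derives_contra by blast
    qed
    then show ?thesis
      by (intro that[of "insert (\<^bold>\<not> ?\<chi>) \<Gamma>"] infinite_fresh_pars_insert[OF inf])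
        (auto simp: N Neg_def)
  next
    case S
    let ?\<chi> = "substS X (Par a) \<psi>"
    have "\<not> (insert (\<^bold>\<not> ?\<chi>) \<Gamma> \<turnstile> \<^bold>\<bottom>)"
    proof
      assume "insert (\<^bold>\<not> ?\<chi>) \<Gamma> \<turnstile> \<^bold>\<bottom>"
      then have "\<Gamma> \<turnstile> ?\<chi>" by (rule Contr)
      moreover have "Par a \<notin> fsv \<psi>" using a assms(3) S by (auto simp: fresh_pars_def Neg_def)
      ultimately have "\<Gamma> \<turnstile> AllS X \<psi>" using a by (intro AllSI) (auto simp: fresh_pars_def)
      then show False using con Assm[OF assms(3)] S derives_contra by blast
    qed
    then show ?thesis
      by (intro that[of "insert (\<^bold>\<not> ?\<chi>) \<Gamma>"] infinite_fresh_pars_insert[OF inf])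
        (auto simp: S Neg_def)
  next
    case no
    then show ?thesis using that[of \<Gamma>] con inf by blast
  qed
qed

lemma henkin_step:
  assumes con: "\<not> (\<Gamma> \<turnstile> \<^bold>\<bottom>)" and inf: "infinite (fresh_pars \<Gamma>)"
  obtains \<Delta> where "\<Gamma> \<subseteq> \<Delta>" "\<not> (\<Delta> \<turnstile> \<^bold>\<bottom>)" "infinite (fresh_pars \<Delta>)" "\<phi> \<in> \<Delta> \<or> (\<^bold>\<not> \<phi>) \<in> \<Delta>"
    "\<And>x \<psi>. \<phi> = (\<^bold>\<not> AllN x \<psi>) \<Longrightarrow> \<phi> \<in> \<Delta> \<Longrightarrow> \<exists>a. (\<^bold>\<not> substN x (Var (Par a)) \<psi>) \<in> \<Delta>"
    "\<And>X \<psi>. \<phi> = (\<^bold>\<not> AllS X \<psi>) \<Longrightarrow> \<phi> \<in> \<Delta> \<Longrightarrow> \<exists>a. (\<^bold>\<not> substS X (Par a) \<psi>) \<in> \<Delta>"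
proof (cases "insert \<phi> \<Gamma> \<turnstile> \<^bold>\<bottom>")
  case True
  then have neg: "\<Gamma> \<turnstile> (\<^bold>\<not> \<phi>)" unfolding Neg_def by (rule ImpI)
  have con': "\<not> (insert (\<^bold>\<not> \<phi>) \<Gamma> \<turnstile> \<^bold>\<bottom>)"
    using Contr neg derives_contra con by blast
  \<comment> \<open>The witness clauses are conditional on membership of \<phi> and hence hold
    vacuously here.\<close>
  have "\<phi> \<notin> insert (\<^bold>\<not> \<phi>) \<Gamma>"
    using con' derives_contra Assm by (metis insertI1)
  then show ?thesis
    by (intro that[of "insert (\<^bold>\<not> \<phi>) \<Gamma>"] con' infinite_fresh_pars_insert[OF inf]) auto
next
  case False
  obtain \<Delta> where "insert \<phi> \<Gamma> \<subseteq> \<Delta>" "\<not> (\<Delta> \<turnstile> \<^bold>\<bottom>)" "infinite (fresh_pars \<Delta>)"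
    "\<And>x \<psi>. \<phi> = (\<^bold>\<not> AllN x \<psi>) \<Longrightarrow> \<exists>a. (\<^bold>\<not> substN x (Var (Par a)) \<psi>) \<in> \<Delta>"
    "\<And>X \<psi>. \<phi> = (\<^bold>\<not> AllS X \<psi>) \<Longrightarrow> \<exists>a. (\<^bold>\<not> substS X (Par a) \<psi>) \<in> \<Delta>"
    by (rule henkin_witness[OF False infinite_fresh_pars_insert[OF inf], of \<phi>]) auto
  then show ?thesis using that[of \<Delta>] by blast
qed

text \<open>
  Weakening is not available without renaming eigenvariables, so consistency of the limit is
  expressed through its consistent stages.
\<close>

definition henkin_set :: "fm set \<Rightarrow> bool" where
  "henkin_set T \<longleftrightarrow>
    (\<forall>F. finite F \<longrightarrow> F \<subseteq> T \<longrightarrow> (\<exists>\<Gamma>. F \<subseteq> \<Gamma> \<and> \<not> (\<Gamma> \<turnstile> \<^bold>\<bottom>))) \<and>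
    (\<forall>\<phi>. \<phi> \<in> T \<or> (\<^bold>\<not> \<phi>) \<in> T) \<and>
    (\<forall>x \<psi>. (\<^bold>\<not> AllN x \<psi>) \<in> T \<longrightarrow> (\<exists>a. (\<^bold>\<not> substN x (Var (Par a)) \<psi>) \<in> T)) \<and>
    (\<forall>X \<psi>. (\<^bold>\<not> AllS X \<psi>) \<in> T \<longrightarrow> (\<exists>a. (\<^bold>\<not> substS X (Par a) \<psi>) \<in> T))"

lemma henkin_extension:
  assumes "\<not> (\<Gamma> \<turnstile> \<^bold>\<bottom>)" and "infinite (fresh_pars \<Gamma>)"
  obtains T where "\<Gamma> \<subseteq> T" "henkin_set T"
proof -
  define ok where "ok n \<Delta> \<longleftrightarrow> \<not> (\<Delta> \<turnstile> \<^bold>\<bottom>) \<and> infinite (fresh_pars \<Delta>) \<and> \<Gamma> \<subseteq> \<Delta>"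
    for n :: nat and \<Delta>
  define Q where "Q n \<Delta> \<Delta>' \<longleftrightarrow> \<Delta> \<subseteq> \<Delta>' \<and> (let \<phi> = from_nat n in (\<phi> \<in> \<Delta>' \<or> (\<^bold>\<not> \<phi>) \<in> \<Delta>') \<and>
    (\<forall>x \<psi>. \<phi> = (\<^bold>\<not> AllN x \<psi>) \<longrightarrow> \<phi> \<in> \<Delta>' \<longrightarrow> (\<exists>a. (\<^bold>\<not> substN x (Var (Par a)) \<psi>) \<in> \<Delta>')) \<and>
    (\<forall>X \<psi>. \<phi> = (\<^bold>\<not> AllS X \<psi>) \<longrightarrow> \<phi> \<in> \<Delta>' \<longrightarrow> (\<exists>a. (\<^bold>\<not> substS X (Par a) \<psi>) \<in> \<Delta>')))"
    for n and \<Delta> \<Delta>' :: "fm set"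
  have "\<exists>G. \<forall>n. ok n (G n) \<and> Q n (G n) (G (Suc n))"
  proof (rule dependent_nat_choice)
    show "\<exists>\<Delta>. ok 0 \<Delta>" using assms by (auto simp: ok_def)
    show "\<exists>\<Delta>'. ok (Suc n) \<Delta>' \<and> Q n \<Delta> \<Delta>'" if "ok n \<Delta>" for \<Delta> n
    proof -
      have "\<not> (\<Delta> \<turnstile> \<^bold>\<bottom>)" "infinite (fresh_pars \<Delta>)" "\<Gamma> \<subseteq> \<Delta>" using that by (auto simp: ok_def)
      note \<Delta> = this
      let ?\<phi> = "from_nat n :: fm"
      obtain \<Delta>' where "\<Delta> \<subseteq> \<Delta>'" "\<not> (\<Delta>' \<turnstile> \<^bold>\<bottom>)" "infinite (fresh_pars \<Delta>')" "?\<phi> \<in> \<Delta>' \<or> (\<^bold>\<not> ?\<phi>) \<in> \<Delta>'"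
        "\<And>x \<psi>. ?\<phi> = (\<^bold>\<not> AllN x \<psi>) \<Longrightarrow> ?\<phi> \<in> \<Delta>' \<Longrightarrow> \<exists>a. (\<^bold>\<not> substN x (Var (Par a)) \<psi>) \<in> \<Delta>'"
        "\<And>X \<psi>. ?\<phi> = (\<^bold>\<not> AllS X \<psi>) \<Longrightarrow> ?\<phi> \<in> \<Delta>' \<Longrightarrow> \<exists>a. (\<^bold>\<not> substS X (Par a) \<psi>) \<in> \<Delta>'"
        by (rule henkin_step[OF \<Delta>(1,2), of ?\<phi>]) blast
      moreover from this \<Delta>(3) have "\<Gamma> \<subseteq> \<Delta>'" by simp
      ultimately show ?thesis
        unfolding ok_def Q_def Let_def by (intro exI[of _ \<Delta>'] conjI allI impI) simp_all
    qed
  qed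
  then obtain G where G: "\<And>n. ok n (G n)" "\<And>n. Q n (G n) (G (Suc n))" by blast
  have G_decide: "\<phi> \<in> G (Suc (to_nat \<phi>)) \<or> (\<^bold>\<not> \<phi>) \<in> G (Suc (to_nat \<phi>))" for \<phi>
    using G(2)[of "to_nat \<phi>"] unfolding Q_def Let_def from_nat_to_nat by simp
  have G_witN: "\<exists>a. (\<^bold>\<not> substN x (Var (Par a)) \<psi>) \<in> G (Suc (to_nat \<phi>))"
    if "\<phi> = (\<^bold>\<not> AllN x \<psi>)" "\<phi> \<in> G (Suc (to_nat \<phi>))" for x \<psi> \<phi>
    by (rule G(2)[of "to_nat \<phi>", unfolded Q_def Let_def from_nat_to_nat,
        THEN conjunct2, THEN conjunct2, THEN conjunct1, rule_format, OF that])
  have G_witS: "\<exists>a. (\<^bold>\<not> substS X (Par a) \<psi>) \<in> G (Suc (to_nat \<phi>))"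
    if "\<phi> = (\<^bold>\<not> AllS X \<psi>)" "\<phi> \<in> G (Suc (to_nat \<phi>))" for X \<psi> \<phi>
    by (rule G(2)[of "to_nat \<phi>", unfolded Q_def Let_def from_nat_to_nat,
        THEN conjunct2, THEN conjunct2, THEN conjunct2, rule_format, OF that])
  have mono: "G m \<subseteq> G n" if "m \<le> n" for m n
    by (rule lift_Suc_mono_le[of G, OF G(2)[unfolded Q_def, THEN conjunct1] that])
  define T where "T = (\<Union>n. G n)"
  have fin: "\<exists>n. F \<subseteq> G n" if "finite F" "F \<subseteq> T" for F
    using that
  proof (induction F)
    case (insert \<phi> F)
    then obtain m n where "F \<subseteq> G n" "\<phi> \<in> G m" by (auto simp: T_def)
    then have "insert \<phi> F \<subseteq> G (max m n)"
      using mono[of m "max m n"] mono[of n "max m n"] by auto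
    then show ?case by blast
  qed simp
  have decide: "\<phi> \<in> T \<or> (\<^bold>\<not> \<phi>) \<in> T" for \<phi>
    using G_decide[of \<phi>] by (auto simp: T_def)
  \<comment> \<open>A member of the limit is already present at its own stage: that stage decides
    it, and if it had chosen the negation, some later stage would contain both. So every negated
    universal formula in \<open>T\<close> did receive its witness.\<close>
  have stage: "\<phi> \<in> G (Suc (to_nat \<phi>))" if "\<phi> \<in> T" for \<phi>
  proof (rule ccontr)
    assume "\<phi> \<notin> G (Suc (to_nat \<phi>))"
    then have "(\<^bold>\<not> \<phi>) \<in> T" using G_decide[of \<phi>] by (auto simp: T_def)
    then obtain n where "{\<phi>, \<^bold>\<not> \<phi>} \<subseteq> G n" using fin[of "{\<phi>, \<^bold>\<not> \<phi>}"] \<open>\<phi> \<in> T\<close> by auto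
    then show False
      using G(1)[of n] derives_contra[of "G n" \<phi>] Assm by (auto simp: ok_def)
  qed
  have "henkin_set T" unfolding henkin_set_def
  proof (intro conjI allI impI)
    show "\<exists>\<Gamma>. F \<subseteq> \<Gamma> \<and> \<not> (\<Gamma> \<turnstile> \<^bold>\<bottom>)" if "finite F" "F \<subseteq> T" for F
      using fin[OF that] G(1) by (auto simp: ok_def)
    show "\<phi> \<in> T \<or> (\<^bold>\<not> \<phi>) \<in> T" for \<phi> by (rule decide)
    show "\<exists>a. (\<^bold>\<not> substN x (Var (Par a)) \<psi>) \<in> T" if "(\<^bold>\<not> AllN x \<psi>) \<in> T" for x \<psi>
      using G_witN[OF refl stage[OF that]] by (auto simp: T_def)
    show "\<exists>a. (\<^bold>\<not> substS X (Par a) \<psi>) \<in> T" if "(\<^bold>\<not> AllS X \<psi>) \<in> T" for X \<psi>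
      using G_witS[OF refl stage[OF that]] by (auto simp: T_def)
  qed
  moreover have "\<Gamma> \<subseteq> T" using G(1)[of 0] by (auto simp: ok_def T_def)
  ultimately show ?thesis using that by blast
qed

context
  fixes T assumes T: "henkin_set T"
begin

text \<open>Derivability is demanded from every superset of \<open>F\<close>, since all that is
  known of the consistent stage containing \<open>F\<close> and the negation of \<phi> is that it
  extends them.\<close>

lemma henkin_derive:
  assumes "finite F" "F \<subseteq> T" "\<And>\<Gamma>. F \<subseteq> \<Gamma> \<Longrightarrow> \<Gamma> \<turnstile> \<phi>"
  shows "\<phi> \<in> T"
proof (rule ccontr)
  assume "\<phi> \<notin> T"
  then have "(\<^bold>\<not> \<phi>) \<in> T" using T by (auto simp: henkin_set_def)
  then obtain \<Gamma> where "insert (\<^bold>\<not> \<phi>) F \<subseteq> \<Gamma>" "\<not> (\<Gamma> \<turnstile> \<^bold>\<bottom>)"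
    using T assms(1,2) unfolding henkin_set_def by (metis finite_insert insert_subset)
  then show False using assms(3)[of \<Gamma>] derives_contra[of \<Gamma> \<phi>] Assm by auto
qed

lemma henkin_Fls: "\<^bold>\<bottom> \<notin> T"
proof
  assume "\<^bold>\<bottom> \<in> T"
  then obtain \<Gamma> where "{\<^bold>\<bottom>} \<subseteq> \<Gamma>" "\<not> (\<Gamma> \<turnstile> \<^bold>\<bottom>)"
    using T unfolding henkin_set_def by (metis empty_subsetI finite.simps insert_subset)
  then show False using Assm by auto
qed

lemma henkin_Imp: "(\<phi> \<^bold>\<longrightarrow> \<psi>) \<in> T \<longleftrightarrow> (\<phi> \<in> T \<longrightarrow> \<psi> \<in> T)"
proof (intro iffI impI)
  assume "(\<phi> \<^bold>\<longrightarrow> \<psi>) \<in> T" "\<phi> \<in> T"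
  then show "\<psi> \<in> T" by (intro henkin_derive[of "{\<phi> \<^bold>\<longrightarrow> \<psi>, \<phi>}"]) (auto intro: ImpE Assm)
next
  assume *: "\<phi> \<in> T \<longrightarrow> \<psi> \<in> T"
  show "(\<phi> \<^bold>\<longrightarrow> \<psi>) \<in> T"
  proof (cases "\<psi> \<in> T")
    case True
    then show ?thesis by (intro henkin_derive[of "{\<psi>}"]) (auto intro: ImpI Assm)
  next
    case False
    then have "(\<^bold>\<not> \<phi>) \<in> T" using * T by (auto simp: henkin_set_def)
    moreover have "\<Gamma> \<turnstile> (\<phi> \<^bold>\<longrightarrow> \<psi>)" if "(\<^bold>\<not> \<phi>) \<in> \<Gamma>" for \<Gamma>
      by (rule ImpI, rule Contr, rule derives_contra[of _ \<phi>]; rule Assm) (use that in auto)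
    ultimately show ?thesis by (intro henkin_derive[of "{\<^bold>\<not> \<phi>}"]) auto
  qed
qed

lemma henkin_Neg: "(\<^bold>\<not> \<phi>) \<in> T \<longleftrightarrow> \<phi> \<notin> T"
  by (simp add: Neg_def henkin_Imp henkin_Fls)

lemma henkin_AllN:
  "AllN x \<phi> \<in> T \<longleftrightarrow> (\<forall>t. vars_trm t \<subseteq> range Par \<longrightarrow> substN x t \<phi> \<in> T)"
proof (intro iffI allI impI)
  fix t assume "AllN x \<phi> \<in> T" "vars_trm t \<subseteq> range Par"
  then show "substN x t \<phi> \<in> T"
    by (intro henkin_derive[of "{AllN x \<phi>}"]) (auto intro: AllNE Assm)
next
  assume "\<forall>t. vars_trm t \<subseteq> range Par \<longrightarrow> substN x t \<phi> \<in> T"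
  then have "\<nexists>a. (\<^bold>\<not> substN x (Var (Par a)) \<phi>) \<in> T" by (simp add: henkin_Neg)
  then show "AllN x \<phi> \<in> T"
    using T henkin_Neg unfolding henkin_set_def by blast
qed

lemma henkin_AllS: "AllS X \<phi> \<in> T \<longleftrightarrow> (\<forall>a. substS X (Par a) \<phi> \<in> T)"
proof (intro iffI allI)
  fix a assume "AllS X \<phi> \<in> T"
  then show "substS X (Par a) \<phi> \<in> T"
    by (intro henkin_derive[of "{AllS X \<phi>}"]) (auto intro: AllSE Assm)
next
  assume "\<forall>a. substS X (Par a) \<phi> \<in> T"
  then have "\<nexists>a. (\<^bold>\<not> substS X (Par a) \<phi>) \<in> T" by (simp add: henkin_Neg)
  then show "AllS X \<phi> \<in> T"
    using T henkin_Neg unfolding henkin_set_def by blast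
qed

lemma henkin_Eq_refl: "(t \<^bold>= t) \<in> T"
  by (rule henkin_derive[of "{}"]) (auto intro: EqI)

lemma henkin_Eq_subst:
  assumes "(s \<^bold>= t) \<in> T" "substN x s \<phi> \<in> T" "vars_trm s \<subseteq> range Par" "vars_trm t \<subseteq> range Par"
  shows "substN x t \<phi> \<in> T"
proof (rule henkin_derive[of "{s \<^bold>= t, substN x s \<phi>}"])
  show "\<Gamma> \<turnstile> substN x t \<phi>" if "{s \<^bold>= t, substN x s \<phi>} \<subseteq> \<Gamma>" for \<Gamma>
    by (rule EqE[of _ s t x \<phi>]) (use that assms in \<open>auto intro: Assm\<close>)
qed (use assms in auto)

end

text \<open>A measure for the truth lemma: quantifier cases recur to substitution instances, which
  are not subformulas but have equally many connectives.\<close>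

primrec connectives :: "fm \<Rightarrow> nat" where
  "connectives \<^bold>\<bottom> = 0"
| "connectives (s \<^bold>= t) = 0"
| "connectives (s \<^bold>< t) = 0"
| "connectives (s \<^bold>\<in> X) = 0"
| "connectives (\<phi> \<^bold>\<longrightarrow> \<psi>) = Suc (connectives \<phi> + connectives \<psi>)"
| "connectives (AllN x \<phi>) = Suc (connectives \<phi>)"
| "connectives (AllS X \<phi>) = Suc (connectives \<phi>)"

lemma connectives_subst [simp]:
  "connectives (substN x t \<phi>) = connectives \<phi>"
  "connectives (substS X Z \<phi>) = connectives \<phi>"
  by (induction \<phi>) auto

lemma vars_subst_trm: "vars_trm (subst_trm x t s) \<subseteq> (vars_trm s - {Nm x}) \<union> vars_trm t"
  by (induction s) auto

lemma fnv_substN: "fnv (substN x t \<phi>) \<subseteq> (fnv \<phi> - {Nm x}) \<union> vars_trm t"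
proof (induction \<phi>)
  case (Eq r s)
  then show ?case using vars_subst_trm[of x t r] vars_subst_trm[of x t s] by auto
next
  case (Less r s)
  then show ?case using vars_subst_trm[of x t r] vars_subst_trm[of x t s] by auto
next
  case (Mem r X)
  then show ?case using vars_subst_trm[of x t r] by auto
qed auto

lemma fsv_substN [simp]: "fsv (substN x t \<phi>) = fsv \<phi>"
  by (induction \<phi>) auto

lemma fnv_substS [simp]: "fnv (substS X Z \<phi>) = fnv \<phi>"
  by (induction \<phi>) auto

lemma fsv_substS: "fsv (substS X Z \<phi>) \<subseteq> insert Z (fsv \<phi> - {Nm X})"
  by (induction \<phi>) auto

lemma subst_trm_closed [simp]: "vars_trm s \<subseteq> range Par \<Longrightarrow> subst_trm x t s = s"
  by (induction s) auto

section \<open>The term model of a Henkin set\<close>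

locale henkin_term_model =
  fixes T assumes T: "henkin_set T" and basic: "basic_axioms \<subseteq> T"
begin

definition closed :: "trm set" where
  "closed = {t. vars_trm t \<subseteq> range Par}"

definition eq_class :: "trm \<Rightarrow> trm set" where
  "eq_class t = {s \<in> closed. (s \<^bold>= t) \<in> T}"

text \<open>
  The classes are renumbered by natural numbers, because the carrier must later be a type that
  does not depend on \<open>T\<close>.
\<close>

definition elt :: "trm \<Rightarrow> nat" where
  "elt t = to_nat_on (eq_class ` closed) (eq_class t)"

definition rep :: "nat \<Rightarrow> trm" where
  "rep n = (SOME t. t \<in> closed \<and> elt t = n)"

definition ext :: "nat \<Rightarrow> nat set" where
  "ext a = {elt t | t. t \<in> closed \<and> (t \<^bold>\<in> Par a) \<in> T}"

definition term_model :: "nat henkin" where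
  "term_model = \<lparr>zer = elt \<^bold>0, un = elt \<^bold>1, add = \<lambda>m n. elt (rep m \<^bold>+ rep n),
     mul = \<lambda>m n. elt (rep m \<^bold>* rep n), lt = \<lambda>m n. (rep m \<^bold>< rep n) \<in> T, sets = range ext\<rparr>"

lemma closed_simps [simp]: "\<^bold>0 \<in> closed" "\<^bold>1 \<in> closed" "s \<^bold>+ t \<in> closed \<longleftrightarrow> s \<in> closed \<and> t \<in> closed"
  "s \<^bold>* t \<in> closed \<longleftrightarrow> s \<in> closed \<and> t \<in> closed" "Var v \<in> closed \<longleftrightarrow> v \<in> range Par"
  by (auto simp: closed_def)

lemma subst_closed [simp]: "s \<in> closed \<Longrightarrow> subst_trm x t s = s"
  by (simp add: closed_def)

lemma Eq_subst:
  "(s \<^bold>= t) \<in> T \<Longrightarrow> substN x s \<phi> \<in> T \<Longrightarrow> s \<in> closed \<Longrightarrow> t \<in> closed \<Longrightarrow> substN x t \<phi> \<in> T"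
  using henkin_Eq_subst[OF T] by (auto simp: closed_def)

lemma Eq_sym: "(s \<^bold>= t) \<in> T \<Longrightarrow> s \<in> closed \<Longrightarrow> t \<in> closed \<Longrightarrow> (t \<^bold>= s) \<in> T"
  using Eq_subst[of s t "([], [])" "Var (Nm ([], [])) \<^bold>= s"] henkin_Eq_refl[OF T] by simp

lemma Eq_trans:
  "(s \<^bold>= t) \<in> T \<Longrightarrow> (t \<^bold>= u) \<in> T \<Longrightarrow> s \<in> closed \<Longrightarrow> t \<in> closed \<Longrightarrow> u \<in> closed \<Longrightarrow> (s \<^bold>= u) \<in> T"
  using Eq_subst[of t u "([], [])" "s \<^bold>= Var (Nm ([], []))"] by simp

lemma Eq_cong:
  assumes "(s \<^bold>= s') \<in> T" "(t \<^bold>= t') \<in> T" and [simp]: "s \<in> closed" "s' \<in> closed" "t \<in> closed" "t' \<in> closed"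
  shows "(s \<^bold>+ t \<^bold>= s' \<^bold>+ t') \<in> T" "(s \<^bold>* t \<^bold>= s' \<^bold>* t') \<in> T"
    "(s \<^bold>< t) \<in> T \<longleftrightarrow> (s' \<^bold>< t') \<in> T" "(s \<^bold>\<in> X) \<in> T \<longleftrightarrow> (s' \<^bold>\<in> X) \<in> T"
proof -
  let ?v = "Var (Nm ([], []))"
  have "(s' \<^bold>= s) \<in> T" "(t' \<^bold>= t) \<in> T" using assms by (auto intro: Eq_sym)
  have 1: "(s \<^bold>+ t \<^bold>= s' \<^bold>+ t) \<in> T" "(s \<^bold>* t \<^bold>= s' \<^bold>* t) \<in> T"
    using Eq_subst[OF assms(1), of "([], [])" "s \<^bold>+ t \<^bold>= ?v \<^bold>+ t"]
      Eq_subst[OF assms(1), of "([], [])" "s \<^bold>* t \<^bold>= ?v \<^bold>* t"] henkin_Eq_refl[OF T] by auto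
  then show "(s \<^bold>+ t \<^bold>= s' \<^bold>+ t') \<in> T" "(s \<^bold>* t \<^bold>= s' \<^bold>* t') \<in> T"
    using Eq_subst[OF assms(2), of "([], [])" "s \<^bold>+ t \<^bold>= s' \<^bold>+ ?v"]
      Eq_subst[OF assms(2), of "([], [])" "s \<^bold>* t \<^bold>= s' \<^bold>* ?v"] by auto
  have "(u' \<^bold>< w') \<in> T" if "(u \<^bold>< w) \<in> T" "(u \<^bold>= u') \<in> T" "(w \<^bold>= w') \<in> T"
    and [simp]: "u \<in> closed" "u' \<in> closed" "w \<in> closed" "w' \<in> closed" for u u' w w'
    using Eq_subst[OF that(2), of "([], [])" "?v \<^bold>< w"]
      Eq_subst[OF that(3), of "([], [])" "u' \<^bold>< ?v"] that(1) by auto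
  then show "(s \<^bold>< t) \<in> T \<longleftrightarrow> (s' \<^bold>< t') \<in> T"
    using assms \<open>(s' \<^bold>= s) \<in> T\<close> \<open>(t' \<^bold>= t) \<in> T\<close> by blast
  show "(s \<^bold>\<in> X) \<in> T \<longleftrightarrow> (s' \<^bold>\<in> X) \<in> T"
    using Eq_subst[OF assms(1), of "([], [])" "?v \<^bold>\<in> X"]
      Eq_subst[OF \<open>(s' \<^bold>= s) \<in> T\<close>, of "([], [])" "?v \<^bold>\<in> X"] by auto
qed

lemma eq_class_eq:
  assumes [simp]: "s \<in> closed" "t \<in> closed"
  shows "eq_class s = eq_class t \<longleftrightarrow> (s \<^bold>= t) \<in> T"
proof
  assume "eq_class s = eq_class t"
  moreover have "s \<in> eq_class s" by (simp add: eq_class_def henkin_Eq_refl[OF T])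
  ultimately show "(s \<^bold>= t) \<in> T" by (simp add: eq_class_def)
next
  assume "(s \<^bold>= t) \<in> T"
  moreover from this have "(t \<^bold>= s) \<in> T" by (rule Eq_sym) simp_all
  ultimately show "eq_class s = eq_class t"
    by (auto simp: eq_class_def intro: Eq_trans[of _ t s] Eq_trans[of _ s t])
qed

lemma numeral_closed [simp]: "numeral_trm n \<in> closed"
  by (induction n) auto

lemma AllN_closed: "AllN x \<phi> \<in> T \<Longrightarrow> t \<in> closed \<Longrightarrow> substN x t \<phi> \<in> T"
  using henkin_AllN[OF T] by (auto simp: closed_def)

text \<open>The first two basic axioms keep numerals inequivalent. This provides infinitely many
  classes of closed terms, so that their renumbering is onto all natural numbers.\<close>

lemma numeral_Eq: "(numeral_trm m \<^bold>= numeral_trm n) \<in> T \<Longrightarrow> m = n"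
proof (induction m arbitrary: n)
  have zero: "(t \<^bold>+ \<^bold>1 \<^bold>= \<^bold>0) \<notin> T" if "t \<in> closed" for t
  proof -
    have "alls [''x''] (\<^bold>\<not> (nv ''x'' \<^bold>+ \<^bold>1 \<^bold>= \<^bold>0)) \<in> T" using basic by (auto simp: basic_axioms_def)
    then have "AllN (''x'', []) (\<^bold>\<not> (nv ''x'' \<^bold>+ \<^bold>1 \<^bold>= \<^bold>0)) \<in> T" by (simp add: alls_def)
    from AllN_closed[OF this that] show ?thesis
      by (simp add: Neg_def henkin_Imp[OF T] henkin_Fls[OF T])
  qed
  {
    case 0
    show ?case
    proof (cases n)
      case (Suc n')
      then have "(numeral_trm n' \<^bold>+ \<^bold>1 \<^bold>= \<^bold>0) \<in> T" using 0 by (auto intro: Eq_sym)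
      then show ?thesis using zero by simp
    qed simp
  next
    case (Suc m)
    have inj: "(s \<^bold>= t) \<in> T" if "(s \<^bold>+ \<^bold>1 \<^bold>= t \<^bold>+ \<^bold>1) \<in> T" "s \<in> closed" "t \<in> closed" for s t
    proof -
      have "alls [''x'', ''y''] (nv ''x'' \<^bold>+ \<^bold>1 \<^bold>= nv ''y'' \<^bold>+ \<^bold>1 \<^bold>\<longrightarrow> nv ''x'' \<^bold>= nv ''y'') \<in> T"
        using basic by (auto simp: basic_axioms_def)
      then have "AllN (''x'', []) (AllN (''y'', [])
        (nv ''x'' \<^bold>+ \<^bold>1 \<^bold>= nv ''y'' \<^bold>+ \<^bold>1 \<^bold>\<longrightarrow> nv ''x'' \<^bold>= nv ''y'')) \<in> T" by (simp add: alls_def)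
      from AllN_closed[OF this that(2)] have
        "AllN (''y'', []) (s \<^bold>+ \<^bold>1 \<^bold>= nv ''y'' \<^bold>+ \<^bold>1 \<^bold>\<longrightarrow> s \<^bold>= nv ''y'') \<in> T" by simp
      from AllN_closed[OF this that(3)] show ?thesis using that by (simp add: henkin_Imp[OF T])
    qed
    show ?case
    proof (cases n)
      case 0
      then show ?thesis using Suc.prems zero by simp
    next
      case (Suc n')
      then show ?thesis using Suc.prems inj Suc.IH by simp
    qed
  }
qed

lemma elt_eq: "s \<in> closed \<Longrightarrow> t \<in> closed \<Longrightarrow> elt s = elt t \<longleftrightarrow> (s \<^bold>= t) \<in> T"
  unfolding elt_def by (subst inj_on_eq_iff[OF inj_on_to_nat_on]) (auto simp: eq_class_eq)

lemma elt_surj: "\<exists>t\<in>closed. elt t = n"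
proof -
  have "inj (\<lambda>n. eq_class (numeral_trm n))"
    by (intro injI) (simp add: eq_class_eq numeral_Eq)
  then have "infinite (range (\<lambda>n. eq_class (numeral_trm n)))"
    using range_inj_infinite by blast
  moreover have "range (\<lambda>n. eq_class (numeral_trm n)) \<subseteq> eq_class ` closed" by auto
  ultimately have "infinite (eq_class ` closed)" using finite_subset by blast
  then have "bij_betw (to_nat_on (eq_class ` closed)) (eq_class ` closed) UNIV"
    by (intro to_nat_on_infinite) auto
  then have "n \<in> to_nat_on (eq_class ` closed) ` eq_class ` closed" by (simp add: bij_betw_def)
  then show ?thesis by (auto simp: elt_def)
qed

lemma rep: "rep n \<in> closed" "elt (rep n) = n"
  using elt_surj[of n] someI_ex[of "\<lambda>t. t \<in> closed \<and> elt t = n"] by (auto simp: rep_def)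

lemma rep_elt: "t \<in> closed \<Longrightarrow> (rep (elt t) \<^bold>= t) \<in> T"
  using rep elt_eq by blast

context
  fixes \<rho> :: "var \<Rightarrow> nat" and S :: "var \<Rightarrow> nat set"
  assumes \<rho>: "\<And>a. \<rho> (Par a) = elt (Var (Par a))" and S: "\<And>a. S (Par a) = ext a"
begin

lemma val_term_model: "t \<in> closed \<Longrightarrow> val term_model \<rho> t = elt t"
proof (induction t)
  case (Var v)
  then show ?case using \<rho> by auto
next
  case (Plus s t)
  then show ?case by (simp add: term_model_def elt_eq rep rep_elt Eq_cong)
next
  case (Times s t)
  then show ?case by (simp add: term_model_def elt_eq rep rep_elt Eq_cong)
qed (simp_all add: term_model_def)

text \<open>The truth lemma. Every element of the carrier is the class of a closed term and every
  set is the extension of a parameter, so both kinds of quantifier reduce to the corresponding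
  property of \<open>T\<close>.\<close>

lemma holds_term_model:
  "fnv \<phi> \<subseteq> range Par \<Longrightarrow> fsv \<phi> \<subseteq> range Par \<Longrightarrow> holds term_model \<rho> S \<phi> \<longleftrightarrow> \<phi> \<in> T"
proof (induction \<phi> rule: measure_induct_rule[of connectives])
  case (less \<phi>)
  show ?case
  proof (cases \<phi>)
    case Fls
    then show ?thesis by (simp add: henkin_Fls[OF T])
  next
    case (Eq s t)
    then have "s \<in> closed" "t \<in> closed" using less.prems by (auto simp: closed_def)
    then show ?thesis using Eq by (simp add: val_term_model elt_eq)
  next
    case (Less s t)
    then have *: "s \<in> closed" "t \<in> closed" using less.prems by (auto simp: closed_def)
    then have "(rep (elt s) \<^bold>< rep (elt t)) \<in> T \<longleftrightarrow> (s \<^bold>< t) \<in> T"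
      by (intro Eq_cong rep_elt) (auto simp: rep)
    then show ?thesis using Less * by (simp add: val_term_model) (simp add: term_model_def)
  next
    case (Mem s X)
    then obtain a where a: "X = Par a" and *: "s \<in> closed" using less.prems by (auto simp: closed_def)
    have "elt s \<in> ext a \<longleftrightarrow> (s \<^bold>\<in> Par a) \<in> T"
      using * Eq_cong(4) elt_eq henkin_Eq_refl[OF T] unfolding ext_def by blast
    then show ?thesis using Mem a * S by (simp add: val_term_model)
  next
    case (Imp \<psi> \<chi>)
    then show ?thesis using less.IH[of \<psi>] less.IH[of \<chi>] less.prems by (simp add: henkin_Imp[OF T])
  next
    case (AllN x \<psi>)
    have "holds term_model (\<rho>(Nm x := elt t)) S \<psi> \<longleftrightarrow> substN x t \<psi> \<in> T" if "t \<in> closed" for t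
    proof -
      have "holds term_model (\<rho>(Nm x := elt t)) S \<psi> = holds term_model \<rho> S (substN x t \<psi>)"
        using that by (subst holds_substN) (auto simp: val_term_model closed_def)
      also have "\<dots> \<longleftrightarrow> substN x t \<psi> \<in> T"
        using AllN less.prems that fnv_substN[of x t \<psi>] by (intro less.IH) (auto simp: closed_def)
      finally show ?thesis .
    qed
    then have "holds term_model \<rho> S \<phi> \<longleftrightarrow> (\<forall>t\<in>closed. substN x t \<psi> \<in> T)"
      using AllN elt_surj by (metis holds.simps(6))
    then show ?thesis using AllN henkin_AllN[OF T] by (auto simp: closed_def)
  next
    case (AllS X \<psi>)
    have "holds term_model \<rho> (S(Nm X := ext a)) \<psi> \<longleftrightarrow> substS X (Par a) \<psi> \<in> T" for a
    proof -
      have "holds term_model \<rho> (S(Nm X := ext a)) \<psi> = holds term_model \<rho> S (substS X (Par a) \<psi>)"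
        by (simp only: holds_substS S)
      also have "\<dots> \<longleftrightarrow> substS X (Par a) \<psi> \<in> T"
        using AllS less.prems fsv_substS[of X "Par a" \<psi>] by (intro less.IH) auto
      finally show ?thesis .
    qed
    moreover have "sets term_model = range ext" by (simp add: term_model_def)
    ultimately have "holds term_model \<rho> S \<phi> \<longleftrightarrow> (\<forall>a. substS X (Par a) \<psi> \<in> T)"
      using AllS by simp
    then show ?thesis using AllS henkin_AllS[OF T] by simp
  qed
qed

end

lemma sentence_term_model:
  assumes "sentence \<phi>" shows "valid_in term_model \<phi> \<longleftrightarrow> \<phi> \<in> T"
proof -
  let ?\<rho> = "\<lambda>v. elt (Var v)" and ?S = "\<lambda>v. case v of Par a \<Rightarrow> ext a | _ \<Rightarrow> ext 0"
  have *: "holds term_model \<rho> S \<phi> \<longleftrightarrow> \<phi> \<in> T" for \<rho> S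
  proof -
    have "holds term_model \<rho> S \<phi> = holds term_model ?\<rho> ?S \<phi>"
      by (rule holds_cong) (use assms in \<open>auto simp: sentence_def\<close>)
    also have "\<dots> \<longleftrightarrow> \<phi> \<in> T"
      by (rule holds_term_model) (use assms in \<open>auto simp: sentence_def\<close>)
    finally show ?thesis .
  qed
  have "range ?S \<subseteq> sets term_model" by (auto simp: term_model_def split: var.split)
  with * show "valid_in term_model \<phi> \<longleftrightarrow> \<phi> \<in> T" unfolding valid_in_def by blast
qed

end

text \<open>Sentences leave all parameters fresh, so a Henkin extension exists; the basic axioms
  make the term model occupy all of \<open>nat\<close>. Countability of the family of sets is
  recorded because each set is later named by a variable with a numerical index.\<close>

theorem completeness:
  assumes "\<And>\<gamma>. \<gamma> \<in> \<Gamma> \<Longrightarrow> sentence \<gamma>" "sentence \<phi>" "basic_axioms \<subseteq> \<Gamma>" "\<not> (\<Gamma> \<turnstile> \<phi>)"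
  obtains M :: "nat henkin" where "\<And>\<gamma>. \<gamma> \<in> \<Gamma> \<Longrightarrow> valid_in M \<gamma>" "\<not> valid_in M \<phi>" "sets M \<noteq> {}" "countable (sets M)"
proof -
  have "\<not> (insert (\<^bold>\<not> \<phi>) \<Gamma> \<turnstile> \<^bold>\<bottom>)" using assms(4) Contr by blast
  moreover have "fresh_pars (insert (\<^bold>\<not> \<phi>) \<Gamma>) = UNIV"
    using assms(1,2) by (auto simp: fresh_pars_def sentence_def Neg_def)
  ultimately obtain T where Th: "insert (\<^bold>\<not> \<phi>) \<Gamma> \<subseteq> T" "henkin_set T"
    using henkin_extension[of "insert (\<^bold>\<not> \<phi>) \<Gamma>"] by auto
  interpret henkin_term_model T
    using Th assms(3) by unfold_locales auto
  have "\<phi> \<notin> T" using Th henkin_Neg[OF T] by auto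
  then show ?thesis
    using that[of term_model] Th(1) sentence_term_model assms(1,2)
    by (auto simp: term_model_def)
qed

lemma vars_connectives [simp]:
  "fnv (\<^bold>\<not> \<phi>) = fnv \<phi>" "fsv (\<^bold>\<not> \<phi>) = fsv \<phi>"
  "fnv (\<phi> \<^bold>\<and> \<psi>) = fnv \<phi> \<union> fnv \<psi>" "fsv (\<phi> \<^bold>\<and> \<psi>) = fsv \<phi> \<union> fsv \<psi>"
  "fnv (\<phi> \<^bold>\<or> \<psi>) = fnv \<phi> \<union> fnv \<psi>" "fsv (\<phi> \<^bold>\<or> \<psi>) = fsv \<phi> \<union> fsv \<psi>"
  "fnv (\<phi> \<^bold>\<longleftrightarrow> \<psi>) = fnv \<phi> \<union> fnv \<psi>" "fsv (\<phi> \<^bold>\<longleftrightarrow> \<psi>) = fsv \<phi> \<union> fsv \<psi>"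
  "fnv (ExN x \<phi>) = fnv \<phi> - {Nm x}" "fsv (ExN x \<phi>) = fsv \<phi>"
  "fnv (ExS X \<phi>) = fnv \<phi>" "fsv (ExS X \<phi>) = fsv \<phi> - {Nm X}"
  by (auto simp: Neg_def And_def Or_def Iff_def ExN_def ExS_def)

lemma vars_numeral_trm [simp]: "vars_trm (numeral_trm n) = {}"
  by (induction n) auto

section \<open>Soundness and the standard model\<close>

lemma holds_fresh_num: "v \<notin> fnv \<phi> \<Longrightarrow> holds M (\<rho>(v := a)) S \<phi> = holds M \<rho> S \<phi>"
  by (rule holds_cong) auto

lemma holds_fresh_set: "v \<notin> fsv \<phi> \<Longrightarrow> holds M \<rho> (S(v := A)) \<phi> = holds M \<rho> S \<phi>"
  by (rule holds_cong) auto

text \<open>With the standard model it gives consistency of \<open>RCA_star\<close>, and hence some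
  model of the theory even in the case that \<open>characterization\<close> is derivable.\<close>

theorem soundness:
  "\<Gamma> \<turnstile> \<phi> \<Longrightarrow> range S \<subseteq> sets M \<Longrightarrow> (\<And>\<gamma>. \<gamma> \<in> \<Gamma> \<Longrightarrow> holds M \<rho> S \<gamma>) \<Longrightarrow> holds M \<rho> S \<phi>"
proof (induction arbitrary: \<rho> S rule: derives.induct)
  case (Contr \<phi> \<Gamma>)
  then show ?case by (metis holds.simps(1) holds_connectives(1) insert_iff)
next
  case (AllNI \<Gamma> x a \<phi>)
  have "holds M (\<rho>(Nm x := n)) S \<phi>" for n
  proof -
    have "holds M (\<rho>(Par a := n)) S \<gamma>" if "\<gamma> \<in> \<Gamma>" for \<gamma>
      using that AllNI.prems(2) AllNI.hyps(3) by (simp add: holds_fresh_num)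
    then have "holds M (\<rho>(Par a := n)) S (substN x (Var (Par a)) \<phi>)"
      by (rule AllNI.IH[OF AllNI.prems(1)])
    then have "holds M (\<rho>(Par a := n, Nm x := n)) S \<phi>" by (simp add: holds_substN)
    then show ?thesis
      using holds_fresh_num[OF AllNI.hyps(2), of M "\<rho>(Nm x := n)" n S] by (simp add: fun_upd_twist)
  qed
  then show ?case by simp
next
  case (AllNE \<Gamma> x \<phi> t)
  have "holds M \<rho> S (AllN x \<phi>)" by (rule AllNE.IH[OF AllNE.prems])
  moreover have "holds M \<rho> S (substN x t \<phi>) = holds M (\<rho>(Nm x := val M \<rho> t)) S \<phi>"
    using AllNE.hyps by (intro holds_substN) auto
  ultimately show ?case by simp
next
  case (AllSI \<Gamma> X a \<phi>)
  have "holds M \<rho> (S(Nm X := A)) \<phi>" if "A \<in> sets M" for A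
  proof -
    have "range (S(Par a := A)) \<subseteq> sets M" using that AllSI.prems(1) by auto
    moreover have "holds M \<rho> (S(Par a := A)) \<gamma>" if "\<gamma> \<in> \<Gamma>" for \<gamma>
      using that AllSI.prems(2) AllSI.hyps(3) by (simp add: holds_fresh_set)
    ultimately have "holds M \<rho> (S(Par a := A)) (substS X (Par a) \<phi>)"
      by (rule AllSI.IH)
    then have "holds M \<rho> (S(Par a := A, Nm X := A)) \<phi>" by (simp add: holds_substS)
    then show ?thesis
      using holds_fresh_set[OF AllSI.hyps(2), of M \<rho> "S(Nm X := A)" A] by (simp add: fun_upd_twist)
  qed
  then show ?case by simp
next
  case (AllSE \<Gamma> X \<phi> a)
  have "holds M \<rho> S (AllS X \<phi>)" by (rule AllSE.IH[OF AllSE.prems])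
  moreover have "S (Par a) \<in> sets M" using AllSE.prems(1) by auto
  ultimately show ?case by (simp add: holds_substS del: fun_upd_apply)
next
  case (EqE \<Gamma> s t x \<phi>)
  have "val M \<rho> s = val M \<rho> t" using EqE.IH(1)[OF EqE.prems] by simp
  moreover have "holds M \<rho> S (substN x s \<phi>)" by (rule EqE.IH(2)[OF EqE.prems])
  moreover have "holds M \<rho> S (substN x u \<phi>) = holds M (\<rho>(Nm x := val M \<rho> u)) S \<phi>"
    if "u \<in> {s, t}" for u
    using EqE.hyps that by (intro holds_substN) auto
  ultimately show ?case by simp
next
  case (ImpI \<phi> \<Gamma> \<psi>)
  then show ?case by (metis holds.simps(5) insert_iff)
qed auto

lemma valid_in_AllN [simp]: "valid_in M (AllN x \<phi>) \<longleftrightarrow> valid_in M \<phi>"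
  unfolding valid_in_def by simp (metis fun_upd_triv)

lemma valid_in_AllS [simp]:
  fixes M :: "'a henkin"
  shows "valid_in M (AllS X \<phi>) \<longleftrightarrow> valid_in M \<phi>"
proof
  assume *: "valid_in M (AllS X \<phi>)"
  show "valid_in M \<phi>" unfolding valid_in_def
  proof (intro allI impI)
    fix \<rho> and S :: "var \<Rightarrow> 'a set" assume S: "range S \<subseteq> sets M"
    then have "\<forall>A\<in>sets M. holds M \<rho> (S(Nm X := A)) \<phi>" using * by (auto simp: valid_in_def)
    then show "holds M \<rho> S \<phi>" using S by (metis fun_upd_triv rangeI subsetD)
  qed
next
  assume *: "valid_in M \<phi>"
  show "valid_in M (AllS X \<phi>)" unfolding valid_in_def
  proof (intro allI impI)
    fix \<rho> and S :: "var \<Rightarrow> 'a set" assume "range S \<subseteq> sets M"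
    then have "range (S(Nm X := A)) \<subseteq> sets M" if "A \<in> sets M" for A
      using that by (auto simp: image_subset_iff)
    then show "holds M \<rho> S (AllS X \<phi>)" using * by (auto simp: valid_in_def)
  qed
qed

lemma valid_in_closure:
  "valid_in M (foldr AllN xs (foldr AllS Xs \<psi>)) \<longleftrightarrow> valid_in M \<psi>"
proof -
  have "valid_in M (foldr AllS Xs \<psi>) \<longleftrightarrow> valid_in M \<psi>" by (induction Xs) auto
  moreover have "valid_in M (foldr AllN xs \<phi>) \<longleftrightarrow> valid_in M \<phi>" for \<phi> by (induction xs) auto
  ultimately show ?thesis by simp
qed

lemma fv_foldr:
  "fnv (foldr AllN xs \<phi>) = fnv \<phi> - Nm ` set xs" "fsv (foldr AllN xs \<phi>) = fsv \<phi>"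
  "fnv (foldr AllS xs \<phi>) = fnv \<phi>" "fsv (foldr AllS xs \<phi>) = fsv \<phi> - Nm ` set xs"
  by (induction xs) auto

text \<open>The closures that make up \<open>RCA_star\<close> bind names, never parameters; hence
  the two conditions on free variables. For this reason elements and sets of the model are later
  denoted by names.\<close>

lemma RCA_star_instance_valid:
  assumes "\<And>\<gamma>. \<gamma> \<in> RCA_star \<Longrightarrow> valid_in M \<gamma>" and "\<psi> \<in> RCA_star_instances"
    and "fnv \<psi> \<subseteq> range Nm" "fsv \<psi> \<subseteq> range Nm"
  shows "valid_in M \<psi>"
proof -
  obtain xs where xs: "Nm ` set xs = fnv \<psi>"
    using assms(3) finite_vars(2) by (metis finite_list finite_subset_image)
  obtain Xs where Xs: "Nm ` set Xs = fsv \<psi>"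
    using assms(4) finite_vars(3) by (metis finite_list finite_subset_image)
  have "foldr AllN xs (foldr AllS Xs \<psi>) \<in> RCA_star"
    using assms(2) xs Xs by (auto simp: RCA_star_def sentence_def fv_foldr)
  then show ?thesis using assms(1) valid_in_closure by blast
qed

lemma RCA_star_sentence: "\<phi> \<in> RCA_star \<Longrightarrow> sentence \<phi>"
  by (simp add: RCA_star_def)

lemma basic_axioms_RCA_star: "basic_axioms \<subseteq> RCA_star"
proof
  fix \<phi> assume *: "\<phi> \<in> basic_axioms"
  then have "sentence \<phi>" by (auto simp: basic_axioms_def sentence_def alls_def)
  moreover have "\<phi> = foldr AllN [] (foldr AllS [] \<phi>)" by simp
  ultimately show "\<phi> \<in> RCA_star"
    using * unfolding RCA_star_def RCA_star_instances_def by blast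
qed

lemma holds_alls_exs [simp]:
  "holds M \<rho> S (alls [] \<phi>) \<longleftrightarrow> holds M \<rho> S \<phi>"
  "holds M \<rho> S (alls (x # xs) \<phi>) \<longleftrightarrow> (\<forall>a. holds M (\<rho>(Nm (x, []) := a)) S (alls xs \<phi>))"
  "holds M \<rho> S (exs [] \<phi>) \<longleftrightarrow> holds M \<rho> S \<phi>"
  "holds M \<rho> S (exs (x # xs) \<phi>) \<longleftrightarrow> (\<exists>a. holds M (\<rho>(Nm (x, []) := a)) S (exs xs \<phi>))"
  by (auto simp: alls_def exs_def)

section \<open>The natural numbers as a model of the theory\<close>

definition standard :: "nat henkin" where
  "standard = \<lparr>zer = 0, un = 1, add = (+), mul = (*), lt = (<), sets = UNIV\<rparr>"

lemma standard_simps [simp]: "zer standard = 0" "un standard = 1" "add standard = (+)"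
  "mul standard = (*)" "lt standard = (<)" "sets standard = UNIV"
  by (simp_all add: standard_def)

text \<open>The values with m + n = s lie between s^2 and s^2 + s, below (s + 1)^2. So the code
  determines s, and then m as the excess over s^2.\<close>

lemma pr_nat_inj: "pr_nat m n = pr_nat m' n' \<longleftrightarrow> m = m' \<and> n = n'"
proof
  assume eq: "pr_nat m n = pr_nat m' n'"
  have *: "(a + b) * (a + b) + a < (c + d) * (c + d) + c" if "a + b < c + d" for a b c d :: nat
  proof -
    have "(a + b + 1) * (a + b + 1) \<le> (c + d) * (c + d)" using that by (intro mult_le_mono) auto
    then show ?thesis by (simp add: algebra_simps)
  qed
  have "m + n = m' + n'"
    using eq *[of m n m' n'] *[of m' n' m n] unfolding pr_nat_def
    by (metis less_irrefl nat_neq_iff)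
  with eq show "m = m' \<and> n = n'" by (auto simp: pr_nat_def)
qed simp

lemma RCA_star_standard:
  assumes "\<gamma> \<in> RCA_star" shows "valid_in standard \<gamma>"
proof -
  have "valid_in standard \<psi>" if "\<psi> \<in> RCA_star_instances" for \<psi>
  proof -
    have 1: ?thesis if "\<psi> \<in> basic_axioms"
      using that unfolding basic_axioms_def valid_in_def by auto
    have 2: ?thesis if "\<psi> = exp_axiom" unfolding valid_in_def
    proof (intro allI impI)
      fix \<rho> S
      \<comment> \<open>One set serves all exponents: the full graph of j \<mapsto> 2^j, in which a
        pair with positive j arises from the pair at j - 1.\<close>
      let ?E = "range (\<lambda>j. pr_nat j (2 ^ j))"
      have *: "(a + b) * (a + b) + a \<in> ?E \<longleftrightarrow> b = 2 ^ a" for a b :: nat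
        using pr_nat_inj by (auto simp: pr_nat_def[of a b, symmetric])
      have "b = 1 \<and> a = 0 \<or> (\<exists>i. a = i + 1 \<and> (\<exists>w. b = w + w \<and> w = 2 ^ i))"
        if "b = 2 ^ a" for a b :: nat
        using that by (cases a) auto
      then have "\<exists>E. \<forall>y. (y = 2 ^ x \<longrightarrow> (x + y) * (x + y) + x \<in> E) \<and>
          (\<forall>j u. (j + u) * (j + u) + j \<in> E \<longrightarrow> j = 0 \<and> u = 1 \<or>
            (\<exists>i w. j = i + 1 \<and> u = w + w \<and> (i + w) * (i + w) + i \<in> E))" for x :: nat
        by (intro exI[of _ ?E]) (auto simp: *)
      then show "holds standard \<rho> S \<psi>"
        unfolding \<open>\<psi> = exp_axiom\<close> exp_axiom_def expo_def pr_def by simp meson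
    qed
    have 3: ?thesis if "\<psi> = induction_ax x \<phi>" for x \<phi>
    proof -
      have "holds standard (\<rho>(Nm x := n)) S \<phi>"
        if "holds standard (\<rho>(Nm x := 0)) S \<phi>"
          "\<And>n. holds standard (\<rho>(Nm x := n)) S \<phi> \<Longrightarrow> holds standard (\<rho>(Nm x := Suc n)) S \<phi>"
        for \<rho> S n
        by (rule nat.induct[of "\<lambda>n. holds standard (\<rho>(Nm x := n)) S \<phi>"]) (rule that)+
      then show ?thesis
        using that by (auto simp: induction_ax_def valid_in_def holds_substN)
    qed
    have 4: ?thesis if "\<psi> = comprehension_ax X n m m' \<theta> \<theta>'" "Nm X \<notin> fsv \<theta>" for X n m m' \<theta> \<theta>'
      unfolding valid_in_def
    proof (intro allI impI)
      fix \<rho> and S :: "var \<Rightarrow> nat set"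
      show "holds standard \<rho> S \<psi>"
        using that by (auto simp: comprehension_ax_def holds_fresh_set
            intro!: exI[of _ "{a. holds standard (\<rho>(Nm n := a)) S (ExN m \<theta>)}"])
    qed
    show ?thesis
      using that 1 2 3 4 unfolding RCA_star_instances_def by blast
  qed
  moreover obtain xs Xs \<psi> where "\<psi> \<in> RCA_star_instances" "\<gamma> = foldr AllN xs (foldr AllS Xs \<psi>)"
    using assms unfolding RCA_star_def by blast
  ultimately show ?thesis by (simp only: valid_in_closure)
qed

lemma RCA_star_consistent: "\<not> (RCA_star \<turnstile> \<^bold>\<bottom>)"
  using soundness[of RCA_star "\<^bold>\<bottom>" "\<lambda>_. {}" standard] RCA_star_standard
  by (auto simp: valid_in_def)

section \<open>The set of sentences\<close>

abbreviation ball_fm :: "name \<Rightarrow> trm \<Rightarrow> fm \<Rightarrow> fm" where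
  "ball_fm x t \<phi> \<equiv> AllN x (Var (Nm x) \<^bold>< t \<^bold>\<longrightarrow> \<phi>)"

abbreviation bex_fm :: "name \<Rightarrow> trm \<Rightarrow> fm \<Rightarrow> fm" where
  "bex_fm x t \<phi> \<equiv> ExN x (Var (Nm x) \<^bold>< t \<^bold>\<and> \<phi>)"

text \<open>
  Second-order induction would not suffice, because the set of values \<open>f\<^sup>n c\<close> is only \<open>\<Sigma>\<^sup>0\<^sub>1\<close>-definable in \<open>RCA\<^sup>*\<^sub>0\<close>.
  Instead, the sentence says that \<open>f\<close> is injective, \<open>c\<close> is not a value of \<open>f\<close>, and every family \<open>(P\<^sub>b)\<close>, indexed by
  the elements \<open>b\<close>, of pairwise distinct sets that are closed under predecessors covers the whole structure.
\<close>

definition peano_sentence :: ofm where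
  "peano_sentence = OAllR 2 0 (OAnd
     (OAll 0 (OAll 1 (ONot (OAnd (OEq (OF (OVar 0)) (OF (OVar 1))) (ONot (OEq (OVar 0) (OVar 1)))))))
     (OAnd (OAll 0 (ONot (OEq (OF (OVar 0)) OC)))
       (ONot (OAnd
          (OAll 0 (OAll 1 (ONot (OAnd (ORel 0 [OVar 0, OF (OVar 1)]) (ONot (ORel 0 [OVar 0, OVar 1]))))))
          (OAnd
            (OAll 0 (OAll 1 (ONot (OAnd (ONot (OEq (OVar 0) (OVar 1)))
              (OAll 2 (OAnd
                (ONot (OAnd (ORel 0 [OVar 0, OVar 2]) (ONot (ORel 0 [OVar 1, OVar 2]))))
                (ONot (OAnd (ORel 0 [OVar 1, OVar 2]) (ONot (ORel 0 [OVar 0, OVar 2]))))))))))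
            (OEx 1 (OAll 0 (ONot (ORel 0 [OVar 0, OVar 1])))))))))"

text \<open>The quantifier adds no content to the closed equation f^n c = f^n c, but satisfaction of
  sentences of arbitrary length is only defined for prefixes \<exists>v_0 ... \<exists>v_n, with at
  least one quantifier.\<close>

definition reach_sentence :: "nat \<Rightarrow> ofm" where
  "reach_sentence n = OEx 0 (OEq (OVar 0) ((OF ^^ n) OC))"

definition power_of_two_fm :: "trm \<Rightarrow> fm" where
  "power_of_two_fm q = ball_fm (''d'', []) (q \<^bold>+ \<^bold>1) (ball_fm (''k'', []) (q \<^bold>+ \<^bold>1)
     (nv ''d'' \<^bold>* nv ''k'' \<^bold>= q \<^bold>\<longrightarrow>
       nv ''d'' \<^bold>= \<^bold>1 \<^bold>\<or> bex_fm (''j'', []) (nv ''d'') (nv ''d'' \<^bold>= nv ''j'' \<^bold>+ nv ''j'')))"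

text \<open>
  The code \<open>t\<close> of the term \<open>f\<^sup>n c\<close> is determined by \<open>15 t + 2 = 17 \<cdot> 16\<^sup>n\<close>. That \<open>16\<^sup>n\<close> is the fourth
  power of a power of two \<open>q\<close> is bounded, a power of two being a number all of whose divisors are \<open>1\<close> or even.
\<close>

definition reach_fm :: fm where
  "reach_fm = bex_fm (''t'', []) (nv ''x'') (bex_fm (''q'', []) (nv ''x'')
     (power_of_two_fm (nv ''q'') \<^bold>\<and>
      numeral_trm 15 \<^bold>* nv ''t'' \<^bold>+ numeral_trm 2 \<^bold>=
        numeral_trm 17 \<^bold>* ((nv ''q'' \<^bold>* nv ''q'') \<^bold>* (nv ''q'' \<^bold>* nv ''q'')) \<^bold>\<and>
      nv ''x'' \<^bold>= tag 7 (pr \<^bold>0 (tag 3 (pr \<^bold>0 (nv ''t''))))))"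

definition Xi :: fm where
  "Xi = (nv ''x'' \<^bold>= numeral_trm (code_ofm peano_sentence) \<^bold>\<or> reach_fm)"

definition characterization :: fm where
  "characterization = characterizes_N Xi [peano_sentence]"

lemma sigma00_connectives [intro]:
  "sigma00 \<phi> \<Longrightarrow> sigma00 (\<^bold>\<not> \<phi>)"
  "sigma00 \<phi> \<Longrightarrow> sigma00 \<psi> \<Longrightarrow> sigma00 (\<phi> \<^bold>\<and> \<psi>)"
  "sigma00 \<phi> \<Longrightarrow> sigma00 \<psi> \<Longrightarrow> sigma00 (\<phi> \<^bold>\<or> \<psi>)"
  "sigma00 \<phi> \<Longrightarrow> sigma00 \<psi> \<Longrightarrow> sigma00 (\<phi> \<^bold>\<longleftrightarrow> \<psi>)"
  by (auto simp: Neg_def And_def Or_def Iff_def intro!: sigma00.intros)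

lemma vars_tag [simp]: "vars_trm (tag d t) = vars_trm t" "vars_trm (pr s t) = vars_trm s \<union> vars_trm t"
  by (auto simp: tag_def pr_def)

lemma delta0_Xi: "delta0_in (''x'', []) Xi"
  unfolding delta0_in_def Xi_def reach_fm_def power_of_two_fm_def
  by (auto intro!: sigma00.intros sigma00_connectives)

lemma fv_alls_exs [simp]:
  "fnv (alls [] \<phi>) = fnv \<phi>" "fnv (alls (x # xs) \<phi>) = fnv (alls xs \<phi>) - {Nm (x, [])}"
  "fnv (exs [] \<phi>) = fnv \<phi>" "fnv (exs (x # xs) \<phi>) = fnv (exs xs \<phi>) - {Nm (x, [])}"
  "fsv (alls xs \<phi>) = fsv \<phi>" "fsv (exs xs \<phi>) = fsv \<phi>"
proof -
  show "fsv (alls xs \<phi>) = fsv \<phi>" "fsv (exs xs \<phi>) = fsv \<phi>"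
    by (induction xs) (auto simp: alls_def exs_def)
qed (auto simp: alls_def exs_def)

lemma fv_Conj_Disj [simp]:
  "fnv (Conj []) = {}" "fsv (Conj []) = {}" "fnv (Disj []) = {}" "fsv (Disj []) = {}"
  "fnv (Conj (\<phi> # \<phi>s)) = fnv \<phi> \<union> fnv (Conj \<phi>s)" "fsv (Conj (\<phi> # \<phi>s)) = fsv \<phi> \<union> fsv (Conj \<phi>s)"
  "fnv (Disj (\<phi> # \<phi>s)) = fnv \<phi> \<union> fnv (Disj \<phi>s)" "fsv (Disj (\<phi> # \<phi>s)) = fsv \<phi> \<union> fsv (Disj \<phi>s)"
  by (auto simp: Conj_def Disj_def)

lemma fv_expo [simp]:
  "fnv (expo s t) = vars_trm s \<union> vars_trm t" "fsv (expo s t) = {}"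
  by (auto simp: expo_def)

lemma fv_in_code:
  "fnv (s \<^bold>\<in>\<^sub>c t) = vars_trm s \<union> vars_trm t - Nm ` {(''bp'', []), (''bq'', []), (''br'', [])}"
  "fsv (s \<^bold>\<in>\<^sub>c t) = {}"
  by (auto simp: in_code_def)

lemma fv_sat_existential: "fnv sat_existential \<subseteq> {Nm (''x'', []), Nm (''c'', [])}"
  "fsv sat_existential \<subseteq> {sv ''A'', sv ''F''}"
  by (auto simp: sat_existential_def existential_prefix_def assignment_def term_values_def
      truth_values_def fv_in_code Leq_def)

lemma fv_tr_peano: "fnv (tr peano_sentence) \<subseteq> {Nm (''c'', [])}"
  "fsv (tr peano_sentence) \<subseteq> {sv ''A'', sv ''F''}"
  by (auto simp: peano_sentence_def relation_on_A_def ex_tuple_in_A_def upt_rec)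

lemma sentence_characterization: "sentence characterization"
proof -
  have "fnv Xi \<subseteq> {Nm (''x'', [])}" "fsv Xi = {}" using delta0_Xi by (auto simp: delta0_in_def)
  then show ?thesis
    using fv_sat_existential fv_tr_peano
    by (auto simp: sentence_def characterization_def characterizes_N_def is_structure_def
        isomorphic_to_N_def sat_def)
qed

section \<open>A model as a type\<close>

text \<open>
  The type \<open>model\<close> is the number part of a model of \<open>RCA\<^sup>*\<^sub>0\<close> that refutes \<open>characterization\<close> unless the latter
  is derivable. Having it as a type makes the algebraic type classes available inside the model.
\<close>

definition counter_model :: "nat henkin" where
  "counter_model = (SOME M. (\<forall>\<gamma>\<in>RCA_star. valid_in M \<gamma>) \<and> sets M \<noteq> {} \<and> countable (sets M) \<and>
     (valid_in M characterization \<longrightarrow> (RCA_star \<turnstile> characterization)))"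

lemma counter_model:
  "\<gamma> \<in> RCA_star \<Longrightarrow> valid_in counter_model \<gamma>" "sets counter_model \<noteq> {}" "countable (sets counter_model)"
  "valid_in counter_model characterization \<Longrightarrow> RCA_star \<turnstile> characterization"
proof -
  \<comment> \<open>If the characterization is underivable, it is the sentence to be refuted;
    otherwise falsity is. In both cases completeness yields a model, so the choice in
    \<open>counter_model\<close> has something to choose.\<close>
  obtain \<phi> where sent: "sentence \<phi>" and unprovable: "\<not> (RCA_star \<turnstile> \<phi>)"
    and \<phi>: "\<not> (RCA_star \<turnstile> characterization) \<Longrightarrow> \<phi> = characterization"
  proof (cases "RCA_star \<turnstile> characterization")
    case True
    then show ?thesis using that[of "\<^bold>\<bottom>"] RCA_star_consistent by (simp add: sentence_def)
  qed (use sentence_characterization that in blast)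
  obtain M :: "nat henkin" where M: "\<And>\<gamma>. \<gamma> \<in> RCA_star \<Longrightarrow> valid_in M \<gamma>" "\<not> valid_in M \<phi>"
      "sets M \<noteq> {}" "countable (sets M)"
    by (rule completeness[OF RCA_star_sentence sent basic_axioms_RCA_star unprovable]) (assumption, rule that)
  have "valid_in M characterization \<longrightarrow> (RCA_star \<turnstile> characterization)"
    using \<phi> M(2) by (cases "RCA_star \<turnstile> characterization") simp_all
  with M have "(\<forall>\<gamma>\<in>RCA_star. valid_in M \<gamma>) \<and> sets M \<noteq> {} \<and> countable (sets M) \<and>
     (valid_in M characterization \<longrightarrow> (RCA_star \<turnstile> characterization))" by simp
  then have "(\<forall>\<gamma>\<in>RCA_star. valid_in counter_model \<gamma>) \<and> sets counter_model \<noteq> {} \<and>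
     countable (sets counter_model) \<and>
     (valid_in counter_model characterization \<longrightarrow> (RCA_star \<turnstile> characterization))"
    unfolding counter_model_def by (rule someI)
  then show "\<gamma> \<in> RCA_star \<Longrightarrow> valid_in counter_model \<gamma>" "sets counter_model \<noteq> {}"
    "countable (sets counter_model)"
    "valid_in counter_model characterization \<Longrightarrow> RCA_star \<turnstile> characterization"
    by simp_all
qed

typedef model = "UNIV :: nat set" by simp

definition \<MM> :: "model henkin" where
  "\<MM> = (let M = counter_model in \<lparr>zer = Abs_model (zer M), un = Abs_model (un M),
     add = \<lambda>a b. Abs_model (add M (Rep_model a) (Rep_model b)),
     mul = \<lambda>a b. Abs_model (mul M (Rep_model a) (Rep_model b)),
     lt = \<lambda>a b. lt M (Rep_model a) (Rep_model b), sets = image Abs_model ` sets M\<rparr>)"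

lemma val_MM: "Rep_model (val \<MM> \<rho> t) = val counter_model (Rep_model \<circ> \<rho>) t"
  by (induction t) (simp_all add: \<MM>_def Let_def Abs_model_inverse)

lemma lt_MM: "lt \<MM> a b \<longleftrightarrow> lt counter_model (Rep_model a) (Rep_model b)"
  and sets_MM: "sets \<MM> = image Abs_model ` sets counter_model"
  by (simp_all add: \<MM>_def Let_def)

lemma holds_MM: "holds \<MM> \<rho> S \<phi> = holds counter_model (Rep_model \<circ> \<rho>) (\<lambda>X. Rep_model ` S X) \<phi>"
proof (induction \<phi> arbitrary: \<rho> S)
  case (Eq s t)
  then show ?case by (metis Rep_model_inject holds.simps(2) val_MM)
next
  case (Less s t)
  then show ?case by (simp only: holds.simps lt_MM val_MM)
next
  case (Mem s X)
  have "Rep_model a \<in> Rep_model ` B \<longleftrightarrow> a \<in> B" for a B by (auto simp: Rep_model_inject)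
  then show ?case by (simp only: holds.simps val_MM[symmetric])
next
  case (AllN x \<phi>)
  have "(Rep_model \<circ> \<rho>(Nm x := a)) = (Rep_model \<circ> \<rho>)(Nm x := Rep_model a)" for a by auto
  then have "holds \<MM> \<rho> S (AllN x \<phi>) \<longleftrightarrow>
      (\<forall>a. holds counter_model ((Rep_model \<circ> \<rho>)(Nm x := Rep_model a)) (\<lambda>X. Rep_model ` S X) \<phi>)"
    by (simp only: holds.simps AllN.IH)
  also have "\<dots> \<longleftrightarrow> holds counter_model (Rep_model \<circ> \<rho>) (\<lambda>X. Rep_model ` S X) (AllN x \<phi>)"
    by (simp only: holds.simps) (metis Abs_model_inverse UNIV_I)
  finally show ?case .
next
  case (AllS X \<phi>)
  have *: "(\<lambda>Y. Rep_model ` (S(Nm X := Abs_model ` A)) Y) = (\<lambda>Y. Rep_model ` S Y)(Nm X := A)" for A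
    by (simp add: fun_eq_iff image_image Abs_model_inverse)
  have "holds \<MM> \<rho> S (AllS X \<phi>) \<longleftrightarrow> (\<forall>A\<in>sets counter_model.
      holds counter_model (Rep_model \<circ> \<rho>) (\<lambda>Y. Rep_model ` (S(Nm X := Abs_model ` A)) Y) \<phi>)"
    by (simp only: holds.simps AllS.IH ball_simps sets_MM)
  then show ?case by (simp only: holds.simps *)
qed auto

lemma valid_in_MM: "valid_in \<MM> \<phi> \<longleftrightarrow> valid_in counter_model \<phi>"
proof
  assume *: "valid_in counter_model \<phi>"
  show "valid_in \<MM> \<phi>" unfolding valid_in_def
  proof (intro allI impI)
    fix \<rho> and S :: "var \<Rightarrow> model set" assume S: "range S \<subseteq> sets \<MM>"
    have "Rep_model ` S X \<in> sets counter_model" for X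
    proof -
      have "S X \<in> sets \<MM>" using S by auto
      then show ?thesis by (auto simp: sets_MM image_image Abs_model_inverse)
    qed
    then have "range (\<lambda>X. Rep_model ` S X) \<subseteq> sets counter_model" by auto
    then show "holds \<MM> \<rho> S \<phi>" using * by (auto simp: holds_MM valid_in_def)
  qed
next
  assume *: "valid_in \<MM> \<phi>"
  show "valid_in counter_model \<phi>" unfolding valid_in_def
  proof (intro allI impI)
    fix \<rho> and S :: "var \<Rightarrow> nat set" assume S: "range S \<subseteq> sets counter_model"
    have "range (\<lambda>X. Abs_model ` S X) \<subseteq> sets \<MM>" using S by (auto simp: sets_MM)
    then have "holds \<MM> (Abs_model \<circ> \<rho>) (\<lambda>X. Abs_model ` S X) \<phi>"
      using * by (auto simp: valid_in_def)
    moreover have "Rep_model \<circ> (Abs_model \<circ> \<rho>) = \<rho>" "(\<lambda>X. Rep_model ` Abs_model ` S X) = S"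
      by (auto simp: Abs_model_inverse image_image)
    ultimately show "holds counter_model \<rho> S \<phi>" by (simp only: holds_MM)
  qed
qed

lemma RCA_star_MM: "\<gamma> \<in> RCA_star \<Longrightarrow> valid_in \<MM> \<gamma>"
  by (simp add: valid_in_MM counter_model)

lemma countable_sets_MM: "sets \<MM> \<noteq> {}" "countable (sets \<MM>)"
  using counter_model(2,3) by (auto simp: sets_MM)

instantiation model :: "{zero, one, plus, times, ord}"
begin

definition "0 = zer \<MM>"
definition "1 = un \<MM>"
definition "a + b = add \<MM> a b"
definition "a * b = mul \<MM> a b"
definition "a < b \<longleftrightarrow> lt \<MM> a b"
definition "a \<le> b \<longleftrightarrow> a < b \<or> a = (b :: model)"

instance ..
end

section \<open>Bounded definability in the model\<close>

abbreviation Sets :: "model set set" where "Sets \<equiv> sets \<MM>"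

lemma MM_simps [simp]: "zer \<MM> = 0" "un \<MM> = 1" "add \<MM> = (+)" "mul \<MM> = (*)" "lt \<MM> = (<)"
  by (simp_all add: fun_eq_iff zero_model_def one_model_def plus_model_def times_model_def less_model_def)

text \<open>Every element and every set of the model receives a variable of its own, so that axioms
  can be applied with arbitrary parameters from the model.\<close>

definition pnum :: "model \<Rightarrow> name" where
  "pnum a = (''p'', [Rep_model a])"

definition pset :: "model set \<Rightarrow> name" where
  "pset A = (''P'', [to_nat_on Sets A])"

text \<open>Whatever its string, a name selects a set through its first index. Hence every variable
  denotes a member of the nonempty family, and one environment serves for all formulas.\<close>

definition set_env :: "var \<Rightarrow> model set" where
  "set_env v = (case v of Nm x \<Rightarrow> from_nat_into Sets (hd (snd x)) | Par _ \<Rightarrow> from_nat_into Sets 0)"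

definition num_env :: "(var \<Rightarrow> model) \<Rightarrow> bool" where
  "num_env \<rho> \<longleftrightarrow> (\<forall>a. \<rho> (Nm (pnum a)) = a)"

lemma set_env_Sets: "range set_env \<subseteq> Sets"
  using from_nat_into[OF countable_sets_MM(1)] by (auto simp: set_env_def split: var.splits)

lemma set_env_pset: "A \<in> Sets \<Longrightarrow> set_env (Nm (pset A)) = A"
  using countable_sets_MM by (simp add: set_env_def pset_def)

lemma num_env_upd: "num_env \<rho> \<Longrightarrow> num_env (\<rho>(Nm (''e'', l) := a))"
  by (auto simp: num_env_def pnum_def)

lemma num_env_exists: "\<exists>\<rho>. num_env \<rho>"
  by (rule exI[of _ "\<lambda>v. case v of Nm x \<Rightarrow> Abs_model (hd (snd x)) | _ \<Rightarrow> 0"])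
    (simp add: num_env_def pnum_def Rep_model_inverse)

text \<open>Names with string \<open>e\<close> are the working variables, disjoint from those
  reserved for parameters of the model. Finiteness of the vector leaves fresh ones for
  binding.\<close>

definition term_vector :: "(nat \<Rightarrow> trm) \<Rightarrow> bool" where
  "term_vector \<tau> \<longleftrightarrow> finite (\<Union>i. vars_trm (\<tau> i)) \<and>
     (\<forall>i. vars_trm (\<tau> i) \<subseteq> range (\<lambda>k. Nm (''e'', [k])))"

definition vals :: "(var \<Rightarrow> model) \<Rightarrow> (nat \<Rightarrow> trm) \<Rightarrow> nat \<Rightarrow> model" where
  "vals \<rho> \<tau> = (\<lambda>i. val \<MM> \<rho> (\<tau> i))"

text \<open>
  \<open>dec P\<close> says that the predicate \<open>P\<close> of environments is definable by a bounded formula with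
  parameters from the model. Quantifying over the vectors of terms that are plugged in for the
  arguments makes this closed under substitution, and bound variables can be chosen fresh. The
  arguments of an environment are counted from the innermost binder.
\<close>

definition defines_trm :: "(nat \<Rightarrow> trm) \<Rightarrow> trm \<Rightarrow> ((nat \<Rightarrow> model) \<Rightarrow> model) \<Rightarrow> bool" where
  "defines_trm \<tau> t f \<longleftrightarrow> vars_trm t \<subseteq> range Nm \<and>
     (\<forall>\<rho>. num_env \<rho> \<longrightarrow> val \<MM> \<rho> t = f (vals \<rho> \<tau>))"

definition defines_fm :: "(nat \<Rightarrow> trm) \<Rightarrow> fm \<Rightarrow> ((nat \<Rightarrow> model) \<Rightarrow> bool) \<Rightarrow> bool" where
  "defines_fm \<tau> \<phi> P \<longleftrightarrow> sigma00 \<phi> \<and> fnv \<phi> \<subseteq> range Nm \<and> fsv \<phi> \<subseteq> range Nm \<and>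
     (\<forall>\<rho>. num_env \<rho> \<longrightarrow> holds \<MM> \<rho> set_env \<phi> = P (vals \<rho> \<tau>))"

definition tdef :: "((nat \<Rightarrow> model) \<Rightarrow> model) \<Rightarrow> bool" where
  "tdef f \<longleftrightarrow> (\<forall>\<tau>. term_vector \<tau> \<longrightarrow> (\<exists>t. defines_trm \<tau> t f))"

definition dec :: "((nat \<Rightarrow> model) \<Rightarrow> bool) \<Rightarrow> bool" where
  "dec P \<longleftrightarrow> (\<forall>\<tau>. term_vector \<tau> \<longrightarrow> (\<exists>\<phi>. defines_fm \<tau> \<phi> P))"

named_theorems dec_intros

lemma decE:
  assumes "dec P" "term_vector \<tau>"
  obtains \<phi> where "sigma00 \<phi>" "fnv \<phi> \<subseteq> range Nm" "fsv \<phi> \<subseteq> range Nm"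
    "\<And>\<rho>. num_env \<rho> \<Longrightarrow> holds \<MM> \<rho> set_env \<phi> = P (vals \<rho> \<tau>)"
  using assms unfolding dec_def defines_fm_def by blast

lemma decI: "(\<And>\<tau>. term_vector \<tau> \<Longrightarrow> \<exists>\<phi>. defines_fm \<tau> \<phi> P) \<Longrightarrow> dec P"
  by (simp add: dec_def)

lemma tdef_var: "tdef (\<lambda>e. e n)"
  unfolding tdef_def
proof (intro allI impI)
  fix \<tau> assume "term_vector \<tau>"
  then show "\<exists>t. defines_trm \<tau> t (\<lambda>e. e n)"
    by (intro exI[of _ "\<tau> n"]) (force simp: term_vector_def vals_def defines_trm_def)
qed

lemma tdef_const: "tdef (\<lambda>e. a)"
  unfolding tdef_def
  by (intro allI impI exI[of _ "Var (Nm (pnum a))"]) (simp add: num_env_def defines_trm_def)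

lemma defines_intros:
  "defines_trm \<tau> s f \<Longrightarrow> defines_trm \<tau> t g \<Longrightarrow> defines_trm \<tau> (s \<^bold>+ t) (\<lambda>e. f e + g e)"
  "defines_trm \<tau> s f \<Longrightarrow> defines_trm \<tau> t g \<Longrightarrow> defines_trm \<tau> (s \<^bold>* t) (\<lambda>e. f e * g e)"
  "defines_trm \<tau> s f \<Longrightarrow> defines_trm \<tau> t g \<Longrightarrow> defines_fm \<tau> (s \<^bold>= t) (\<lambda>e. f e = g e)"
  "defines_trm \<tau> s f \<Longrightarrow> defines_trm \<tau> t g \<Longrightarrow> defines_fm \<tau> (s \<^bold>< t) (\<lambda>e. f e < g e)"
  "defines_trm \<tau> s f \<Longrightarrow> A \<in> Sets \<Longrightarrow> defines_fm \<tau> (s \<^bold>\<in> Nm (pset A)) (\<lambda>e. f e \<in> A)"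
  "defines_fm \<tau> \<phi> P \<Longrightarrow> defines_fm \<tau> \<psi> Q \<Longrightarrow> defines_fm \<tau> (\<phi> \<^bold>\<longrightarrow> \<psi>) (\<lambda>e. P e \<longrightarrow> Q e)"
  by (simp_all add: defines_trm_def defines_fm_def sigma00.intros set_env_pset)

lemma tdef_plus: "tdef f \<Longrightarrow> tdef g \<Longrightarrow> tdef (\<lambda>e. f e + g e)"
  unfolding tdef_def using defines_intros(1) by blast

lemma tdef_times: "tdef f \<Longrightarrow> tdef g \<Longrightarrow> tdef (\<lambda>e. f e * g e)"
  unfolding tdef_def using defines_intros(2) by blast

lemmas tdef_intros = tdef_var tdef_plus tdef_times tdef_const

lemma dec_eq_tdef: "tdef f \<Longrightarrow> tdef g \<Longrightarrow> dec (\<lambda>e. f e = g e)"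
  unfolding tdef_def dec_def using defines_intros(3) by blast

lemma dec_less_tdef: "tdef f \<Longrightarrow> tdef g \<Longrightarrow> dec (\<lambda>e. f e < g e)"
  unfolding tdef_def dec_def using defines_intros(4) by blast

lemma dec_mem_tdef: "tdef f \<Longrightarrow> A \<in> Sets \<Longrightarrow> dec (\<lambda>e. f e \<in> A)"
  unfolding tdef_def dec_def using defines_intros(5) by blast

lemma dec_imp [dec_intros]: "dec P \<Longrightarrow> dec Q \<Longrightarrow> dec (\<lambda>e. P e \<longrightarrow> Q e)"
  unfolding dec_def using defines_intros(6) by blast

lemma dec_const [dec_intros]: "dec (\<lambda>e. c)"
  by (rule decI, rule exI[of _ "if c then \<^bold>\<not> \<^bold>\<bottom> else \<^bold>\<bottom>"])
    (auto simp: defines_fm_def intro: sigma00.intros)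

lemma dec_not [dec_intros]: "dec P \<Longrightarrow> dec (\<lambda>e. \<not> P e)"
  using dec_imp[OF _ dec_const[of False]] by simp

lemma dec_and [dec_intros]: "dec P \<Longrightarrow> dec Q \<Longrightarrow> dec (\<lambda>e. P e \<and> Q e)"
  using dec_not[OF dec_imp[OF _ dec_not]] by simp

lemma dec_or [dec_intros]: "dec P \<Longrightarrow> dec Q \<Longrightarrow> dec (\<lambda>e. P e \<or> Q e)"
  using dec_imp[OF dec_not] by (simp add: disj_imp)

lemma dec_iff [dec_intros]: "dec P \<Longrightarrow> dec Q \<Longrightarrow> dec (\<lambda>e. P e \<longleftrightarrow> Q e)"
  using dec_and[OF dec_imp dec_imp] by (simp add: iff_conv_conj_imp)

lemma fresh_name: "finite V \<Longrightarrow> \<exists>k. Nm (''e'', [k]) \<notin> V"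
proof (rule ccontr)
  assume "finite V" "\<nexists>k. Nm (''e'', [k]) \<notin> V"
  then have "range (\<lambda>k. Nm (''e'', [k])) \<subseteq> V" by auto
  then have "finite (range (\<lambda>k :: nat. Nm (''e'', [k])))" using \<open>finite V\<close> finite_subset by blast
  then show False using finite_imageD[of "\<lambda>k :: nat. Nm (''e'', [k])" UNIV] by (simp add: inj_def)
qed

lemma vals_case: "Nm x \<notin> (\<Union>i. vars_trm (\<tau> i)) \<Longrightarrow>
    vals (\<rho>(Nm x := a)) (case_nat (Var (Nm x)) \<tau>) = case_nat a (vals \<rho> \<tau>)"
  by (rule ext) (auto simp: vals_def split: nat.split intro!: val_cong)

lemma term_vector_case:
  "term_vector \<tau> \<Longrightarrow> term_vector (case_nat (Var (Nm (''e'', [k]))) \<tau>)"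
proof -
  let ?x = "(''e'', [k])"
  assume *: "term_vector \<tau>"
  have "(\<Union>i. vars_trm (case i of 0 \<Rightarrow> Var (Nm ?x) | Suc j \<Rightarrow> \<tau> j)) \<subseteq>
      insert (Nm ?x) (\<Union>i. vars_trm (\<tau> i))"
    by (auto split: nat.splits)
  then show ?thesis
    using * finite_subset by (auto simp: term_vector_def split: nat.split)
qed

lemma dec_ball_tdef:
  assumes f: "tdef f" and Q: "dec (\<lambda>e. Q (e 0) (\<lambda>i. e (Suc i)))"
  shows "dec (\<lambda>e. \<forall>y. y < f e \<longrightarrow> Q y e)"
proof (rule decI)
  fix \<tau> assume \<tau>: "term_vector \<tau>"
  obtain t where t: "vars_trm t \<subseteq> range Nm" "\<And>\<rho>. num_env \<rho> \<Longrightarrow> val \<MM> \<rho> t = f (vals \<rho> \<tau>)"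
    using f \<tau> unfolding tdef_def defines_trm_def by blast
  have "finite (vars_trm t \<union> (\<Union>i. vars_trm (\<tau> i)))"
    using \<tau> by (simp add: term_vector_def finite_vars)
  then obtain k where k: "Nm (''e'', [k]) \<notin> vars_trm t \<union> (\<Union>i. vars_trm (\<tau> i))"
    using fresh_name by blast
  define x where "x = (''e'', [k])"
  have x: "Nm x \<notin> vars_trm t" "Nm x \<notin> (\<Union>i. vars_trm (\<tau> i))" using k by (auto simp: x_def)
  obtain \<phi> where \<phi>: "sigma00 \<phi>" "fnv \<phi> \<subseteq> range Nm" "fsv \<phi> \<subseteq> range Nm"
    "\<And>\<rho>. num_env \<rho> \<Longrightarrow> holds \<MM> \<rho> set_env \<phi> =
      Q (vals \<rho> (case_nat (Var (Nm x)) \<tau>) 0) (\<lambda>i. vals \<rho> (case_nat (Var (Nm x)) \<tau>) (Suc i))"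
    using decE[OF Q term_vector_case[OF \<tau>, of k]] unfolding x_def by metis
  have "holds \<MM> \<rho> set_env (ball_fm x t \<phi>) \<longleftrightarrow> (\<forall>y. y < f (vals \<rho> \<tau>) \<longrightarrow> Q y (vals \<rho> \<tau>))"
    if \<rho>: "num_env \<rho>" for \<rho>
  proof -
    have "holds \<MM> (\<rho>(Nm x := a)) set_env \<phi> = Q a (vals \<rho> \<tau>)" for a
    proof -
      have "num_env (\<rho>(Nm x := a))" unfolding x_def by (rule num_env_upd[OF \<rho>])
      then show ?thesis by (simp only: \<phi>(4) vals_case[OF x(2)] nat.case)
    qed
    moreover have "val \<MM> (\<rho>(Nm x := a)) t = f (vals \<rho> \<tau>)" for a
      using x(1) t(2)[OF \<rho>] val_cong[of t "\<rho>(Nm x := a)" \<rho>] by (metis fun_upd_other)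
    ultimately show ?thesis by simp
  qed
  moreover have "sigma00 (ball_fm x t \<phi>)" using \<phi>(1) x(1) by (rule sigma00.intros)
  moreover have "fnv (ball_fm x t \<phi>) \<subseteq> range Nm" "fsv (ball_fm x t \<phi>) \<subseteq> range Nm"
    using \<phi> t by auto
  ultimately show "\<exists>\<phi>. defines_fm \<tau> \<phi> (\<lambda>e. \<forall>y. y < f e \<longrightarrow> Q y e)"
    unfolding defines_fm_def by blast
qed

lemma dec_bex_tdef:
  assumes "tdef f" and "dec (\<lambda>e. Q (e 0) (\<lambda>i. e (Suc i)))"
  shows "dec (\<lambda>e. \<exists>y. y < f e \<and> Q y e)"
  using dec_not[OF dec_ball_tdef[OF assms(1), of "\<lambda>y e. \<not> Q y e"]] dec_not[OF assms(2)] by simp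

lemma dec_reindex: "dec P \<Longrightarrow> dec (\<lambda>e. P (\<lambda>i. e (\<pi> i)))"
proof (rule decI)
  fix \<tau> assume P: "dec P" and \<tau>: "term_vector \<tau>"
  have "(\<Union>i. vars_trm (\<tau> (\<pi> i))) \<subseteq> (\<Union>i. vars_trm (\<tau> i))" by auto
  then have "term_vector (\<lambda>i. \<tau> (\<pi> i))"
    using \<tau> finite_subset by (auto simp: term_vector_def)
  then show "\<exists>\<phi>. defines_fm \<tau> \<phi> (\<lambda>e. P (\<lambda>i. e (\<pi> i)))"
    using P unfolding dec_def defines_fm_def vals_def by blast
qed

lemma term_vector_single: "term_vector (\<lambda>i. Var (Nm (''e'', [k])))"
  by (auto simp: term_vector_def)

text \<open>The single access to the induction axiom: a decidable predicate is given by a bounded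
  formula whose parameters have names in the environment. All later inductions over the model come
  back to it.\<close>

lemma dec_induct:
  assumes P: "dec (\<lambda>e. P (e 0))" and "P 0" and "\<And>x. P x \<Longrightarrow> P (x + 1)"
  shows "P (x :: model)"
proof -
  let ?x = "(''e'', [0])"
  obtain \<phi> where \<phi>: "sigma00 \<phi>" "fnv \<phi> \<subseteq> range Nm" "fsv \<phi> \<subseteq> range Nm"
    "\<And>\<rho>. num_env \<rho> \<Longrightarrow> holds \<MM> \<rho> set_env \<phi> = P (\<rho> (Nm ?x))"
    using decE[OF P term_vector_single[of 0]] by (auto simp: vals_def)
  obtain \<rho> where \<rho>: "num_env \<rho>" using num_env_exists by blast
  have at: "holds \<MM> (\<rho>(Nm ?x := a)) set_env \<phi> = P a" for a
    using \<phi>(4)[OF num_env_upd[OF \<rho>, of "[0]" a]] by simp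
  have "valid_in \<MM> (induction_ax ?x \<phi>)"
  proof (rule RCA_star_instance_valid[OF RCA_star_MM])
    show "induction_ax ?x \<phi> \<in> RCA_star_instances"
      using \<phi>(1) by (auto simp: RCA_star_instances_def)
    show "fnv (induction_ax ?x \<phi>) \<subseteq> range Nm" "fsv (induction_ax ?x \<phi>) \<subseteq> range Nm"
      using \<phi>(2,3) fnv_substN[of ?x "\<^bold>0" \<phi>] fnv_substN[of ?x "Var (Nm ?x) \<^bold>+ \<^bold>1" \<phi>]
      by (auto simp: induction_ax_def)
  qed
  then have "holds \<MM> \<rho> set_env (induction_ax ?x \<phi>)"
    using set_env_Sets by (auto simp: valid_in_def)
  then have ind: "holds \<MM> \<rho> set_env (substN ?x \<^bold>0 \<phi>) \<and>
      (\<forall>a. holds \<MM> (\<rho>(Nm ?x := a)) set_env \<phi> \<longrightarrow>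
        holds \<MM> (\<rho>(Nm ?x := a)) set_env (substN ?x (Var (Nm ?x) \<^bold>+ \<^bold>1) \<phi>)) \<longrightarrow>
      (\<forall>a. holds \<MM> (\<rho>(Nm ?x := a)) set_env \<phi>)"
    by (simp only: induction_ax_def holds_connectives holds.simps(5,6))
  have "holds \<MM> \<rho> set_env (substN ?x \<^bold>0 \<phi>)"
    using holds_substN[of "\<^bold>0" ?x \<MM> \<rho> set_env \<phi>] at[of 0] assms(2) by simp
  moreover have "holds \<MM> (\<rho>(Nm ?x := a)) set_env (substN ?x (Var (Nm ?x) \<^bold>+ \<^bold>1) \<phi>) = P (a + 1)" for a
    using holds_substN[of "Var (Nm ?x) \<^bold>+ \<^bold>1" ?x \<MM> "\<rho>(Nm ?x := a)" set_env \<phi>] at[of "a + 1"] by simp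
  ultimately show ?thesis using ind assms(3) unfolding at by simp
qed

lemma basic_facts:
  fixes a b :: model
  shows "a + 1 \<noteq> 0" "a + 1 = b + 1 \<Longrightarrow> a = b" "a + 0 = a" "a + (b + 1) = (a + b) + 1"
    "a * 0 = 0" "a * (b + 1) = a * b + a" "\<not> a < 0" "a < b + 1 \<longleftrightarrow> a < b \<or> a = b"
proof -
  have "\<forall>\<phi>\<in>basic_axioms. holds \<MM> (\<lambda>_. 0) set_env \<phi>"
    using RCA_star_MM basic_axioms_RCA_star set_env_Sets unfolding valid_in_def by blast
  then show "a + 1 \<noteq> 0" "a + 1 = b + 1 \<Longrightarrow> a = b" "a + 0 = a" "a + (b + 1) = (a + b) + 1"
    "a * 0 = 0" "a * (b + 1) = a * b + a" "\<not> a < 0" "a < b + 1 \<longleftrightarrow> a < b \<or> a = b"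
    by (simp_all add: basic_axioms_def)
qed

section \<open>The ordered semiring of the model\<close>

text \<open>These rules treat polynomial terms and presuppose no arithmetic, so they can be used to
  derive the arithmetic on which the later rules for \<open>df\<close> rest.\<close>

lemmas basic_dec_intros = dec_ball_tdef dec_bex_tdef dec_eq_tdef dec_less_tdef dec_mem_tdef tdef_intros

lemma add_assoc_model: "(a + b) + c = a + (b + c :: model)"
proof (rule dec_induct[where P = "\<lambda>c. (a + b) + c = a + (b + c)"])
  show "dec (\<lambda>e. (a + b) + e 0 = a + (b + e 0))" by (intro dec_intros basic_dec_intros)
qed (simp_all add: basic_facts)

lemma zero_add_model: "0 + a = (a :: model)"
proof (rule dec_induct[where P = "\<lambda>a. 0 + a = a"])
  show "dec (\<lambda>e. 0 + e 0 = e 0)" by (intro dec_intros basic_dec_intros)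
qed (simp_all add: basic_facts)

lemma one_add_model: "1 + a = a + (1 :: model)"
proof (rule dec_induct[where P = "\<lambda>a. 1 + a = a + 1"])
  show "dec (\<lambda>e. 1 + e 0 = e 0 + 1)" by (intro dec_intros basic_dec_intros)
qed (simp_all add: basic_facts zero_add_model)

lemma add_commute_model: "a + b = b + (a :: model)"
proof (rule dec_induct[where P = "\<lambda>b. a + b = b + a"])
  show "dec (\<lambda>e. a + e 0 = e 0 + a)" by (intro dec_intros basic_dec_intros)
  show "a + 0 = 0 + a" by (simp add: basic_facts zero_add_model)
  show "a + (x + 1) = x + 1 + a" if "a + x = x + a" for x
    using that by (metis add_assoc_model basic_facts(4) one_add_model)
qed

lemma zero_mult_model: "0 * a = (0 :: model)"
proof (rule dec_induct[where P = "\<lambda>a. 0 * a = 0"])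
  show "dec (\<lambda>e. 0 * e 0 = 0)" by (intro dec_intros basic_dec_intros)
qed (simp_all add: basic_facts)

lemma distrib_right_model: "(a + b) * c = a * c + b * (c :: model)"
proof (rule dec_induct[where P = "\<lambda>c. (a + b) * c = a * c + b * c"])
  show "dec (\<lambda>e. (a + b) * e 0 = a * e 0 + b * e 0)" by (intro dec_intros basic_dec_intros)
  show "(a + b) * (x + 1) = a * (x + 1) + b * (x + 1)" if "(a + b) * x = a * x + b * x" for x
    using that by (metis add_assoc_model basic_facts(6) add_commute_model)
qed (simp_all add: basic_facts)

lemma one_mult_model: "1 * a = (a :: model)"
proof (rule dec_induct[where P = "\<lambda>a. 1 * a = a"])
  show "dec (\<lambda>e. 1 * e 0 = e 0)" by (intro dec_intros basic_dec_intros)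
qed (simp_all add: basic_facts)

lemma mult_commute_model: "a * b = b * (a :: model)"
proof (rule dec_induct[where P = "\<lambda>b. a * b = b * a"])
  show "dec (\<lambda>e. a * e 0 = e 0 * a)" by (intro dec_intros basic_dec_intros)
qed (simp_all add: basic_facts zero_mult_model distrib_right_model one_mult_model)

lemma mult_assoc_model: "(a * b) * c = a * (b * c :: model)"
proof (rule dec_induct[where P = "\<lambda>c. (a * b) * c = a * (b * c)"])
  show "dec (\<lambda>e. (a * b) * e 0 = a * (b * e 0))" by (intro dec_intros basic_dec_intros)
  show "a * b * (x + 1) = a * (b * (x + 1))" if "a * b * x = a * (b * x)" for x
    using that by (metis basic_facts(6) mult_commute_model distrib_right_model)
qed (simp_all add: basic_facts)

lemma less_trans_model: "a < b \<Longrightarrow> b < c \<Longrightarrow> a < (c :: model)"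
proof -
  have "b < c \<longrightarrow> a < c" if "a < b"
  proof (rule dec_induct[where P = "\<lambda>c. b < c \<longrightarrow> a < c"])
    show "dec (\<lambda>e. b < e 0 \<longrightarrow> a < e 0)" by (intro dec_intros basic_dec_intros)
  qed (use that in \<open>auto simp: basic_facts\<close>)
  then show "a < b \<Longrightarrow> b < c \<Longrightarrow> a < c" by blast
qed

lemma less_add_one_model: "a < a + (1 :: model)"
  by (simp add: basic_facts)

lemma less_irrefl_model: "\<not> a < (a :: model)"
proof (rule dec_induct[where P = "\<lambda>a. \<not> a < a"])
  show "dec (\<lambda>e. \<not> e 0 < e 0)" by (intro dec_intros basic_dec_intros)
  show "\<not> x + 1 < x + 1" if "\<not> x < x" for x :: model
    using that less_add_one_model[of x] less_trans_model[of x "x + 1" x] basic_facts(8)[of "x + 1" x]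
    by auto
qed (simp add: basic_facts)

lemma less_mono_one_model: "a < b \<Longrightarrow> a + 1 < b + (1 :: model)"
proof -
  have "a < b \<longrightarrow> a + 1 < b + 1"
  proof (rule dec_induct[where P = "\<lambda>b. a < b \<longrightarrow> a + 1 < b + 1"])
    show "dec (\<lambda>e. a < e 0 \<longrightarrow> a + 1 < e 0 + 1)" by (intro dec_intros basic_dec_intros)
  qed (auto simp: basic_facts)
  then show "a < b \<Longrightarrow> a + 1 < b + 1" by blast
qed

lemma zero_less_add_one_model: "0 < a + (1 :: model)"
proof (rule dec_induct[where P = "\<lambda>a. 0 < a + 1"])
  show "dec (\<lambda>e. 0 < e 0 + 1)" by (intro dec_intros basic_dec_intros)
qed (auto simp: basic_facts)

lemma less_linear_model: "a < b \<or> a = b \<or> b < (a :: model)"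
proof (rule dec_induct[where P = "\<lambda>a. a < b \<or> a = b \<or> b < a"])
  show "dec (\<lambda>e. e 0 < b \<or> e 0 = b \<or> b < e 0)" by (intro dec_intros basic_dec_intros)
  show "0 < b \<or> 0 = b \<or> b < 0"
  proof (rule dec_induct[where P = "\<lambda>b. 0 < b \<or> 0 = b \<or> b < 0"])
    show "dec (\<lambda>e. 0 < e 0 \<or> 0 = e 0 \<or> e 0 < 0)" by (intro dec_intros basic_dec_intros)
  qed (auto simp: zero_less_add_one_model)
  show "x + 1 < b \<or> x + 1 = b \<or> b < x + 1" if "x < b \<or> x = b \<or> b < x" for x
    using that basic_facts(8) less_mono_one_model by blast
qed

lemma less_iff_model: "a < b \<longleftrightarrow> (\<exists>c. b = a + c + (1 :: model))"
proof
  \<comment> \<open>The difference is sought below b to keep the induction formula bounded.\<close>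
  have "a < b \<longrightarrow> (\<exists>c. c < b \<and> b = a + c + 1)"
  proof (rule dec_induct[where P = "\<lambda>b. a < b \<longrightarrow> (\<exists>c. c < b \<and> b = a + c + 1)"])
    show "dec (\<lambda>e. a < e 0 \<longrightarrow> (\<exists>c. c < e 0 \<and> e 0 = a + c + 1))" by (intro dec_intros basic_dec_intros)
    fix x assume *: "a < x \<longrightarrow> (\<exists>c. c < x \<and> x = a + c + 1)"
    show "a < x + 1 \<longrightarrow> (\<exists>c. c < x + 1 \<and> x + 1 = a + c + 1)"
    proof
      assume "a < x + 1"
      then consider "a < x" | "a = x" using basic_facts(8) by blast
      then show "\<exists>c. c < x + 1 \<and> x + 1 = a + c + 1"
      proof cases
        case 1
        then obtain c where "c < x" "x = a + c + 1" using * by blast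
        then show ?thesis
          by (metis basic_facts(4) less_mono_one_model)
      next
        case 2
        then show ?thesis
          by (intro exI[of _ 0]) (simp add: zero_less_add_one_model basic_facts(3))
      qed
    qed
  qed (simp add: basic_facts)
  then show "a < b \<Longrightarrow> \<exists>c. b = a + c + 1" by blast
next
  assume "\<exists>c. b = a + c + 1"
  then obtain c where b: "b = a + c + 1" by blast
  have "a < a + c + 1"
  proof (rule dec_induct[where P = "\<lambda>c. a < a + c + 1"])
    show "dec (\<lambda>e. a < a + e 0 + 1)" by (intro dec_intros basic_dec_intros)
  qed (auto simp: basic_facts)
  then show "a < b" by (simp add: b)
qed

lemma le_iff_model: "a \<le> b \<longleftrightarrow> (\<exists>c. b = a + (c :: model))"
proof
  assume "a \<le> b"
  then show "\<exists>c. b = a + c"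
    unfolding less_eq_model_def less_iff_model by (metis add_assoc_model basic_facts(3))
next
  assume "\<exists>c. b = a + c"
  then obtain c where b: "b = a + c" by blast
  consider "c = 0" | d where "c = d + 1"
  proof -
    have "c = 0 \<or> 0 < c" using less_linear_model basic_facts(7) by blast
    then show ?thesis using that less_iff_model by (metis zero_add_model)
  qed
  then show "a \<le> b"
  proof cases
    case 1
    then show ?thesis by (simp add: less_eq_model_def b basic_facts(3))
  next
    case 2
    then show ?thesis unfolding less_eq_model_def less_iff_model b using basic_facts(4) by blast
  qed
qed

lemma add_left_less_model: "a < b \<longleftrightarrow> c + a < c + (b :: model)"
proof -
  have "a < b \<Longrightarrow> c + a < c + b" for a b
    unfolding less_iff_model using add_assoc_model by metis
  then show ?thesis using less_linear_model less_irrefl_model less_trans_model by metis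
qed

lemma add_left_cancel_model: "c + a = c + b \<Longrightarrow> a = (b :: model)"
  using less_linear_model add_left_less_model less_irrefl_model by metis

instantiation model :: linordered_semidom
begin

definition minus_model :: "model \<Rightarrow> model \<Rightarrow> model" where
  "minus_model a b = (if b \<le> a then THE c. b + c = a else 0)"

lemma minus_model_eq: "b + c = a \<Longrightarrow> a - b = (c :: model)"
proof -
  assume *: "b + c = a"
  then have "b \<le> a" using le_iff_model by blast
  moreover have "(THE c. b + c = a) = c"
    using * add_left_cancel_model by (intro the_equality) blast+
  ultimately show ?thesis by (simp add: minus_model_def)
qed

lemma minus_model_zero: "\<not> b \<le> a \<Longrightarrow> a - b = (0 :: model)"
  by (simp add: minus_model_def)

instance
proof intro_classes
  fix a b c :: model
  show "a + b + c = a + (b + c)" by (rule add_assoc_model)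
  show "a + b = b + a" by (rule add_commute_model)
  show "0 + a = a" by (rule zero_add_model)
  show "a * b * c = a * (b * c)" by (rule mult_assoc_model)
  show "a * b = b * a" by (rule mult_commute_model)
  show "1 * a = a" by (rule one_mult_model)
  show "(a + b) * c = a * c + b * c" by (rule distrib_right_model)
  show "a * (b + c) = a * b + a * c" by (metis distrib_right_model mult_commute_model)
  show "0 * a = 0" by (rule zero_mult_model)
  show "a * 0 = 0" by (rule basic_facts)
  show zo: "(0 :: model) \<noteq> 1" by (metis basic_facts(1) zero_add_model)
  show "(0 :: model) < 1" using zero_less_add_one_model[of 0] by (simp add: zero_add_model)
  show "a + b - a = b" by (rule minus_model_eq) (rule refl)
  show lin: "a \<le> b \<or> b \<le> a" using less_linear_model by (auto simp: less_eq_model_def)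
  show "a < b \<longleftrightarrow> a \<le> b \<and> \<not> b \<le> a"
    using less_irrefl_model less_trans_model by (auto simp: less_eq_model_def)
  show "a \<le> a" by (simp add: less_eq_model_def)
  show "a \<le> b \<Longrightarrow> b \<le> c \<Longrightarrow> a \<le> c"
    using less_trans_model by (auto simp: less_eq_model_def)
  show "a \<le> b \<Longrightarrow> b \<le> a \<Longrightarrow> a = b"
    using less_irrefl_model less_trans_model by (auto simp: less_eq_model_def)
  show "a \<le> b \<Longrightarrow> c + a \<le> c + b"
    using add_left_less_model by (auto simp: less_eq_model_def)
  show "a < b \<Longrightarrow> 0 < c \<Longrightarrow> c * a < c * b"
  proof -
    assume "a < b" "0 < c"
    then obtain d k where "b = a + d + 1" "c = k + 1"
      unfolding less_iff_model by (metis zero_add_model)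
    then have "c * b = c * a + (c * d + k) + 1"
      by (metis add_assoc_model basic_facts(6) distrib_right_model mult_commute_model)
    then show "c * a < c * b" unfolding less_iff_model by blast
  qed
  show "b \<le> a \<Longrightarrow> a - b + b = a"
    using minus_model_eq le_iff_model add_commute_model by metis
  show "a \<noteq> 0 \<Longrightarrow> b \<noteq> 0 \<Longrightarrow> a * b \<noteq> 0"
  proof -
    assume "a \<noteq> 0" "b \<noteq> 0"
    then obtain d k where "a = d + 1" "b = k + 1"
      using less_linear_model[of 0] basic_facts(7) unfolding less_iff_model by (metis zero_add_model)
    then have "a * b = a * k + d + 1" by (metis add_assoc_model basic_facts(6))
    then show ?thesis using basic_facts(1) by metis
  qed
  show "a - b - c = a - (b + c)"
  proof (cases "b + c \<le> a")
    case True
    then obtain d where "a = b + c + d" using le_iff_model by blast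
    then show ?thesis using minus_model_eq add_assoc_model by metis
  next
    case False
    show ?thesis
    proof (cases "b \<le> a")
      case True
      then obtain d where d: "a = b + d" using le_iff_model by blast
      then have "\<not> c \<le> d" using False le_iff_model add_assoc_model by metis
      then have "a - b - c = 0" using d minus_model_eq minus_model_zero by metis
      then show ?thesis using False minus_model_zero by simp
    next
      case b: False
      have "0 - c = 0"
      proof (cases "c \<le> 0")
        case True
        then have "c = 0" using basic_facts(7) by (auto simp: less_eq_model_def)
        then show ?thesis using minus_model_eq zero_add_model by metis
      qed (rule minus_model_zero)
      then show ?thesis using False b minus_model_zero by simp
    qed
  qed
  show "a * (b - c) = a * b - a * c"
  proof (cases "c \<le> b")
    case True
    then obtain d where d: "b = c + d" using le_iff_model by blast
    then have "a * c + a * d = a * b" using distrib_right_model mult_commute_model by metis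
    then show ?thesis using d minus_model_eq by metis
  next
    case False
    then obtain d where "c = b + d" using lin le_iff_model
      by (metis less_linear_model less_eq_model_def)
    then have "a * c = a * b + a * d" using distrib_right_model mult_commute_model by metis
    then have le: "a * b \<le> a * c" using le_iff_model by blast
    have "a * b - a * c = 0"
    proof (cases "a * c \<le> a * b")
      case True
      then have "a * b = a * c" using le less_irrefl_model less_trans_model
        by (auto simp: less_eq_model_def)
      then show ?thesis using minus_model_eq basic_facts(3) by metis
    qed (rule minus_model_zero)
    then show ?thesis using False minus_model_zero basic_facts(5) by simp
  qed
qed

end

instance model :: canonically_ordered_monoid_add
  by intro_classes (rule le_iff_model)

lemma less_add_one_iff [simp]: "a < b + 1 \<longleftrightarrow> a \<le> (b :: model)"
  by (simp add: basic_facts less_eq_model_def)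

lemma add_one_le_iff [simp]: "a + 1 \<le> b \<longleftrightarrow> a < (b :: model)"
  by (metis less_add_one_iff not_le)

lemma less_one_iff [simp]: "a < 1 \<longleftrightarrow> a = (0 :: model)"
  using less_add_one_iff[of a 0] by simp

lemma square_ge_self: "x \<le> x * (x :: model)"
proof (cases "x = 0")
  case False
  then have "1 \<le> x" by (metis less_one_iff not_less)
  then show ?thesis using mult_left_mono[of 1 x x] by simp
qed simp

definition pair :: "model \<Rightarrow> model \<Rightarrow> model" where
  "pair a b = (a + b) * (a + b) + a"

lemma val_pr [simp]: "val \<MM> \<rho> (pr s t) = pair (val \<MM> \<rho> s) (val \<MM> \<rho> t)"
  by (simp add: pr_def pair_def)

lemma pair_inj [simp]: "pair a b = pair c d \<longleftrightarrow> a = c \<and> b = d"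
proof
  assume eq: "pair a b = pair c d"
  have *: "pair a b < pair c d" if "a + b < c + d" for a b c d
  proof -
    have "(a + b + 1) * (a + b + 1) \<le> (c + d) * (c + d)"
      using that by (intro mult_mono) simp_all
    also have "(a + b + 1) * (a + b + 1) = pair a b + (a + b + b + 1)"
      by (simp add: pair_def algebra_simps)
    finally have "pair a b + (a + b + b + 1) \<le> pair c d"
      unfolding pair_def[of c d] by (metis add_increasing2 zero_le)
    moreover have "pair a b < pair a b + (a + b + b + 1)"
      using less_add_one_iff[of "pair a b" "pair a b + (a + b + b)"] by (simp add: add.assoc)
    ultimately show ?thesis by (rule less_le_trans[rotated])
  qed
  have s: "a + b = c + d"
    using eq *[of a b c d] *[of c d a b] by (metis less_irrefl linorder_neqE)
  then have "a = c" using eq unfolding pair_def s by simp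
  with s show "a = c \<and> b = d" by simp
qed simp

lemma le_pair: "a \<le> pair a b" "b \<le> pair a b"
proof -
  show "a \<le> pair a b" by (simp add: pair_def)
  have "b \<le> a + b" by simp
  also have "\<dots> \<le> (a + b) * (a + b)" by (rule square_ge_self)
  also have "\<dots> \<le> pair a b" by (simp add: pair_def)
  finally show "b \<le> pair a b" .
qed

section \<open>Recursive definability in the model\<close>

lemma comprehension:
  assumes "sigma00 \<theta>" "fnv \<theta> \<subseteq> range Nm" "fsv \<theta> \<subseteq> range Nm"
    and "sigma00 \<theta>'" "fnv \<theta>' \<subseteq> range Nm" "fsv \<theta>' \<subseteq> range Nm"
    and iff: "\<And>a. (\<exists>b. holds \<MM> (\<rho>(Nm z := a, Nm m := b)) set_env \<theta>) \<longleftrightarrow>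
      (\<forall>b. holds \<MM> (\<rho>(Nm z := a, Nm m := b)) set_env \<theta>')"
  shows "{a. \<exists>b. holds \<MM> (\<rho>(Nm z := a, Nm m := b)) set_env \<theta>} \<in> Sets"
proof -
  obtain k where k: "Nm (''e'', [k]) \<notin> fsv \<theta>" using fresh_name finite_vars(3) by blast
  define X where "X = (''e'', [k])"
  have X: "Nm X \<notin> fsv \<theta>" using k by (simp add: X_def)
  have "valid_in \<MM> (comprehension_ax X z m m \<theta> \<theta>')"
  proof (rule RCA_star_instance_valid[OF RCA_star_MM])
    show "comprehension_ax X z m m \<theta> \<theta>' \<in> RCA_star_instances"
      using assms(1,4) X unfolding RCA_star_instances_def by blast
    show "fnv (comprehension_ax X z m m \<theta> \<theta>') \<subseteq> range Nm" "fsv (comprehension_ax X z m m \<theta> \<theta>') \<subseteq> range Nm"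
      using assms by (auto simp: comprehension_ax_def)
  qed
  then have "holds \<MM> \<rho> set_env (comprehension_ax X z m m \<theta> \<theta>')"
    using set_env_Sets by (auto simp: valid_in_def)
  then have "\<exists>A\<in>Sets. \<forall>a. holds \<MM> (\<rho>(Nm z := a)) (set_env(Nm X := A)) (Var (Nm z) \<^bold>\<in> Nm X) \<longleftrightarrow>
      (\<exists>b. holds \<MM> (\<rho>(Nm z := a, Nm m := b)) (set_env(Nm X := A)) \<theta>)"
    using iff unfolding comprehension_ax_def by (simp only: holds_connectives holds.simps(5-7)) blast
  then obtain A where A: "A \<in> Sets" "\<And>a. holds \<MM> (\<rho>(Nm z := a)) (set_env(Nm X := A)) (Var (Nm z) \<^bold>\<in> Nm X) \<longleftrightarrow>
      (\<exists>b. holds \<MM> (\<rho>(Nm z := a, Nm m := b)) (set_env(Nm X := A)) \<theta>)" by blast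
  have "a \<in> A \<longleftrightarrow> (\<exists>b. holds \<MM> (\<rho>(Nm z := a, Nm m := b)) set_env \<theta>)" for a
    using A(2)[of a] unfolding holds_fresh_set[OF X] by simp
  then have "{a. \<exists>b. holds \<MM> (\<rho>(Nm z := a, Nm m := b)) set_env \<theta>} = A" by auto
  then show ?thesis using A(1) by simp
qed

lemma dec_Collect: "dec (\<lambda>e. P (e 0)) \<Longrightarrow> {x. P x} \<in> Sets"
proof -
  assume P: "dec (\<lambda>e. P (e 0))"
  let ?x = "(''e'', [0])" and ?m = "(''e'', [1])"
  obtain \<phi> where \<phi>: "sigma00 \<phi>" "fnv \<phi> \<subseteq> range Nm" "fsv \<phi> \<subseteq> range Nm"
    "\<And>\<rho>. num_env \<rho> \<Longrightarrow> holds \<MM> \<rho> set_env \<phi> = P (\<rho> (Nm ?x))"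
    using decE[OF P term_vector_single[of 0]] by (auto simp: vals_def)
  obtain \<rho> where \<rho>: "num_env \<rho>" using num_env_exists by blast
  have at: "holds \<MM> (\<rho>(Nm ?x := a, Nm ?m := b)) set_env \<phi> = P a" for a b
    using \<phi>(4)[OF num_env_upd[OF num_env_upd[OF \<rho>, of "[0]" a], of "[1]" b]] by simp
  have "{a. \<exists>b. holds \<MM> (\<rho>(Nm ?x := a, Nm ?m := b)) set_env \<phi>} \<in> Sets"
    by (rule comprehension[OF \<phi>(1-3) \<phi>(1-3)]) (simp only: at simp_thms)
  then show ?thesis by (simp only: at simp_thms)
qed

section \<open>Definitions that are both Sigma^0_1 and Pi^0_1, as bounded definitions with a set
  parameter\<close>

definition bexs :: "name list \<Rightarrow> name \<Rightarrow> fm \<Rightarrow> fm" where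
  "bexs xs z \<phi> = foldr (\<lambda>x. bex_fm x (Var (Nm z) \<^bold>+ \<^bold>1)) xs \<phi>"

definition names_tuple :: "name list \<Rightarrow> trm" where
  "names_tuple xs = foldr (\<lambda>x. pr (Var (Nm x))) xs \<^bold>0"

lemma bexs_simps [simp]:
  "z \<notin> set xs \<Longrightarrow> sigma00 \<phi> \<Longrightarrow> sigma00 (bexs xs z \<phi>)"
  "fnv \<phi> \<subseteq> range Nm \<Longrightarrow> fnv (bexs xs z \<phi>) \<subseteq> range Nm" "fsv (bexs xs z \<phi>) = fsv \<phi>"
  by (induction xs) (auto simp: bexs_def intro: sigma00.intros)

lemma vars_names_tuple [simp]: "vars_trm (names_tuple xs) = Nm ` set xs"
  by (induction xs) (auto simp: names_tuple_def)

lemma names_tuple_inj: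
  "val \<MM> \<rho> (names_tuple xs) = val \<MM> \<rho>' (names_tuple xs) \<Longrightarrow> x \<in> set xs \<Longrightarrow> \<rho> (Nm x) = \<rho>' (Nm x)"
  by (induction xs) (auto simp: names_tuple_def)

text \<open>An entry never exceeds the code of its tuple. Hence quantifiers bounded by the code
  suffice to decode it, and decoding stays within bounded formulas.\<close>

lemma le_names_tuple: "x \<in> set xs \<Longrightarrow> \<rho> (Nm x) \<le> val \<MM> \<rho> (names_tuple xs)"
proof (induction xs)
  case (Cons y xs)
  let ?t = "val \<MM> \<rho> (names_tuple xs)"
  have eq: "val \<MM> \<rho> (names_tuple (y # xs)) = pair (\<rho> (Nm y)) ?t" by (simp add: names_tuple_def)
  have "\<rho> (Nm y) \<le> pair (\<rho> (Nm y)) ?t" "?t \<le> pair (\<rho> (Nm y)) ?t" by (rule le_pair)+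
  then show ?case using Cons unfolding eq by (auto intro: order_trans)
qed simp

lemma holds_bexs:
  "z \<notin> set xs \<Longrightarrow> distinct xs \<Longrightarrow> holds \<MM> \<rho> S (bexs xs z \<phi>) \<longleftrightarrow>
    (\<exists>\<rho>'. (\<forall>v. v \<notin> Nm ` set xs \<longrightarrow> \<rho>' v = \<rho> v) \<and> (\<forall>x\<in>set xs. \<rho>' (Nm x) \<le> \<rho> (Nm z)) \<and> holds \<MM> \<rho>' S \<phi>)"
proof (induction xs arbitrary: \<rho>)
  case Nil
  have "(\<forall>v. \<rho>' v = \<rho> v) \<longleftrightarrow> \<rho>' = \<rho>" for \<rho>' by auto
  then show ?case by (simp add: bexs_def)
next
  case (Cons x xs)
  have "holds \<MM> \<rho> S (bexs (x # xs) z \<phi>) \<longleftrightarrow>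
      (\<exists>a. a \<le> \<rho> (Nm z) \<and> holds \<MM> (\<rho>(Nm x := a)) S (bexs xs z \<phi>))"
    using Cons.prems by (simp add: bexs_def)
  also have "\<dots> \<longleftrightarrow> (\<exists>a. a \<le> \<rho> (Nm z) \<and> (\<exists>\<rho>'. (\<forall>v. v \<notin> Nm ` set xs \<longrightarrow> \<rho>' v = (\<rho>(Nm x := a)) v) \<and>
      (\<forall>y\<in>set xs. \<rho>' (Nm y) \<le> \<rho> (Nm z)) \<and> holds \<MM> \<rho>' S \<phi>))"
    using Cons.prems Cons.IH by simp
  also have "\<dots> \<longleftrightarrow> (\<exists>\<rho>'. (\<forall>v. v \<notin> Nm ` set (x # xs) \<longrightarrow> \<rho>' v = \<rho> v) \<and>
      (\<forall>y\<in>set (x # xs). \<rho>' (Nm y) \<le> \<rho> (Nm z)) \<and> holds \<MM> \<rho>' S \<phi>)" (is "?L \<longleftrightarrow> ?R")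
  proof
    assume ?L
    then obtain a \<rho>' where "a \<le> \<rho> (Nm z)" and \<rho>': "\<And>v. v \<notin> Nm ` set xs \<Longrightarrow> \<rho>' v = (\<rho>(Nm x := a)) v"
      "\<forall>y\<in>set xs. \<rho>' (Nm y) \<le> \<rho> (Nm z)" "holds \<MM> \<rho>' S \<phi>" by blast
    moreover have "\<rho>' (Nm x) = a" using \<rho>'(1)[of "Nm x"] Cons.prems by auto
    ultimately show ?R by (intro exI[of _ \<rho>']) auto
  next
    assume ?R
    then obtain \<rho>' where "\<And>v. v \<notin> Nm ` set (x # xs) \<Longrightarrow> \<rho>' v = \<rho> v"
      "\<forall>y\<in>set (x # xs). \<rho>' (Nm y) \<le> \<rho> (Nm z)" "holds \<MM> \<rho>' S \<phi>" by blast
    then show ?L by (intro exI[of _ "\<rho>' (Nm x)"] conjI exI[of _ \<rho>']) auto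
  qed
  finally show ?case .
qed

text \<open>
  This needs comprehension: tuples of arguments are coded by numbers, and the set of codes of the
  tuples satisfying the predicate becomes a parameter.
\<close>

lemma dec_Delta1:
  assumes P: "dec (\<lambda>e. P (e 0) (\<lambda>i. e (Suc i)))" and Q: "dec (\<lambda>e. Q (e 0) (\<lambda>i. e (Suc i)))"
    and iff: "\<And>e. (\<exists>m. P m e) \<longleftrightarrow> (\<forall>m. Q m e)"
  shows "dec (\<lambda>e. \<exists>m. P m e)"
proof (rule decI)
  fix \<tau> assume \<tau>: "term_vector \<tau>"
  let ?V = "\<Union>i. vars_trm (\<tau> i)"
  have "finite ?V" "?V \<subseteq> (\<lambda>k. Nm (''e'', [k])) ` UNIV"
    using \<tau> by (auto simp: term_vector_def)
  then obtain K where K: "finite K" "?V = (\<lambda>k. Nm (''e'', [k])) ` K"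
    using finite_subset_image by metis
  obtain ks where "set ks = K" "distinct ks" using finite_distinct_list[OF K(1)] by blast
  with K have ks: "?V = (\<lambda>k. Nm (''e'', [k])) ` set ks" "distinct ks" by simp_all
  define xs :: "name list" where "xs = map (\<lambda>k. (''e'', [k])) ks"
  have xs: "Nm ` set xs = ?V" "distinct xs"
    using ks by (auto simp: xs_def distinct_map inj_on_def image_image)
  obtain i where i: "Nm (''e'', [i]) \<notin> ?V"
    using fresh_name[of ?V] \<tau> by (auto simp: term_vector_def)
  obtain j where j: "Nm (''e'', [j]) \<notin> insert (Nm (''e'', [i])) ?V"
    using fresh_name[of "insert (Nm (''e'', [i])) ?V"] \<tau> by (auto simp: term_vector_def)
  define m where "m = (''e'', [i])"
  define z where "z = (''e'', [j])"
  have fresh: "Nm m \<notin> ?V" "Nm z \<notin> ?V" "m \<noteq> z" using i j by (auto simp: m_def z_def)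
  then have notin: "m \<notin> set xs" "z \<notin> set xs" unfolding xs(1)[symmetric] by auto
  have reduce: "\<exists>\<phi>. sigma00 \<phi> \<and> fnv \<phi> \<subseteq> range Nm \<and> fsv \<phi> \<subseteq> range Nm \<and>
      (\<forall>\<rho>. num_env \<rho> \<longrightarrow> holds \<MM> \<rho> set_env \<phi> = R (\<rho> (Nm m)) (vals \<rho> \<tau>))"
    if "dec (\<lambda>e. R (e 0) (\<lambda>i. e (Suc i)))" for R
    using decE[OF that term_vector_case[OF \<tau>, of i]] unfolding m_def[symmetric] vals_def
    by simp metis
  obtain \<phi> where \<phi>: "sigma00 \<phi>" "fnv \<phi> \<subseteq> range Nm" "fsv \<phi> \<subseteq> range Nm"
    "\<And>\<rho>. num_env \<rho> \<Longrightarrow> holds \<MM> \<rho> set_env \<phi> = P (\<rho> (Nm m)) (vals \<rho> \<tau>)"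
    using reduce[OF P] by blast
  obtain \<psi> where \<psi>: "sigma00 \<psi>" "fnv \<psi> \<subseteq> range Nm" "fsv \<psi> \<subseteq> range Nm"
    "\<And>\<rho>. num_env \<rho> \<Longrightarrow> holds \<MM> \<rho> set_env \<psi> = Q (\<rho> (Nm m)) (vals \<rho> \<tau>)"
    using reduce[OF Q] by blast
  \<comment> \<open>The variable z codes values of the variables in \<open>xs\<close> for which
    \<chi> holds. The truth of the wrapped formula depends only on z, on m and on parameters of the
    model, which is the form that comprehension accepts.\<close>
  define wrap where "wrap \<chi> = bexs xs z (Var (Nm z) \<^bold>= names_tuple xs \<^bold>\<and> \<chi>)" for \<chi>
  have wrap: "sigma00 (wrap \<chi>)" "fnv (wrap \<chi>) \<subseteq> range Nm" "fsv (wrap \<chi>) \<subseteq> range Nm"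
    if "sigma00 \<chi>" "fnv \<chi> \<subseteq> range Nm" "fsv \<chi> \<subseteq> range Nm" for \<chi>
    using that notin unfolding wrap_def
    by (auto intro!: bexs_simps sigma00.intros sigma00_connectives)
  obtain \<rho>0 where \<rho>0: "num_env \<rho>0" using num_env_exists by blast
  have holds_wrap: "holds \<MM> (\<rho>0(Nm z := a, Nm m := b)) set_env (wrap \<chi>) \<longleftrightarrow>
      (\<exists>\<rho>'. a = val \<MM> \<rho>' (names_tuple xs) \<and> R b (vals \<rho>' \<tau>))"
    if \<chi>: "\<And>\<rho>. num_env \<rho> \<Longrightarrow> holds \<MM> \<rho> set_env \<chi> = R (\<rho> (Nm m)) (vals \<rho> \<tau>)" for \<chi> R a b
  proof
    let ?\<rho> = "\<rho>0(Nm z := a, Nm m := b)"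
    assume "holds \<MM> ?\<rho> set_env (wrap \<chi>)"
    then obtain \<rho>' where \<rho>': "\<And>v. v \<notin> Nm ` set xs \<Longrightarrow> \<rho>' v = ?\<rho> v"
      "holds \<MM> \<rho>' set_env (Var (Nm z) \<^bold>= names_tuple xs \<^bold>\<and> \<chi>)"
      unfolding wrap_def holds_bexs[OF notin(2) xs(2)] by blast
    have "\<rho>' (Nm (pnum c)) = c" for c
      using \<rho>0 \<rho>'(1)[of "Nm (pnum c)"] by (auto simp: num_env_def pnum_def xs_def m_def z_def)
    then have "num_env \<rho>'" by (simp add: num_env_def)
    moreover have "\<rho>' (Nm z) = a" "\<rho>' (Nm m) = b"
      using \<rho>'(1)[of "Nm z"] \<rho>'(1)[of "Nm m"] notin fresh(3) by auto
    ultimately show "\<exists>\<rho>'. a = val \<MM> \<rho>' (names_tuple xs) \<and> R b (vals \<rho>' \<tau>)"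
      using \<rho>'(2) \<chi> by (intro exI[of _ \<rho>']) auto
  next
    let ?\<rho> = "\<rho>0(Nm z := a, Nm m := b)"
    assume "\<exists>\<rho>'. a = val \<MM> \<rho>' (names_tuple xs) \<and> R b (vals \<rho>' \<tau>)"
    then obtain \<rho>1 where \<rho>1: "a = val \<MM> \<rho>1 (names_tuple xs)" "R b (vals \<rho>1 \<tau>)" by blast
    define \<rho>' where "\<rho>' v = (if v \<in> Nm ` set xs then \<rho>1 v else ?\<rho> v)" for v
    have "val \<MM> \<rho>' (names_tuple xs) = val \<MM> \<rho>1 (names_tuple xs)"
      by (rule val_cong) (auto simp: \<rho>'_def)
    moreover have "vals \<rho>' \<tau> = vals \<rho>1 \<tau>"
      unfolding vals_def by (intro HOL.ext val_cong) (use xs(1) in \<open>auto simp: \<rho>'_def\<close>)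
    moreover have "\<rho>' (Nm (pnum c)) = c" for c
      using \<rho>0 by (auto simp: num_env_def pnum_def xs_def m_def z_def \<rho>'_def)
    then have "num_env \<rho>'" by (simp add: num_env_def)
    moreover have "\<rho>' (Nm z) = a" "\<rho>' (Nm m) = b" using notin fresh(3) by (auto simp: \<rho>'_def)
    ultimately have "holds \<MM> \<rho>' set_env (Var (Nm z) \<^bold>= names_tuple xs \<^bold>\<and> \<chi>)"
      using \<chi>[of \<rho>'] \<rho>1 by simp
    moreover have "\<rho>' v = ?\<rho> v" if "v \<notin> Nm ` set xs" for v using that by (simp add: \<rho>'_def)
    moreover have "\<rho>' (Nm x) \<le> ?\<rho> (Nm z)" if "x \<in> set xs" for x
      using le_names_tuple[OF that, of \<rho>1] that \<rho>1(1) fresh(3) by (simp add: \<rho>'_def)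
    ultimately show "holds \<MM> ?\<rho> set_env (wrap \<chi>)"
      unfolding wrap_def holds_bexs[OF notin(2) xs(2)] by blast
  qed
  have vals_eq: "vals \<rho> \<tau> = vals \<rho>' \<tau>"
    if "val \<MM> \<rho> (names_tuple xs) = val \<MM> \<rho>' (names_tuple xs)" for \<rho> \<rho>'
    unfolding vals_def
  proof (intro HOL.ext val_cong)
    fix l v assume "v \<in> vars_trm (\<tau> l)"
    then have "v \<in> Nm ` set xs" using xs(1) by auto
    then show "\<rho> v = \<rho>' v" using names_tuple_inj[OF that] by auto
  qed
  have hP: "holds \<MM> (\<rho>0(Nm z := a, Nm m := b)) set_env (wrap \<phi>) \<longleftrightarrow>
      (\<exists>\<rho>'. a = val \<MM> \<rho>' (names_tuple xs) \<and> P b (vals \<rho>' \<tau>))" for a b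
    by (rule holds_wrap) (rule \<phi>(4))
  have hQ: "holds \<MM> (\<rho>0(Nm z := a, Nm m := b)) set_env (wrap \<psi>) \<longleftrightarrow>
      (\<exists>\<rho>'. a = val \<MM> \<rho>' (names_tuple xs) \<and> Q b (vals \<rho>' \<tau>))" for a b
    by (rule holds_wrap) (rule \<psi>(4))
  define X where "X = {a. \<exists>b. holds \<MM> (\<rho>0(Nm z := a, Nm m := b)) set_env (wrap \<phi>)}"
  have "X \<in> Sets" unfolding X_def
  proof (rule comprehension[OF wrap[OF \<phi>(1-3)] wrap[OF \<psi>(1-3)]])
    fix a
    show "(\<exists>b. holds \<MM> (\<rho>0(Nm z := a, Nm m := b)) set_env (wrap \<phi>)) \<longleftrightarrow>
        (\<forall>b. holds \<MM> (\<rho>0(Nm z := a, Nm m := b)) set_env (wrap \<psi>))"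
    proof (cases "\<exists>\<rho>'. a = val \<MM> \<rho>' (names_tuple xs)")
      case True
      then obtain \<rho> where \<rho>: "a = val \<MM> \<rho> (names_tuple xs)" by blast
      have "(\<exists>\<rho>'. a = val \<MM> \<rho>' (names_tuple xs) \<and> R (vals \<rho>' \<tau>)) \<longleftrightarrow> R (vals \<rho> \<tau>)" for R
        using \<rho> vals_eq by metis
      then show ?thesis by (simp only: hP hQ iff)
    next
      \<comment> \<open>At a number that codes no tuple both wrapped formulas fail for every m, so
        both sides of the equivalence are false.\<close>
      case False
      then show ?thesis by (simp only: hP hQ) blast
    qed
  qed
  moreover have "(val \<MM> \<rho> (names_tuple xs) \<in> X) = (\<exists>b. P b (vals \<rho> \<tau>))" for \<rho>
  proof -
    have "(\<exists>\<rho>'. val \<MM> \<rho> (names_tuple xs) = val \<MM> \<rho>' (names_tuple xs) \<and> R (vals \<rho>' \<tau>)) \<longleftrightarrow> R (vals \<rho> \<tau>)" for R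
      using vals_eq by metis
    then show ?thesis unfolding X_def mem_Collect_eq by (simp only: hP)
  qed
  ultimately show "\<exists>\<phi>. defines_fm \<tau> \<phi> (\<lambda>e. \<exists>m. P m e)"
    by (intro exI[of _ "names_tuple xs \<^bold>\<in> Nm (pset X)"])
      (auto simp: defines_fm_def set_env_pset intro: sigma00.intros)
qed

text \<open>Definability through the graph instead of a term, because the language has no terms for
  exponentiation or for the values f^n c.\<close>

definition df :: "((nat \<Rightarrow> model) \<Rightarrow> model) \<Rightarrow> bool" where
  "df f \<longleftrightarrow> dec (\<lambda>e. e 0 = f (\<lambda>i. e (Suc i)))"

text \<open>The claim about the value can be put as \<exists>m. m = f e \<and> Q m and as
  \<forall>m. m = f e \<longrightarrow> Q m. Thus it is Delta^0_1 without any bound on the value,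
  and \<open>dec_Delta1\<close> applies.\<close>

lemma dec_subst:
  assumes f: "df f" and Q: "dec (\<lambda>e. Q (e 0) (\<lambda>i. e (Suc i)))"
  shows "dec (\<lambda>e. Q (f e) e)"
proof -
  have "dec (\<lambda>e. \<exists>m. m = f e \<and> Q m e)"
    using f Q unfolding df_def
    by (intro dec_Delta1[of "\<lambda>m e. m = f e \<and> Q m e" "\<lambda>m e. m = f e \<longrightarrow> Q m e"] dec_intros) auto
  then show ?thesis by simp
qed

lemma df_reindex: "df f \<Longrightarrow> df (\<lambda>e. f (\<lambda>i. e (\<pi> i)))"
  unfolding df_def
  by (drule dec_reindex[where \<pi> = "case_nat 0 (\<lambda>i. Suc (\<pi> i))"]) simp

lemma df_Suc: "df f \<Longrightarrow> df (\<lambda>e. f (\<lambda>i. e (Suc i)))"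
  by (rule df_reindex)

text \<open>Substitution acts on the argument with index 0, so the arguments are brought to that
  position one after another. Three places cover the graph of a binary function.\<close>

lemma dec_ternary:
  assumes R: "dec (\<lambda>e. R (e 0) (e (Suc 0)) (e (Suc (Suc 0))))" and f: "df f" and g: "df g" and h: "df h"
  shows "dec (\<lambda>e. R (f e) (g e) (h e))"
proof -
  have "dec (\<lambda>e. R (e (Suc (Suc 0))) (e (Suc 0)) (e 0))"
    using dec_reindex[OF R, of "\<lambda>i. if i = 0 then Suc (Suc 0) else if i = Suc 0 then Suc 0 else 0"] by simp
  then have "dec (\<lambda>e. R (e (Suc 0)) (e 0) (h (\<lambda>i. e (Suc (Suc i)))))"
    using dec_subst[where f = "\<lambda>e. h (\<lambda>i. e (Suc (Suc i)))" and Q = "\<lambda>y e. R (e (Suc 0)) (e 0) y"]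
      df_reindex[OF h, of "\<lambda>i. Suc (Suc i)"] by simp
  then have "dec (\<lambda>e. R (e 0) (g (\<lambda>i. e (Suc i))) (h (\<lambda>i. e (Suc i))))"
    using dec_subst[where f = "\<lambda>e. g (\<lambda>i. e (Suc i))" and Q = "\<lambda>y e. R (e 0) y (h (\<lambda>i. e (Suc i)))"]
      df_Suc[OF g] by simp
  then show ?thesis
    using dec_subst[OF f, where Q = "\<lambda>y e. R y (g e) (h e)"] by simp
qed

lemma df_const [dec_intros]: "df (\<lambda>e. a)"
  unfolding df_def by (intro basic_dec_intros)

lemma df_var [dec_intros]: "df (\<lambda>e. e n)"
  unfolding df_def by (intro basic_dec_intros)

lemma dec_binary:
  "dec (\<lambda>e. R (e 0) (e (Suc 0))) \<Longrightarrow> df f \<Longrightarrow> df g \<Longrightarrow> dec (\<lambda>e. R (f e) (g e))"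
  using dec_ternary[where R = "\<lambda>x y z. R x y", OF _ _ _ df_const] by simp

lemma dec_unary:
  "dec (\<lambda>e. R (e 0)) \<Longrightarrow> df f \<Longrightarrow> dec (\<lambda>e. R (f e))"
  using dec_binary[where R = "\<lambda>x y. R x", OF _ _ df_const] by simp

lemma df_binary:
  assumes "dec (\<lambda>e. e 0 = F (e (Suc 0)) (e (Suc (Suc 0))))" "df f" "df g"
  shows "df (\<lambda>e. F (f e) (g e))"
  unfolding df_def
  by (rule dec_ternary[where R = "\<lambda>x y z. x = F y z"]) (intro assms df_Suc df_var)+

lemma df_unary:
  assumes "dec (\<lambda>e. e 0 = F (e (Suc 0)))" "df f" shows "df (\<lambda>e. F (f e))"
  using df_binary[where F = "\<lambda>x y. F x", OF _ _ df_const] assms by simp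

lemma dec_eq [dec_intros]: "df f \<Longrightarrow> df g \<Longrightarrow> dec (\<lambda>e. f e = g e)"
  by (rule dec_binary) (intro basic_dec_intros)

lemma dec_less [dec_intros]: "df f \<Longrightarrow> df g \<Longrightarrow> dec (\<lambda>e. f e < g e)"
  by (rule dec_binary) (intro basic_dec_intros)

lemma dec_le [dec_intros]: "df f \<Longrightarrow> df g \<Longrightarrow> dec (\<lambda>e. f e \<le> g e)"
  using dec_not[OF dec_less, of g f] by (simp add: not_less)

lemma dec_mem [dec_intros]: "df f \<Longrightarrow> A \<in> Sets \<Longrightarrow> dec (\<lambda>e. f e \<in> A)"
  by (rule dec_unary) (intro basic_dec_intros)

lemma df_plus [dec_intros]: "df f \<Longrightarrow> df g \<Longrightarrow> df (\<lambda>e. f e + g e)"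
  by (rule df_binary) (intro basic_dec_intros)

lemma df_times [dec_intros]: "df f \<Longrightarrow> df g \<Longrightarrow> df (\<lambda>e. f e * g e)"
  by (rule df_binary) (intro basic_dec_intros)

lemma df_pair [dec_intros]: "df f \<Longrightarrow> df g \<Longrightarrow> df (\<lambda>e. pair (f e) (g e))"
  unfolding pair_def by (intro dec_intros)

lemma dec_ball [dec_intros]:
  assumes f: "df f" and Q: "dec (\<lambda>e. Q (e 0) (\<lambda>i. e (Suc i)))"
  shows "dec (\<lambda>e. \<forall>y. y < f e \<longrightarrow> Q y e)"
proof (rule dec_subst[OF f, where Q = "\<lambda>b e. \<forall>y. y < b \<longrightarrow> Q y e"])
  have "dec (\<lambda>e. Q (e 0) (\<lambda>i. e (Suc (Suc i))))"
    using dec_reindex[OF Q, of "case_nat 0 (\<lambda>i. Suc (Suc i))"] by simp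
  then show "dec (\<lambda>e. \<forall>y. y < e 0 \<longrightarrow> Q y (\<lambda>i. e (Suc i)))"
    by (intro dec_ball_tdef[where Q = "\<lambda>y e. Q y (\<lambda>i. e (Suc i))"] tdef_intros)
qed

lemma dec_bex [dec_intros]:
  assumes "df f" and "dec (\<lambda>e. Q (e 0) (\<lambda>i. e (Suc i)))"
  shows "dec (\<lambda>e. \<exists>y. y < f e \<and> Q y e)"
  using dec_not[OF dec_ball[OF assms(1), of "\<lambda>y e. \<not> Q y e"]] dec_not[OF assms(2)] by simp

lemma dec_ball_le [dec_intros]:
  assumes "df f" and "dec (\<lambda>e. Q (e 0) (\<lambda>i. e (Suc i)))"
  shows "dec (\<lambda>e. \<forall>y. y \<le> f e \<longrightarrow> Q y e)"
  using dec_ball[OF df_plus[OF assms(1) df_const[of 1]] assms(2)] by simp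

lemma dec_bex_le [dec_intros]:
  assumes "df f" and "dec (\<lambda>e. Q (e 0) (\<lambda>i. e (Suc i)))"
  shows "dec (\<lambda>e. \<exists>y. y \<le> f e \<and> Q y e)"
  using dec_bex[OF df_plus[OF assms(1) df_const[of 1]] assms(2)] by simp

lemma df_if [dec_intros]:
  assumes "dec P" "df f" "df g" shows "df (\<lambda>e. if P e then f e else g e)"
proof -
  have "dec (\<lambda>e. (P (\<lambda>i. e (Suc i)) \<longrightarrow> e 0 = f (\<lambda>i. e (Suc i))) \<and>
      (\<not> P (\<lambda>i. e (Suc i)) \<longrightarrow> e 0 = g (\<lambda>i. e (Suc i))))"
    by (intro dec_intros dec_reindex[OF assms(1)] df_Suc[OF assms(2)] df_Suc[OF assms(3)])
  then show ?thesis unfolding df_def by (rule back_subst[of dec]) auto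
qed

lemma df_min [dec_intros]: "df f \<Longrightarrow> df g \<Longrightarrow> df (\<lambda>e. min (f e) (g e))"
  unfolding min_def by (intro dec_intros)

section \<open>Divisibility, course-of-values induction and least elements\<close>

lemma dvd_le: "a dvd b \<Longrightarrow> b \<noteq> 0 \<Longrightarrow> a \<le> (b :: model)"
proof (elim dvdE)
  fix k assume "b \<noteq> 0" "b = a * k"
  then have "1 \<le> k" by (metis less_one_iff mult_zero_right not_less)
  then show "a \<le> b" using \<open>b = a * k\<close> mult_left_mono[of 1 k a] by simp
qed

lemma dec_dvd [dec_intros]: "df f \<Longrightarrow> df g \<Longrightarrow> dec (\<lambda>e. f e dvd g e)"
proof (rule dec_binary[where R = "\<lambda>a b. a dvd b"])
  have *: "a dvd b \<longleftrightarrow> (\<exists>q. q \<le> b \<and> b = a * q)" for a b :: model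
  proof
    assume ab: "a dvd b"
    then obtain q where q: "b = a * q" by blast
    show "\<exists>q. q \<le> b \<and> b = a * q"
    \<comment> \<open>If b = 0 the given quotient may exceed b, for instance when a = 0; then 0 is
      taken instead.\<close>
    proof (cases "b = 0")
      case True
      then show ?thesis by (intro exI[of _ 0]) simp
    next
      case False
      then have "q \<le> b" using q dvd_le[of q b] by simp
      then show ?thesis using q by blast
    qed
  qed auto
  show "dec (\<lambda>e. e 0 dvd e (Suc 0))" unfolding * by (intro dec_intros)
qed

lemma dec_less_induct:
  assumes P: "dec (\<lambda>e. P (e 0))" and step: "\<And>x. (\<And>y. y < x \<Longrightarrow> P y) \<Longrightarrow> P x"
  shows "P (x :: model)"
proof -
  have "\<forall>y. y < x + 1 \<longrightarrow> P y"
  proof (rule dec_induct[where P = "\<lambda>x. \<forall>y. y < x + 1 \<longrightarrow> P y"])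
    have "dec (\<lambda>e. P (e 0))" by (rule P)
    then show "dec (\<lambda>e. \<forall>y. y < e 0 + 1 \<longrightarrow> P y)" by (intro dec_intros)
    show "\<forall>y. y < 0 + 1 \<longrightarrow> P y" using step[of 0] by simp
    show "\<forall>y. y < x + 1 + 1 \<longrightarrow> P y" if *: "\<forall>y. y < x + 1 \<longrightarrow> P y" for x
    proof (intro allI impI)
      fix y assume "y < x + 1 + 1"
      then have "y < x + 1 \<or> y = x + 1" by (simp only: less_add_one_iff le_less)
      then show "P y" using * step[of "x + 1"] by blast
    qed
  qed
  then show ?thesis by simp
qed

lemma dec_least:
  assumes P: "dec (\<lambda>e. P (e 0))" and "P x"
  obtains m :: model where "P m" "\<And>y. y < m \<Longrightarrow> \<not> P y"
  using dec_less_induct[where P = "\<lambda>x. \<not> P x", OF dec_not[OF P]] assms(2) by metis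

section \<open>Exponentiation\<close>

definition exp_tree :: "model set \<Rightarrow> bool" where
  "exp_tree E \<longleftrightarrow> (\<forall>j u. pair j u \<in> E \<longrightarrow>
     j = 0 \<and> u = 1 \<or> (\<exists>i w. j = i + 1 \<and> u = w + w \<and> pair i w \<in> E))"

definition is_exp :: "model \<Rightarrow> model \<Rightarrow> bool" where
  "is_exp x y \<longleftrightarrow> (\<exists>E\<in>Sets. pair x y \<in> E \<and> exp_tree E)"

lemma holds_expo [simp]: "holds \<MM> \<rho> S (expo s t) \<longleftrightarrow> is_exp (val \<MM> \<rho> s) (val \<MM> \<rho> t)"
  by (simp add: expo_def is_exp_def exp_tree_def)

lemma exp_tree_unique:
  assumes E: "E \<in> Sets" "exp_tree E" and E': "E' \<in> Sets" "exp_tree E'"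
    and "pair x y \<in> E" "pair x y' \<in> E'"
  shows "y = y'"
proof -
  \<comment> \<open>A common bound for both values makes uniqueness at x a bounded
    statement.\<close>
  define B where "B = y + y'"
  have "\<forall>y. y \<le> B \<longrightarrow> (\<forall>y'. y' \<le> B \<longrightarrow> pair x y \<in> E \<longrightarrow> pair x y' \<in> E' \<longrightarrow> y = y')"
  proof (rule dec_induct[where P = "\<lambda>x. \<forall>y. y \<le> B \<longrightarrow> (\<forall>y'. y' \<le> B \<longrightarrow> pair x y \<in> E \<longrightarrow> pair x y' \<in> E' \<longrightarrow> y = y')"])
    show "dec (\<lambda>e. \<forall>y. y \<le> B \<longrightarrow> (\<forall>y'. y' \<le> B \<longrightarrow> pair (e 0) y \<in> E \<longrightarrow> pair (e 0) y' \<in> E' \<longrightarrow> y = y'))"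
      by (intro dec_intros E E')
    have "y = 1" if "pair 0 y \<in> F" "exp_tree F" for y F
      using that basic_facts(1) unfolding exp_tree_def by metis
    then show "\<forall>y. y \<le> B \<longrightarrow> (\<forall>y'. y' \<le> B \<longrightarrow> pair 0 y \<in> E \<longrightarrow> pair 0 y' \<in> E' \<longrightarrow> y = y')"
      using E E' by metis
  next
    fix x assume IH: "\<forall>y. y \<le> B \<longrightarrow> (\<forall>y'. y' \<le> B \<longrightarrow> pair x y \<in> E \<longrightarrow> pair x y' \<in> E' \<longrightarrow> y = y')"
    have pre: "\<exists>w. y = w + w \<and> w \<le> y \<and> pair x w \<in> F" if F: "pair (x + 1) y \<in> F" "exp_tree F" for y F
    proof -
      obtain i w where "x + 1 = i + 1" "y = w + w" "pair i w \<in> F"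
        using F basic_facts(1)[of x] unfolding exp_tree_def by metis
      then show ?thesis by auto
    qed
    show "\<forall>y. y \<le> B \<longrightarrow> (\<forall>y'. y' \<le> B \<longrightarrow> pair (x + 1) y \<in> E \<longrightarrow> pair (x + 1) y' \<in> E' \<longrightarrow> y = y')"
      using pre[OF _ E(2)] pre[OF _ E'(2)] IH by (metis order_trans)
  qed
  then show ?thesis using assms(5,6) by (auto simp: B_def)
qed

definition exp2 :: "model \<Rightarrow> model" where
  "exp2 x = (THE y. is_exp x y)"

lemma is_exp_iff: "is_exp x y \<longleftrightarrow> y = exp2 x"
proof -
  have "exp_axiom = foldr AllN [] (foldr AllS [] exp_axiom)" "sentence exp_axiom"
    by (simp_all add: exp_axiom_def sentence_def)
  then have "exp_axiom \<in> RCA_star" unfolding RCA_star_def RCA_star_instances_def by blast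
  then have "holds \<MM> (\<lambda>_. 0) set_env exp_axiom"
    using RCA_star_MM set_env_Sets unfolding valid_in_def by blast
  then have "\<exists>y. is_exp x y" by (simp add: exp_axiom_def)
  moreover have "y = y'" if "is_exp x y" "is_exp x y'" for y y'
    using that exp_tree_unique unfolding is_exp_def by blast
  ultimately show ?thesis unfolding exp2_def by (metis the_equality)
qed

lemma exp_tree_exp2: "E \<in> Sets \<Longrightarrow> exp_tree E \<Longrightarrow> pair x y \<in> E \<Longrightarrow> y = exp2 x"
  using is_exp_iff is_exp_def by blast

lemma exp2_zero [simp]: "exp2 0 = 1"
proof -
  obtain E where "E \<in> Sets" "pair 0 (exp2 0) \<in> E" "exp_tree E"
    using is_exp_iff is_exp_def by blast
  then show ?thesis using basic_facts(1) unfolding exp_tree_def by metis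
qed

lemma exp2_add_one [simp]: "exp2 (x + 1) = exp2 x + exp2 x"
proof -
  obtain E where E: "E \<in> Sets" "pair (x + 1) (exp2 (x + 1)) \<in> E" "exp_tree E"
    using is_exp_iff is_exp_def by blast
  then obtain i w where "x + 1 = i + 1" "exp2 (x + 1) = w + w" "pair i w \<in> E"
    using basic_facts(1) unfolding exp_tree_def by metis
  then show ?thesis using exp_tree_exp2[OF E(1,3)] by auto
qed

text \<open>The induction descends from b. A pair at b - i that is not the base pair has a
  predecessor in \<open>E\<close> with half the value, so exp2 b bounds every value met on the way.
  Monotonicity falls out before \<open>exp2\<close> may occur in an induction formula.\<close>

lemma exp_tree_downward:
  assumes E: "E \<in> Sets" "exp_tree E" "pair b (exp2 b) \<in> E" and "j \<le> b"
  shows "pair j (exp2 j) \<in> E" "exp2 j \<le> exp2 b"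
proof -
  have *: "i \<le> b \<longrightarrow> (\<exists>j. j \<le> b \<and> (\<exists>u. u \<le> exp2 b \<and> b = j + i \<and> pair j u \<in> E))" for i
  proof (rule dec_induct[where P = "\<lambda>i. i \<le> b \<longrightarrow> (\<exists>j. j \<le> b \<and> (\<exists>u. u \<le> exp2 b \<and> b = j + i \<and> pair j u \<in> E))"])
    show "dec (\<lambda>e. e 0 \<le> b \<longrightarrow> (\<exists>j. j \<le> b \<and> (\<exists>u. u \<le> exp2 b \<and> b = j + e 0 \<and> pair j u \<in> E)))"
      by (intro dec_intros E)
    show "0 \<le> b \<longrightarrow> (\<exists>j. j \<le> b \<and> (\<exists>u. u \<le> exp2 b \<and> b = j + 0 \<and> pair j u \<in> E))"
      using E by auto
    show "x + 1 \<le> b \<longrightarrow> (\<exists>j. j \<le> b \<and> (\<exists>u. u \<le> exp2 b \<and> b = j + (x + 1) \<and> pair j u \<in> E))"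
      if IH: "x \<le> b \<longrightarrow> (\<exists>j. j \<le> b \<and> (\<exists>u. u \<le> exp2 b \<and> b = j + x \<and> pair j u \<in> E))" for x
    proof
      assume "x + 1 \<le> b"
      then have "x < b" by simp
      then obtain j u where ju: "j \<le> b" "u \<le> exp2 b" "b = j + x" "pair j u \<in> E" using IH by auto
      have "j \<noteq> 0" using ju(3) \<open>x < b\<close> by auto
      then obtain i w where "j = i + 1" "u = w + w" "pair i w \<in> E"
        using ju(4) E(2) unfolding exp_tree_def by metis
      note iw = this
      have "w \<le> u" by (simp add: iw)
      then have w: "w \<le> exp2 b" using ju(2) by (rule order_trans)
      have bx: "b = i + (x + 1)" using ju(3) iw(1) by (simp add: algebra_simps)
      then have "i \<le> b" using le_iff_model by blast
      then show "\<exists>j. j \<le> b \<and> (\<exists>u. u \<le> exp2 b \<and> b = j + (x + 1) \<and> pair j u \<in> E)"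
        using iw(3) w bx by blast
    qed
  qed
  obtain i where i: "b = j + i" using \<open>j \<le> b\<close> le_iff_model by blast
  then have "i \<le> b" by simp
  then obtain j' u where "b = j' + i" "u \<le> exp2 b" "pair j' u \<in> E" using * by blast
  then have "pair j u \<in> E" "u \<le> exp2 b" using i by auto
  then show "pair j (exp2 j) \<in> E" "exp2 j \<le> exp2 b" using exp_tree_exp2[OF E(1,2)] by auto
qed

lemma exp2_mono: "j \<le> b \<Longrightarrow> exp2 j \<le> exp2 b"
proof -
  obtain E where "E \<in> Sets" "pair b (exp2 b) \<in> E" "exp_tree E"
    using is_exp_iff is_exp_def by blast
  then show "j \<le> b \<Longrightarrow> ?thesis" using exp_tree_downward(2) by blast
qed

text \<open>
  Exponentiation is not yet known to be a set: the axiom only provides its restrictions to initial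
  segments.
\<close>

lemma df_exp2_bounded: "df f \<Longrightarrow> df (\<lambda>e. exp2 (min (f e) b))"
proof (rule df_unary[where F = "\<lambda>x. exp2 (min x b)"])
  obtain E where E: "E \<in> Sets" "pair b (exp2 b) \<in> E" "exp_tree E"
    using is_exp_iff is_exp_def by blast
  have *: "y = exp2 (min j b) \<longleftrightarrow> pair (min j b) y \<in> E" for j y
  proof -
    have "pair (min j b) (exp2 (min j b)) \<in> E" using exp_tree_downward(1)[OF E(1,3,2)] by simp
    then show ?thesis using exp_tree_exp2[OF E(1,3)] by blast
  qed
  show "dec (\<lambda>e. e 0 = exp2 (min (e (Suc 0)) b))" unfolding * by (intro dec_intros E)
qed

lemma exp2_add: "exp2 (x + y) = exp2 x * exp2 y"
proof -
  \<comment> \<open>The truncations keep all exponents below fixed bounds, which makes the formula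
    decidable at this stage; at j = y they have no effect.\<close>
  have "exp2 (min (x + j) (x + y)) = exp2 x * exp2 (min j y)" for j
  proof (rule dec_induct[where P = "\<lambda>j. exp2 (min (x + j) (x + y)) = exp2 x * exp2 (min j y)"])
    show "dec (\<lambda>e. exp2 (min (x + e 0) (x + y)) = exp2 x * exp2 (min (e 0) y))"
      by (intro dec_intros df_exp2_bounded)
    show "exp2 (min (x + 0) (x + y)) = exp2 x * exp2 (min 0 y)" by (simp add: min_def)
    fix j assume IH: "exp2 (min (x + j) (x + y)) = exp2 x * exp2 (min j y)"
    show "exp2 (min (x + (j + 1)) (x + y)) = exp2 x * exp2 (min (j + 1) y)"
    proof (cases "j < y")
      case True
      then have "min (x + (j + 1)) (x + y) = (x + j) + 1" "min (j + 1) y = j + 1"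
        "min (x + j) (x + y) = x + j" "min j y = j"
        by (auto simp: min_def add.assoc[symmetric])
      then show ?thesis using IH by (simp only: exp2_add_one distrib_left)
    next
      case False
      then have "y \<le> j" by simp
      moreover have "y \<le> j + 1" using \<open>y \<le> j\<close> by (rule add_increasing2[rotated]) simp
      ultimately show ?thesis using IH by (simp add: min_absorb2)
    qed
  qed
  from this[of y] show ?thesis by simp
qed

lemma exp2_pos [simp]: "0 < exp2 x" "exp2 x \<noteq> 0"
  using exp2_mono[of 0 x] by (auto simp: less_le_trans[OF zero_less_one])

lemma less_exp2: "x < exp2 x"
proof -
  have "j < exp2 (min j x) \<or> x < j" for j
  proof (rule dec_induct[where P = "\<lambda>j. j < exp2 (min j x) \<or> x < j"])
    show "dec (\<lambda>e. e 0 < exp2 (min (e 0) x) \<or> x < e 0)" by (intro dec_intros df_exp2_bounded)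
    show "0 < exp2 (min 0 x) \<or> x < 0" by simp
    fix j assume IH: "j < exp2 (min j x) \<or> x < j"
    show "j + 1 < exp2 (min (j + 1) x) \<or> x < j + 1"
    proof (cases "j < x")
      case True
      then have "min j x = j" by simp
      then have "j < exp2 j" using IH True by auto
      moreover have "1 \<le> exp2 j" using exp2_mono[of 0 j] by simp
      ultimately have "j + 1 < exp2 j + exp2 j" by (rule add_less_le_mono)
      moreover have "min (j + 1) x = j + 1" using True by (simp add: min_def)
      ultimately show ?thesis by simp
    qed (simp add: not_less)
  qed
  from this[of x] show ?thesis by simp
qed

text \<open>A substitute for primitive recursion. Since every factor is at most 2^c, the partial
  product after u steps is at most 2^(u c); this bound on w is what permits the induction.\<close>

lemma bounded_product:
  assumes Q: "dec (\<lambda>e. Q (e 0) (e (Suc 0)))" and "Q 0 1"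
    and step: "\<And>u w. u < b \<Longrightarrow> 0 < w \<Longrightarrow> Q u w \<Longrightarrow> \<exists>g. 0 < g \<and> g \<le> exp2 c \<and> Q (u + 1) (w * g)"
  obtains w :: model where "0 < w" "Q b w"
proof -
  have "u \<le> b \<longrightarrow> (\<exists>w. w \<le> exp2 (min (u * c) (b * c)) \<and> 0 < w \<and> Q u w)" for u
  proof (rule dec_induct[where P = "\<lambda>u. u \<le> b \<longrightarrow> (\<exists>w. w \<le> exp2 (min (u * c) (b * c)) \<and> 0 < w \<and> Q u w)"])
    have "dec (\<lambda>e. Q (e (Suc 0)) (e 0))"
      using dec_reindex[OF Q, of "\<lambda>i. if i = 0 then Suc 0 else 0"] by simp
    then show "dec (\<lambda>e. e 0 \<le> b \<longrightarrow> (\<exists>w. w \<le> exp2 (min (e 0 * c) (b * c)) \<and> 0 < w \<and> Q (e 0) w))"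
      by (intro dec_intros df_exp2_bounded)
    show "0 \<le> b \<longrightarrow> (\<exists>w. w \<le> exp2 (min (0 * c) (b * c)) \<and> 0 < w \<and> Q 0 w)"
      using \<open>Q 0 1\<close> by (auto simp: min_def)
    fix u assume IH: "u \<le> b \<longrightarrow> (\<exists>w. w \<le> exp2 (min (u * c) (b * c)) \<and> 0 < w \<and> Q u w)"
    show "u + 1 \<le> b \<longrightarrow> (\<exists>w. w \<le> exp2 (min ((u + 1) * c) (b * c)) \<and> 0 < w \<and> Q (u + 1) w)"
    proof
      assume ub: "u + 1 \<le> b"
      then have "u < b" by simp
      have "min (u * c) (b * c) = u * c" "min ((u + 1) * c) (b * c) = (u + 1) * c"
        using \<open>u < b\<close> ub by (auto simp: min_def intro: mult_right_mono)
      moreover obtain w where w: "w \<le> exp2 (min (u * c) (b * c))" "0 < w" "Q u w"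
        using IH \<open>u < b\<close> by auto
      moreover obtain g where g: "0 < g" "g \<le> exp2 c" "Q (u + 1) (w * g)"
        using step[OF \<open>u < b\<close> w(2,3)] by blast
      ultimately have "w * g \<le> exp2 (min ((u + 1) * c) (b * c))"
        by (simp add: distrib_right exp2_add mult_mono)
      then show "\<exists>w. w \<le> exp2 (min ((u + 1) * c) (b * c)) \<and> 0 < w \<and> Q (u + 1) w"
        using w g by (intro exI[of _ "w * g"]) simp
    qed
  qed
  from this[of b] show ?thesis using that by auto
qed

subsection \<open>Goedel's coding of finite sets\<close>

text \<open>The moduli 1 + (m + 1) d of Goedel's beta function, pairwise coprime when d is divisible
  by all differences of indices. A set is coded by the product of the moduli of its members, and
  divisibility decodes it without exponentiation.\<close>

definition beta_mem :: "model \<Rightarrow> model \<Rightarrow> model \<Rightarrow> bool" where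
  "beta_mem m d w \<longleftrightarrow> 1 + (m + 1) * d dvd w"

lemma dec_beta_mem [dec_intros]: "df f \<Longrightarrow> df g \<Longrightarrow> df h \<Longrightarrow> dec (\<lambda>e. beta_mem (f e) (g e) (h e))"
  unfolding beta_mem_def by (intro dec_intros)

text \<open>Bezout's identity for the moduli of indices \<open>a\<close> and \<open>a + k\<close>, without subtraction.\<close>

lemma beta_coprime:
  fixes a k e w :: model
  defines "d \<equiv> k * e"
  defines "u \<equiv> 1 + (a + 1) * d" and "v \<equiv> 1 + (a + k + 1) * d"
  shows "u dvd w * v \<Longrightarrow> u dvd w" "v dvd w * u \<Longrightarrow> v dvd w"
proof -
  have 1: "(a + 1) * (a + k + 1) * e * w * u + w = (a + 1) * (a + 1) * e * (w * v) + w * u"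
    by (simp add: u_def v_def d_def algebra_simps)
  show "u dvd w" if "u dvd w * v"
  proof -
    have "u dvd (a + 1) * (a + 1) * e * (w * v) + w * u"
      by (rule dvd_add[OF dvd_mult[OF that] dvd_triv_right])
    then show ?thesis unfolding 1[symmetric] by (subst (asm) dvd_add_right_iff) auto
  qed
  have 2: "(a + k + 1) * (a + k + 1) * e * (w * u) + w = (a + 1) * (a + k + 1) * e * w * v + w * v"
    by (simp add: u_def v_def d_def algebra_simps)
  show "v dvd w" if "v dvd w * u"
  proof -
    have "v dvd (a + k + 1) * (a + k + 1) * e * (w * u) + w"
      unfolding 2 by (rule dvd_add[OF dvd_triv_right dvd_triv_right])
    then show ?thesis by (subst (asm) dvd_add_right_iff[OF dvd_mult[OF that]])
  qed
qed

text \<open>The product that is built is the factorial of b: step u contributes the factor u + 1,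
  which is at most b and so below 2^b.\<close>

lemma common_multiple:
  obtains d :: model where "0 < d" "\<And>i. 0 < i \<Longrightarrow> i \<le> b \<Longrightarrow> i dvd d"
proof (rule bounded_product[where Q = "\<lambda>u w. \<forall>i. i \<le> u \<longrightarrow> 0 < i \<longrightarrow> i dvd w" and b = b and c = b])
  show "dec (\<lambda>e. \<forall>i. i \<le> e 0 \<longrightarrow> 0 < i \<longrightarrow> i dvd e (Suc 0))" by (intro dec_intros)
  fix u w assume *: "u < b" "0 < w" "\<forall>i. i \<le> u \<longrightarrow> 0 < i \<longrightarrow> i dvd w"
  have "i dvd w * (u + 1)" if "i \<le> u + 1" "0 < i" for i
  proof (cases "i = u + 1")
    case False
    then have "i \<le> u" using that(1) by (metis le_less less_add_one_iff)
    then show ?thesis using * that by auto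
  qed simp
  moreover have "u + 1 \<le> exp2 b" using * less_exp2[of b] by simp
  moreover have "0 < u + 1" by (metis less_add_one_iff zero_le)
  ultimately show "\<exists>g. 0 < g \<and> g \<le> exp2 b \<and> (\<forall>i. i \<le> u + 1 \<longrightarrow> 0 < i \<longrightarrow> i dvd w * g)" by blast
qed (use that in auto)

text \<open>The number w is the product of the moduli of the members of X below b. By coprimality,
  multiplying by the modulus of u changes the membership of no other index below b.\<close>

lemma beta_coding:
  assumes X: "X \<in> Sets"
  obtains d w where "\<And>m. m < b \<Longrightarrow> beta_mem m d w \<longleftrightarrow> m \<in> X"
proof -
  obtain d where d: "0 < d" "\<And>i. 0 < i \<Longrightarrow> i \<le> b \<Longrightarrow> i dvd d" using common_multiple by blast
  have cop: "beta_mem m d (w * (1 + (u + 1) * d)) \<longleftrightarrow> beta_mem m d w" if "m < b" "u < b" "m \<noteq> u" for m u w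
  proof
    assume *: "beta_mem m d (w * (1 + (u + 1) * d))"
    consider "m < u" | "u < m" using \<open>m \<noteq> u\<close> by force
    then show "beta_mem m d w"
    proof cases
      case 1
      then obtain k where k: "u = m + k" using le_iff_model[of m u] by auto
      then have "0 < k" "k \<le> b" using 1 \<open>u < b\<close> by (auto simp: zero_less_iff_neq_zero intro: order_trans[of k u b])
      then obtain e where "d = k * e" using d(2) by blast
      then show ?thesis using * beta_coprime(1)[of m k e w] k by (simp add: beta_mem_def)
    next
      case 2
      then obtain k where k: "m = u + k" using le_iff_model[of u m] by auto
      then have "0 < k" "k \<le> b" using 2 \<open>m < b\<close> by (auto simp: zero_less_iff_neq_zero intro: order_trans[of k m b])
      then obtain e where "d = k * e" using d(2) by blast
      then show ?thesis using * beta_coprime(2)[of u k e w] k by (simp add: beta_mem_def)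
    qed
  qed (simp add: beta_mem_def)
  \<comment> \<open>Each factor is at most c, hence at most 2^c, as the bound on products
    demands.\<close>
  define c where "c = 1 + (b + 1) * d"
  obtain w where w: "\<forall>m. m < b \<longrightarrow> (beta_mem m d w \<longleftrightarrow> m < b \<and> m \<in> X)"
  proof (rule bounded_product[where Q = "\<lambda>u w. \<forall>m. m < b \<longrightarrow> (beta_mem m d w \<longleftrightarrow> m < u \<and> m \<in> X)" and b = b and c = c])
    show "dec (\<lambda>e. \<forall>m. m < b \<longrightarrow> (beta_mem m d (e (Suc 0)) \<longleftrightarrow> m < e 0 \<and> m \<in> X))"
      by (intro dec_intros X)
    have "\<not> beta_mem m d 1" for m
    proof
      assume "beta_mem m d 1"
      then have "1 + (m + 1) * d \<le> 1" unfolding beta_mem_def by (rule dvd_le) simp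
      then have "1 + (m + 1) * d = 1 + 0" by (simp add: order_antisym)
      then have "(m + 1) * d = 0" by (simp only: add_left_cancel)
      then show False using d(1) basic_facts(1)[of m] by simp
    qed
    then show "\<forall>m. m < b \<longrightarrow> (beta_mem m d 1 \<longleftrightarrow> m < 0 \<and> m \<in> X)" by simp
    fix u w assume *: "u < b" "0 < w" "\<forall>m. m < b \<longrightarrow> (beta_mem m d w \<longleftrightarrow> m < u \<and> m \<in> X)"
    define g where "g = (if u \<in> X then 1 + (u + 1) * d else 1)"
    have "beta_mem m d (w * g) \<longleftrightarrow> m < u + 1 \<and> m \<in> X" if "m < b" for m
    proof (cases "m = u")
      case True
      show ?thesis
      proof (cases "u \<in> X")
        case uX: True
        then have "beta_mem m d (w * g)" unfolding beta_mem_def g_def True by simp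
        then show ?thesis using True uX by simp
      next
        case False
        then show ?thesis using True * that by (simp add: g_def)
      qed
    next
      case False
      have "beta_mem m d (w * g) \<longleftrightarrow> beta_mem m d w"
        using cop[OF that *(1) False] by (simp add: g_def)
      then show ?thesis using * that False by (simp add: le_less)
    qed
    moreover have "g \<le> exp2 c"
    proof -
      have "1 + (u + 1) * d \<le> c" unfolding c_def using *(1) by (intro add_left_mono mult_right_mono) auto
      moreover have "1 \<le> c" by (simp add: c_def)
      ultimately show ?thesis using less_exp2[of c] by (auto simp: g_def intro: order_trans less_imp_le)
    qed
    moreover have "0 < g" by (auto simp: g_def add_pos_nonneg)
    ultimately show "\<exists>g. 0 < g \<and> g \<le> exp2 c \<and> (\<forall>m. m < b \<longrightarrow> (beta_mem m d (w * g) \<longleftrightarrow> m < u + 1 \<and> m \<in> X))"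
      by blast
  qed blast
  then show ?thesis using that by blast
qed

text \<open>The numbers b, d, w code a finite \<open>exp_tree\<close> containing (x, y). So a value
  of exponentiation is witnessed by numbers instead of a set, and checking the witness is
  bounded.\<close>

definition coded_exp :: "model \<Rightarrow> model \<Rightarrow> model \<Rightarrow> model \<Rightarrow> model \<Rightarrow> bool" where
  "coded_exp b d w x y \<longleftrightarrow> pair x y < b \<and> beta_mem (pair x y) d w \<and>
     (\<forall>m. m < b \<longrightarrow> beta_mem m d w \<longrightarrow> m = pair 0 1 \<or>
       (\<exists>i. i < b \<and> (\<exists>v. v < b \<and> m = pair (i + 1) (v + v) \<and> pair i v < b \<and> beta_mem (pair i v) d w)))"

lemma dec_coded_exp:
  "dec (\<lambda>e. coded_exp (e i) (e j) (e k) (e l) (e m))"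
  unfolding coded_exp_def by (intro dec_intros)

lemma coded_exp_sound: "coded_exp b d w x y \<Longrightarrow> y = exp2 x"
proof -
  assume *: "coded_exp b d w x y"
  define E where "E = {m. m < b \<and> beta_mem m d w}"
  have "E \<in> Sets" unfolding E_def
    by (rule dec_Collect) (intro dec_intros)
  moreover have "exp_tree E" unfolding exp_tree_def
  proof (intro allI impI)
    fix j u assume "pair j u \<in> E"
    then have "pair j u = pair 0 1 \<or> (\<exists>i v. pair j u = pair (i + 1) (v + v) \<and> pair i v \<in> E)"
      using * unfolding coded_exp_def E_def by blast
    then show "j = 0 \<and> u = 1 \<or> (\<exists>i w. j = i + 1 \<and> u = w + w \<and> pair i w \<in> E)"
      by auto
  qed
  moreover have "pair x y \<in> E" using * by (simp add: coded_exp_def E_def)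
  ultimately show ?thesis by (rule exp_tree_exp2)
qed

lemma pair_mono: "a \<le> a' \<Longrightarrow> b \<le> b' \<Longrightarrow> pair a b \<le> pair a' b'"
  unfolding pair_def by (intro add_mono mult_mono) auto

lemma coded_exp_complete: "\<exists>b d w. coded_exp b d w x (exp2 x)"
proof -
  define X where "X = {m. \<exists>j. j \<le> x \<and> m = pair j (exp2 (min j x))}"
  have X: "X \<in> Sets" unfolding X_def
    by (rule dec_Collect) (intro dec_intros df_exp2_bounded)
  define b where "b = pair x (exp2 x) + 1"
  obtain d w where dw: "\<And>m. m < b \<Longrightarrow> beta_mem m d w \<longleftrightarrow> m \<in> X" using beta_coding[OF X] by metis
  have memb: "pair j (exp2 j) < b \<and> beta_mem (pair j (exp2 j)) d w" if "j \<le> x" for j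
  proof -
    have "pair j (exp2 j) < b" using pair_mono[OF that exp2_mono[OF that]] by (simp add: b_def)
    moreover have "pair j (exp2 j) \<in> X" using that by (auto simp: X_def)
    ultimately show ?thesis using dw by blast
  qed
  have "m = pair 0 1 \<or> (\<exists>i. i < b \<and> (\<exists>v. v < b \<and> m = pair (i + 1) (v + v) \<and> pair i v < b \<and> beta_mem (pair i v) d w))"
    if "m < b" "beta_mem m d w" for m
  proof -
    have "m \<in> X" using dw that by blast
    then obtain j where "j \<le> x" "m = pair j (exp2 (min j x))" unfolding X_def by blast
    then have j: "j \<le> x" "m = pair j (exp2 j)" by simp_all
    show ?thesis
    proof (cases "j = 0")
      case False
      then obtain i where i: "j = i + 1" using less_iff_model[of 0 j] by (auto simp: zero_less_iff_neq_zero)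
      then have "i \<le> x" using j(1) by (auto simp: less_imp_le)
      then have *: "pair i (exp2 i) < b" "beta_mem (pair i (exp2 i)) d w" using memb by auto
      have "i < b" "exp2 i < b"
        by (rule le_less_trans[OF le_pair(1) *(1)], rule le_less_trans[OF le_pair(2) *(1)])
      then show ?thesis using * j i by auto
    qed (use j in simp)
  qed
  then have "coded_exp b d w x (exp2 x)" using memb[of x] by (simp add: coded_exp_def)
  then show ?thesis by blast
qed

text \<open>The graph is Sigma^0_1 because some code contains the pair, and Pi^0_1 because all codes
  agree. One number n bounding all the witnesses merges each block of quantifiers into the single
  one that \<open>dec_Delta1\<close> allows; in \<open>?Q\<close> it bounds the competing value as
  well.\<close>

lemma df_exp2 [dec_intros]: "df f \<Longrightarrow> df (\<lambda>e. exp2 (f e))"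
proof (rule df_unary[where F = exp2])
  let ?P = "\<lambda>n x y. \<exists>b. b \<le> n \<and> (\<exists>d. d \<le> n \<and> (\<exists>w. w \<le> n \<and> coded_exp b d w x y))"
  let ?Q = "\<lambda>n x y. \<forall>b. b \<le> n \<longrightarrow> (\<forall>d. d \<le> n \<longrightarrow> (\<forall>w. w \<le> n \<longrightarrow>
    (\<forall>y'. y' \<le> n \<longrightarrow> coded_exp b d w x y' \<longrightarrow> y' = y)))"
  have bound: "\<exists>n. b \<le> n \<and> d \<le> n \<and> w \<le> n \<and> y \<le> n" for b d w y :: model
    by (intro exI[of _ "max (max b d) (max w y)"]) (simp add: le_max_iff_disj)
  have P: "(\<exists>n. ?P n x y) \<longleftrightarrow> y = exp2 x" for x y
  proof
    assume "y = exp2 x"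
    then obtain b d w where "coded_exp b d w x y" using coded_exp_complete by blast
    then show "\<exists>n. ?P n x y" using bound[of b d w 0] by blast
  qed (use coded_exp_sound in blast)
  have Q: "(\<forall>n. ?Q n x y) \<longleftrightarrow> y = exp2 x" for x y
  proof
    assume *: "\<forall>n. ?Q n x y"
    obtain b d w where "coded_exp b d w x (exp2 x)" using coded_exp_complete by blast
    then show "y = exp2 x" using bound[of b d w "exp2 x"] * by metis
  qed (use coded_exp_sound in blast)
  have "dec (\<lambda>e. \<exists>n. ?P n (e (Suc 0)) (e 0))"
  proof (rule dec_Delta1[where P = "\<lambda>n e. ?P n (e (Suc 0)) (e 0)" and Q = "\<lambda>n e. ?Q n (e (Suc 0)) (e 0)"])
    show "dec (\<lambda>e. ?P (e 0) (e (Suc (Suc 0))) (e (Suc 0)))"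
      by (intro dec_intros dec_coded_exp)
    show "dec (\<lambda>e. ?Q (e 0) (e (Suc (Suc 0))) (e (Suc 0)))"
      by (intro dec_intros dec_coded_exp)
  qed (simp only: P Q)
  then show "dec (\<lambda>e. e 0 = exp2 (e (Suc 0)))" by (simp only: P)
qed

subsection \<open>Coded finite sets\<close>

definition in_set :: "model \<Rightarrow> model \<Rightarrow> bool" where
  "in_set s t \<longleftrightarrow> (\<exists>q r. r < exp2 s \<and> t = q * (exp2 s + exp2 s) + (exp2 s + r))"

lemma division_exists: "0 < b \<Longrightarrow> \<exists>q r. r < b \<and> a = q * b + (r :: model)"
proof -
  assume b: "0 < b"
  have "\<exists>q. q \<le> a \<and> (\<exists>r. r < b \<and> a = q * b + r)"
  proof (rule dec_induct[where P = "\<lambda>a. \<exists>q. q \<le> a \<and> (\<exists>r. r < b \<and> a = q * b + r)"])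
    show "dec (\<lambda>e. \<exists>q. q \<le> e 0 \<and> (\<exists>r. r < b \<and> e 0 = q * b + r))" by (intro dec_intros)
    show "\<exists>q. q \<le> 0 \<and> (\<exists>r. r < b \<and> 0 = q * b + r)" using b by simp
    fix a assume "\<exists>q. q \<le> a \<and> (\<exists>r. r < b \<and> a = q * b + r)"
    then obtain q r where qr: "q \<le> a" "r < b" "a = q * b + r" by blast
    show "\<exists>q. q \<le> a + 1 \<and> (\<exists>r. r < b \<and> a + 1 = q * b + r)"
    proof (cases "r + 1 = b")
      case True
      then have "a + 1 = (q + 1) * b + 0" using qr by (simp add: algebra_simps flip: True)
      moreover have "q + 1 \<le> a + 1" using qr by simp
      ultimately show ?thesis using b by blast
    next
      case False
      then have "r + 1 < b" using qr(2) by (metis add_one_le_iff le_less)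
      moreover have "a + 1 = q * b + (r + 1)" using qr by (simp add: add.assoc)
      moreover have "q \<le> a + 1" using qr(1) by (intro less_imp_le) simp
      ultimately show ?thesis by blast
    qed
  qed
  then show ?thesis by blast
qed

lemma division_unique:
  assumes "q * b + r = q' * b + (r' :: model)" "r < b" "r' < b"
  shows "q = q' \<and> r = r'"
proof -
  have *: False if "q * b + r = q' * b + r'" "r < b" "q < q'" for q q' r r'
  proof -
    have "q * b + r < q * b + b" using that(2) by (rule add_strict_left_mono)
    also have "\<dots> = (q + 1) * b" by (simp add: distrib_right)
    also have "\<dots> \<le> q' * b" using that(3) by (intro mult_right_mono) auto
    also have "\<dots> \<le> q' * b + r'" by simp
    finally show False using that by simp
  qed
  have "q = q'" using *[of q r q' r'] *[of q' r' q r] assms by (metis linorder_neqE)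
  then show ?thesis using assms by simp
qed

lemma in_set_iff_digit:
  assumes "t = q * (exp2 s + exp2 s) + r" "r < exp2 s + exp2 s"
  shows "in_set s t \<longleftrightarrow> exp2 s \<le> r"
proof
  assume "in_set s t"
  then obtain q' r' where *: "r' < exp2 s" "t = q' * (exp2 s + exp2 s) + (exp2 s + r')"
    unfolding in_set_def by blast
  then have "r = exp2 s + r'"
    using division_unique[of q "exp2 s + exp2 s" r q' "exp2 s + r'"] assms by simp
  then show "exp2 s \<le> r" by simp
next
  assume "exp2 s \<le> r"
  then obtain r' where "r = exp2 s + r'" using le_iff_model by blast
  then show "in_set s t" using assms unfolding in_set_def by auto
qed

lemma in_set_le: "in_set s t \<Longrightarrow> exp2 s \<le> t"
  unfolding in_set_def by (auto simp: add_increasing)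

lemma in_set_less: "in_set s t \<Longrightarrow> s < t"
  using in_set_le less_exp2 less_le_trans by blast

lemma dec_in_set [dec_intros]: "df f \<Longrightarrow> df g \<Longrightarrow> dec (\<lambda>e. in_set (f e) (g e))"
proof (rule dec_binary[where R = in_set])
  have *: "in_set s t \<longleftrightarrow> (\<exists>q. q \<le> t \<and> (\<exists>r. r < exp2 s \<and> t = q * (exp2 s + exp2 s) + (exp2 s + r)))" for s t
  proof -
    have "q \<le> t" if "t = q * (exp2 s + exp2 s) + (exp2 s + r)" for q r
    proof -
      have "1 \<le> exp2 s + exp2 s" using exp2_mono[of 0 s] by (simp add: add_increasing2)
      then have "q * 1 \<le> q * (exp2 s + exp2 s)" by (intro mult_left_mono) auto
      also have "\<dots> \<le> t" unfolding that by simp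
      finally show ?thesis by simp
    qed
    then show ?thesis unfolding in_set_def by blast
  qed
  show "dec (\<lambda>e. in_set (e 0) (e (Suc 0)))" unfolding * by (intro dec_intros)
qed

text \<open>Comprehension for coded sets: passing from b to b + 1 adds the digit of weight 2^b if
  needed. The bound T < 2^b keeps the induction formula bounded and rules out digits at b and
  beyond.\<close>

lemma finite_coding:
  assumes P: "dec (\<lambda>e. P (e 0))"
  shows "\<exists>T. T < exp2 b \<and> (\<forall>s. in_set s T \<longleftrightarrow> s < b \<and> P s)"
proof -
  have "\<exists>T. T < exp2 b \<and> (\<forall>s. s < b \<longrightarrow> (in_set s T \<longleftrightarrow> P s))"
  proof (rule dec_induct[where P = "\<lambda>b. \<exists>T. T < exp2 b \<and> (\<forall>s. s < b \<longrightarrow> (in_set s T \<longleftrightarrow> P s))"])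
    show "dec (\<lambda>e. \<exists>T. T < exp2 (e 0) \<and> (\<forall>s. s < e 0 \<longrightarrow> (in_set s T \<longleftrightarrow> P s)))"
      using P by (intro dec_intros)
    fix b assume "\<exists>T. T < exp2 b \<and> (\<forall>s. s < b \<longrightarrow> (in_set s T \<longleftrightarrow> P s))"
    then obtain T where T: "T < exp2 b" "\<And>s. s < b \<Longrightarrow> in_set s T \<longleftrightarrow> P s" by blast
    define T' where "T' = (if P b then exp2 b + T else T)"
    have less: "T' < exp2 (b + 1)"
      using T(1) unfolding T'_def exp2_add_one by (auto simp: add_strict_increasing2)
    have "in_set s T' \<longleftrightarrow> P s" if "s < b + 1" for s
    proof (cases "s = b")
      case True
      have "in_set b T' \<longleftrightarrow> exp2 b \<le> T'"
        using in_set_iff_digit[of T' 0 b T'] less by simp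
      also have "\<dots> \<longleftrightarrow> P b" using T(1) by (auto simp: T'_def not_le)
      finally show ?thesis by (simp add: True)
    next
      case False
      then have "s < b" using that by (simp add: le_less)
      then obtain c where c: "b = (s + 1) + c" unfolding less_iff_model by (auto simp: algebra_simps)
      \<comment> \<open>Adding 2^b, a multiple of 2^(s + 1), leaves the digit of weight 2^s
        unchanged.\<close>
      have "exp2 b = exp2 (s + 1) * exp2 c" unfolding c by (rule exp2_add)
      then have eb: "exp2 b = exp2 c * (exp2 s + exp2 s)" by (simp only: exp2_add_one mult.commute)
      obtain q r where qr: "r < exp2 s + exp2 s" "T = q * (exp2 s + exp2 s) + r"
        using division_exists[of "exp2 s + exp2 s" T] by (auto simp: add_pos_nonneg)
      have "in_set s (exp2 b + T) \<longleftrightarrow> exp2 s \<le> r"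
        by (rule in_set_iff_digit[of _ "exp2 c + q"]) (simp_all add: qr eb algebra_simps)
      moreover have "in_set s T \<longleftrightarrow> exp2 s \<le> r"
        by (rule in_set_iff_digit[of _ q]) (simp_all add: qr)
      ultimately show ?thesis using T(2)[OF \<open>s < b\<close>] by (simp add: T'_def)
    qed
    then show "\<exists>T. T < exp2 (b + 1) \<and> (\<forall>s. s < b + 1 \<longrightarrow> (in_set s T \<longleftrightarrow> P s))" using less by blast
  qed simp
  then obtain T where T: "T < exp2 b" "\<And>s. s < b \<Longrightarrow> in_set s T \<longleftrightarrow> P s" by blast
  moreover have "s < b" if "in_set s T" for s
    using in_set_le[OF that] T(1) exp2_mono[of b s] by (meson leD le_less_trans not_less)
  ultimately show ?thesis by blast
qed

lemma val_numeral_trm [simp]: "val \<MM> \<rho> (numeral_trm n) = of_nat n"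
  by (induction n) (simp_all add: add.commute)

lemma val_tag [simp]: "val \<MM> \<rho> (tag d t) = 16 * val \<MM> \<rho> t + of_nat d"
  unfolding tag_def by simp

lemma holds_in_code [simp]:
  assumes "vars_trm s \<union> vars_trm t \<subseteq> - Nm ` {(''bp'', []), (''bq'', []), (''br'', [])}"
  shows "holds \<MM> \<rho> S (s \<^bold>\<in>\<^sub>c t) \<longleftrightarrow> in_set (val \<MM> \<rho> s) (val \<MM> \<rho> t)"
proof -
  have "val \<MM> (\<rho>(Nm (''bp'', []) := p, Nm (''bq'', []) := q, Nm (''br'', []) := r)) u = val \<MM> \<rho> u"
    if "u \<in> {s, t}" for p q r u
    by (rule val_cong) (use assms that in auto)
  then show ?thesis
    unfolding in_code_def in_set_def
    by (simp add: Conj_def is_exp_iff)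
qed

instance model :: semiring_no_zero_divisors_cancel
proof intro_classes
  fix a b c :: model
  have cancel: "a = b" if "c * a = c * b" "c \<noteq> 0" for a b
    using that mult_strict_left_mono[of a b c] mult_strict_left_mono[of b a c]
    by (cases a b rule: linorder_cases) (simp_all add: zero_less_iff_neq_zero)
  show *: "c * a = c * b \<longleftrightarrow> c = 0 \<or> a = b"
  proof
    show "c * a = c * b \<Longrightarrow> c = 0 \<or> a = b" using cancel[of a b] by blast
  qed (elim disjE; simp)
  show "a * c = b * c \<longleftrightarrow> c = 0 \<or> a = b" unfolding mult.commute[of _ c] by (rule *)
qed

lemma pair_strict_mono: "a \<le> a' \<Longrightarrow> b < b' \<Longrightarrow> pair a b < pair a' b'"
  by (rule le_neq_trans[OF pair_mono]) (auto simp: less_imp_le)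

section \<open>The pigeonhole principle and bounds in the model\<close>

text \<open>Induction on m. The step changes the relation, so its code must be quantified inside the
  induction formula; the bound 2^(pair m m) suffices since only pairs (n, v) with n \<le> m and v <
  m matter.\<close>

lemma php_codes: "\<not> ((\<forall>n. n \<le> m \<longrightarrow> (\<exists>v. v < m \<and> in_set (pair n v) T)) \<and>
    (\<forall>n. n \<le> m \<longrightarrow> (\<forall>n'. n' \<le> m \<longrightarrow> (\<forall>v. v < m \<longrightarrow> in_set (pair n v) T \<longrightarrow> in_set (pair n' v) T \<longrightarrow> n = n'))))"
  (is "\<not> ?J m T")
proof -
  have *: "\<forall>T. T < exp2 (pair m m) \<longrightarrow> \<not> ?J m T" for m
  proof (rule dec_induct[where P = "\<lambda>m. \<forall>T. T < exp2 (pair m m) \<longrightarrow> \<not> ?J m T"])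
    show "dec (\<lambda>e. \<forall>T. T < exp2 (pair (e 0) (e 0)) \<longrightarrow> \<not> ?J (e 0) T)" by (intro dec_intros)
    show "\<forall>T. T < exp2 (pair 0 0) \<longrightarrow> \<not> ?J 0 T" by auto
    fix m assume IH: "\<forall>T. T < exp2 (pair m m) \<longrightarrow> \<not> ?J m T"
    show "\<forall>T. T < exp2 (pair (m + 1) (m + 1)) \<longrightarrow> \<not> ?J (m + 1) T"
    proof (intro allI impI notI)
      fix T assume J: "?J (m + 1) T"
      have inj: "n = n'" if "n \<le> m + 1" "n' \<le> m + 1" "v < m + 1" "in_set (pair n v) T" "in_set (pair n' v) T" for n n' v
        using J that by blast
      have step: "n \<noteq> m + 1" "n \<le> m + 1" "n < m + 1" if "n \<le> m" for n
        using that by (auto simp: less_imp_le dest: less_add_one_iff[THEN iffD2])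
      obtain v0 where v0: "v0 < m + 1" "in_set (pair (m + 1) v0) T" using J by blast
      \<comment> \<open>The argument m + 1, related to v0, is dropped, and an argument that was
        related to the value m is redirected to the vacated v0.\<close>
      let ?R = "\<lambda>n v. n \<le> m \<and> v < m \<and> (in_set (pair n v) T \<or> v = v0 \<and> in_set (pair n m) T)"
      have "dec (\<lambda>e. \<exists>n. n \<le> m \<and> (\<exists>v. v < m \<and> e 0 = pair n v \<and> ?R n v))" by (intro dec_intros)
      from finite_coding[where P = "\<lambda>s. \<exists>n. n \<le> m \<and> (\<exists>v. v < m \<and> s = pair n v \<and> ?R n v)", OF this, of "pair m m"]
      obtain T' where T': "T' < exp2 (pair m m)"
        "\<And>s. in_set s T' \<longleftrightarrow> s < pair m m \<and> (\<exists>n. n \<le> m \<and> (\<exists>v. v < m \<and> s = pair n v \<and> ?R n v))"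
        by (elim exE conjE) metis
      have mem: "in_set (pair n v) T' \<longleftrightarrow> ?R n v" for n v
      proof -
        have "pair n v < pair m m" if "n \<le> m" "v < m"
          using that by (rule pair_strict_mono)
        then show ?thesis unfolding T'(2) by auto
      qed
      have "?J m T'"
      proof (intro conjI allI impI)
        fix n assume n: "n \<le> m"
        obtain v where v: "v < m + 1" "in_set (pair n v) T" using J step[OF n] by blast
        show "\<exists>v. v < m \<and> in_set (pair n v) T'"
        proof (cases "v = m")
          case True
          have "v0 \<noteq> m" using inj[of n "m + 1" m] v v0 step[OF n] True by auto
          then have "v0 < m" using v0 by (simp add: le_less)
          then show ?thesis using mem n v True by blast
        next
          case False
          then have "v < m" using v by (simp add: le_less)
          then show ?thesis using mem n v by blast
        qed
      next
        fix n n' v assume n: "n \<le> m" "n' \<le> m" and v: "v < m"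
          and in': "in_set (pair n v) T'" "in_set (pair n' v) T'"
        have nov0: "\<not> in_set (pair k v0) T" if "k \<le> m" for k
          using inj[of k "m + 1" v0] v0 step[OF that] by auto
        show "n = n'"
        proof (cases "v = v0")
          case True
          then have "in_set (pair n m) T" "in_set (pair n' m) T" using in' nov0 n unfolding mem by auto
          then show ?thesis using inj[of n n' m] step n by simp
        next
          case False
          then show ?thesis using in' inj[of n n' v] v step n unfolding mem by (auto simp: less_imp_le)
        qed
      qed
      then show False using IH T' by blast
    qed
  qed
  show ?thesis
  proof
    assume J: "?J m T"
    \<comment> \<open>An arbitrary code is cut down to the relevant pairs in order to meet the bound
      in the induction.\<close>
    have "dec (\<lambda>e. in_set (e 0) T)" by (intro dec_intros)
    from finite_coding[where P = "\<lambda>s. in_set s T", OF this, of "pair m m"]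
    obtain T' where T': "T' < exp2 (pair m m)" "\<And>s. in_set s T' \<longleftrightarrow> s < pair m m \<and> in_set s T"
      by (elim exE conjE) metis
    have "in_set (pair n v) T' \<longleftrightarrow> in_set (pair n v) T" if "n \<le> m" "v < m" for n v
      using pair_strict_mono[OF that] unfolding T'(2) by simp
    then have "?J m T'" using J by blast
    then show False using * T'(1) by blast
  qed
qed

lemma pigeonhole:
  assumes j: "df (\<lambda>e. j (e 0))" and bound: "\<And>n. j n < m"
  obtains n n' where "n \<noteq> n'" "j n = j (n' :: model)"
proof -
  let ?b = "pair m m"
  have "dec (\<lambda>e. \<exists>n. n \<le> m \<and> e 0 = pair n (j n))"
    using df_reindex[OF j, of "\<lambda>_. 0"] by (intro dec_intros)
  from finite_coding[where P = "\<lambda>s. \<exists>n. n \<le> m \<and> s = pair n (j n)", OF this]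
  obtain T where T: "\<And>s. in_set s T \<longleftrightarrow> s < ?b \<and> (\<exists>n. n \<le> m \<and> s = pair n (j n))" by blast
  have mem: "in_set (pair n v) T \<longleftrightarrow> v = j n" if "n \<le> m" for n v
  proof -
    have "pair n (j n) < ?b"
      using that bound[of n] by (rule pair_strict_mono)
    then show ?thesis unfolding T using that by auto
  qed
  have "\<exists>v. v < m \<and> in_set (pair n v) T" if "n \<le> m" for n
    using mem[OF that] bound by blast
  then have "\<exists>n n' v. n \<le> m \<and> n' \<le> m \<and> in_set (pair n v) T \<and> in_set (pair n' v) T \<and> n \<noteq> n'"
    using php_codes[of m T] by blast
  then show ?thesis using mem that by metis
qed

text \<open>
  No collection principle is needed: the position of the maximum is bounded, and comparing two
  values of \<open>f\<close> is decidable.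
\<close>

lemma df_bounded:
  assumes f: "df (\<lambda>e. f (e 0))"
  shows "\<exists>B. \<forall>k. k \<le> n \<longrightarrow> f k \<le> (B :: model)"
proof -
  have fi: "df (\<lambda>e. f (e i))" for i using df_reindex[OF f, of "\<lambda>_. i"] by simp
  have "\<exists>m. m \<le> n \<and> (\<forall>k. k \<le> n \<longrightarrow> f k \<le> f m)"
  proof (rule dec_induct[where P = "\<lambda>n. \<exists>m. m \<le> n \<and> (\<forall>k. k \<le> n \<longrightarrow> f k \<le> f m)"])
    show "dec (\<lambda>e. \<exists>m. m \<le> e 0 \<and> (\<forall>k. k \<le> e 0 \<longrightarrow> f k \<le> f m))" by (intro dec_intros fi)
    show "\<exists>m. m \<le> 0 \<and> (\<forall>k. k \<le> 0 \<longrightarrow> f k \<le> f m)" by auto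
    fix x assume "\<exists>m. m \<le> x \<and> (\<forall>k. k \<le> x \<longrightarrow> f k \<le> f m)"
    then obtain m where m: "m \<le> x" "\<And>k. k \<le> x \<Longrightarrow> f k \<le> f m" by blast
    have le: "k \<le> x \<or> k = x + 1" if "k \<le> x + 1" for k using that by (simp add: le_less)
    show "\<exists>m. m \<le> x + 1 \<and> (\<forall>k. k \<le> x + 1 \<longrightarrow> f k \<le> f m)"
    proof (cases "f m \<le> f (x + 1)")
      case True
      then show ?thesis using m le by (intro exI[of _ "x + 1"]) (auto intro: order_trans)
    next
      case False
      have "m \<le> x + 1" using m(1) by (intro less_imp_le) simp
      moreover have "f k \<le> f m" if "k \<le> x + 1" for k using le[OF that] m(2) False by (auto simp: not_le less_imp_le)
      ultimately show ?thesis by blast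
    qed
  qed
  then show ?thesis by blast
qed

section \<open>Codes of the terms \<open>f\<^sup>n c\<close> and powers of two\<close>

definition power_of_two :: "model \<Rightarrow> bool" where
  "power_of_two q \<longleftrightarrow> (\<forall>d. d \<le> q \<longrightarrow> (\<forall>k. k \<le> q \<longrightarrow> d * k = q \<longrightarrow> d = 1 \<or> (\<exists>j. j < d \<and> d = j + j)))"

lemma parity: "\<exists>y. x = y + y \<or> x = y + y + (1 :: model)"
proof -
  obtain q r where "r < 2" "x = q * 2 + r" using division_exists[of 2 x] by auto
  moreover have "r = 0 \<or> r = 1"
  proof -
    have "r < 1 + 1" using \<open>r < 2\<close> by simp
    then show ?thesis by (simp only: less_add_one_iff le_less less_one_iff)
  qed
  ultimately show ?thesis by (auto simp: mult_2_right)
qed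

lemma odd_not_even: "y + y + 1 \<noteq> z + (z :: model)"
proof
  assume "y + y + 1 = z + z"
  then have "y * 2 + 1 = z * 2 + 0" by (simp add: mult_2_right)
  then show False using division_unique[of y 2 1 z 0] by simp
qed

text \<open>If an odd d divides 2^(n + 1), its cofactor is even, and halving the cofactor gives a
  factorization of 2^n with the same d.\<close>

lemma power_of_two_exp2: "power_of_two (exp2 n)"
proof (rule dec_induct[where P = "\<lambda>n. power_of_two (exp2 n)"])
  show "dec (\<lambda>e. power_of_two (exp2 (e 0)))" unfolding power_of_two_def by (intro dec_intros)
  show "power_of_two (exp2 0)" unfolding power_of_two_def
  proof (intro allI impI)
    fix d k assume "d \<le> exp2 0" "d * k = exp2 0"
    then have "d \<noteq> 0" "d \<le> 1" by auto
    then have "d = 1" by (simp add: le_less)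
    then show "d = 1 \<or> (\<exists>j. j < d \<and> d = j + j)" ..
  qed
  fix n assume IH: "power_of_two (exp2 n)"
  let ?p = "exp2 n"
  show "power_of_two (exp2 (n + 1))" unfolding power_of_two_def
  proof (intro allI impI)
    fix d k assume dk: "d * k = exp2 (n + 1)"
    have "d \<noteq> 0" "k \<noteq> 0" using dk exp2_pos(2)[of "n + 1"] by auto
    obtain i where "d = i + i \<or> d = i + i + 1" using parity by blast
    then show "d = 1 \<or> (\<exists>j. j < d \<and> d = j + j)"
    proof
      assume "d = i + i"
      moreover from this \<open>d \<noteq> 0\<close> have "i < d" by (simp add: zero_less_iff_neq_zero)
      ultimately show ?thesis by blast
    next
      assume d: "d = i + i + 1"
      obtain k' where k': "k = k' + k' \<or> k = k' + k' + 1" using parity by blast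
      have "k \<noteq> k' + k' + 1"
      proof
        assume "k = k' + k' + 1"
        then have "(i * k + k') + (i * k + k') + 1 = d * k" unfolding d by (simp add: algebra_simps)
        then show False using dk odd_not_even by simp
      qed
      then have k: "k = k' + k'" using k' by blast
      then have "d * k' * 2 = ?p * 2" using dk unfolding k exp2_add_one by (simp only: distrib_left mult_2_right)
      then have "d * k' = ?p" by simp
      moreover from this have "d dvd ?p" "k' dvd ?p" by (metis dvd_triv_left, metis dvd_triv_right)
      then have "d \<le> ?p" "k' \<le> ?p" by (simp_all add: dvd_le)
      ultimately show ?thesis using IH unfolding power_of_two_def by blast
    qed
  qed
qed

text \<open>The factorization q * 1 forces q to be 1 or even, and half of an even q inherits the
  property. The exponent is below q, which bounds the existential quantifier.\<close>

lemma power_of_twoD: "power_of_two q \<Longrightarrow> \<exists>j. q = exp2 j"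
proof -
  have "power_of_two q \<longrightarrow> (\<exists>j. j \<le> q \<and> q = exp2 j)"
  proof (rule dec_less_induct[where P = "\<lambda>q. power_of_two q \<longrightarrow> (\<exists>j. j \<le> q \<and> q = exp2 j)"])
    show "dec (\<lambda>e. power_of_two (e 0) \<longrightarrow> (\<exists>j. j \<le> e 0 \<and> e 0 = exp2 j))"
      unfolding power_of_two_def by (intro dec_intros)
    fix q assume IH: "\<And>y. y < q \<Longrightarrow> power_of_two y \<longrightarrow> (\<exists>j. j \<le> y \<and> y = exp2 j)"
    show "power_of_two q \<longrightarrow> (\<exists>j. j \<le> q \<and> q = exp2 j)"
    proof
      assume P: "power_of_two q"
      have "q \<noteq> 0"
      proof
        assume "q = 0"
        then show False using P unfolding power_of_two_def by (metis mult_zero_left not_less_zero order_refl zero_neq_one)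
      qed
      then have "1 \<le> q" by (metis less_one_iff not_less)
      show "\<exists>j. j \<le> q \<and> q = exp2 j"
      proof (cases "q = 1")
        case True
        then show ?thesis by (intro exI[of _ 0]) simp
      next
        case False
        then obtain h where h: "h < q" "q = h + h"
          using P \<open>1 \<le> q\<close> unfolding power_of_two_def by (metis mult.right_neutral order_refl)
        have "power_of_two h" unfolding power_of_two_def
        proof (intro allI impI)
          fix d k assume dk: "d \<le> h" "k \<le> h" "d * k = h"
          then have "d * (k + k) = q" using h by (simp add: distrib_left)
          moreover have "d \<le> q" "k + k \<le> q" using dk h by (auto simp: add_mono less_imp_le intro: order_trans)
          ultimately show "d = 1 \<or> (\<exists>j. j < d \<and> d = j + j)" using P unfolding power_of_two_def by blast
        qed
        then obtain i where "h = exp2 i" using IH h(1) by blast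
        then have "q = exp2 (i + 1)" using h by simp
        then show ?thesis using less_exp2[of "i + 1"] less_imp_le by blast
      qed
    qed
  qed
  then show "power_of_two q \<Longrightarrow> \<exists>j. q = exp2 j" by blast
qed

definition pow16 :: "model \<Rightarrow> model" where
  "pow16 n = (exp2 n * exp2 n) * (exp2 n * exp2 n)"

lemma pow16_simps [simp]: "pow16 0 = 1" "pow16 (n + 1) = 16 * pow16 n"
  unfolding pow16_def exp2_add_one mult_2[symmetric] by (simp_all add: ac_simps)

lemma df_pow16 [dec_intros]: "df f \<Longrightarrow> df (\<lambda>e. pow16 (f e))"
  unfolding pow16_def by (intro dec_intros)

text \<open>Origin of the constants: the constant c has code 1, and one application of f turns t
  into 16 t + 2. Since 15 (16 t + 2) + 2 = 16 (15 t + 2), the quantity 15 t + 2 starts at 17 and is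
  multiplied by 16 at each step.\<close>

lemma term_code_exists: "\<exists>t. 15 * t + 2 = 17 * pow16 n"
proof -
  have "\<exists>t. t \<le> 17 * pow16 n \<and> 15 * t + 2 = 17 * pow16 n"
  proof (rule dec_induct[where P = "\<lambda>n. \<exists>t. t \<le> 17 * pow16 n \<and> 15 * t + 2 = 17 * pow16 n"])
    show "dec (\<lambda>e. \<exists>t. t \<le> 17 * pow16 (e 0) \<and> 15 * t + 2 = 17 * pow16 (e 0))" by (intro dec_intros)
    show "\<exists>t. t \<le> 17 * pow16 0 \<and> 15 * t + 2 = 17 * pow16 0" by (intro exI[of _ 1]) simp
    fix n assume "\<exists>t. t \<le> 17 * pow16 n \<and> 15 * t + 2 = 17 * pow16 n"
    then obtain t where t: "15 * t + 2 = 17 * pow16 n" by blast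
    have "15 * (16 * t + 2) + 2 = 16 * (15 * t + 2)" by (simp add: algebra_simps)
    also have "\<dots> = 17 * pow16 (n + 1)" unfolding t by simp
    finally have eq: "15 * (16 * t + 2) + 2 = 17 * pow16 (n + 1)" .
    moreover have "z \<le> 15 * z + 2" for z :: model
      using mult_right_mono[of 1 15 z] by (simp add: add_increasing2)
    then have "16 * t + 2 \<le> 17 * pow16 (n + 1)" by (metis eq)
    ultimately show "\<exists>t. t \<le> 17 * pow16 (n + 1) \<and> 15 * t + 2 = 17 * pow16 (n + 1)" by blast
  qed
  then show ?thesis by blast
qed

definition term_code :: "model \<Rightarrow> model" where
  "term_code n = (THE t. 15 * t + 2 = 17 * pow16 n)"

lemma term_code_iff: "t = term_code n \<longleftrightarrow> 15 * t + 2 = 17 * pow16 n"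
proof -
  have unique: "t = t'" if "15 * t + 2 = 17 * pow16 n" "15 * t' + 2 = 17 * pow16 n" for t t'
  proof -
    have "15 * t + 2 = 15 * t' + 2" using that by simp
    then show ?thesis by simp
  qed
  then have "\<exists>!t. 15 * t + 2 = 17 * pow16 n" using term_code_exists[of n] by blast
  from theI'[OF this, folded term_code_def] show ?thesis using unique by blast
qed

lemma term_code_simps [simp]: "term_code 0 = 1" "term_code (n + 1) = 16 * term_code n + 2"
proof -
  show "term_code 0 = 1" using term_code_iff[of 1 0] by simp
  have "15 * (16 * term_code n + 2) + 2 = 16 * (15 * term_code n + 2)" by (simp add: algebra_simps)
  also have "15 * term_code n + 2 = 17 * pow16 n" using term_code_iff by blast
  finally show "term_code (n + 1) = 16 * term_code n + 2"
    using term_code_iff[of "16 * term_code n + 2" "n + 1"] by simp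
qed

lemma df_term_code [dec_intros]: "df f \<Longrightarrow> df (\<lambda>e. term_code (f e))"
  by (rule df_unary[where F = term_code]) (simp only: term_code_iff, intro dec_intros)

text \<open>The lowest hexadecimal digit is the tag of the outermost constructor, so clauses for
  different constructors exclude each other.\<close>

lemma mod16:
  fixes x y i j :: model
  assumes "16 * x + i = 16 * y + j" "i < 16" "j < 16" shows "x = y" "i = j"
  using division_unique[of x 16 i y j] assms by (auto simp: mult.commute)

section \<open>The characterization in the model\<close>

lemma holds_Conj_Disj [simp]:
  "holds M \<rho> S (Conj [])" "holds M \<rho> S (Conj (\<phi> # \<phi>s)) \<longleftrightarrow> holds M \<rho> S \<phi> \<and> holds M \<rho> S (Conj \<phi>s)"
  "\<not> holds M \<rho> S (Disj [])" "holds M \<rho> S (Disj (\<phi> # \<phi>s)) \<longleftrightarrow> holds M \<rho> S \<phi> \<or> holds M \<rho> S (Disj \<phi>s)"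
  by (simp_all add: Conj_def Disj_def)

lemma holds_Leq [simp]: "holds \<MM> \<rho> S (s \<^bold>\<le> t) \<longleftrightarrow> val \<MM> \<rho> s \<le> val \<MM> \<rho> t"
  by (simp add: Leq_def le_less)

section \<open>The formalized notions as statements about the model\<close>

definition is_str :: "model set \<Rightarrow> model set \<Rightarrow> model \<Rightarrow> bool" where
  "is_str A F c \<longleftrightarrow> c \<in> A \<and>
     (\<forall>p. p \<in> F \<longrightarrow> (\<exists>a. a \<in> A \<and> (\<exists>b. b \<in> A \<and> p = pair a b))) \<and>
     (\<forall>a. a \<in> A \<longrightarrow> (\<exists>b. pair a b \<in> F \<and> (\<forall>d. pair a d \<in> F \<longrightarrow> d = b)))"

definition iso_N :: "model set \<Rightarrow> model set \<Rightarrow> model \<Rightarrow> bool" where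
  "iso_N A F c \<longleftrightarrow> (\<exists>H\<in>Sets.
     (\<forall>p. p \<in> H \<longrightarrow> (\<exists>a. a \<in> A \<and> (\<exists>n. p = pair a n))) \<and>
     (\<forall>a. a \<in> A \<longrightarrow> (\<exists>n. pair a n \<in> H \<and> (\<forall>m. pair a m \<in> H \<longrightarrow> m = n))) \<and>
     (\<forall>a b. (\<exists>n. pair a n \<in> H \<and> pair b n \<in> H) \<longrightarrow> a = b) \<and>
     (\<forall>n. \<exists>a. pair a n \<in> H) \<and> pair c 0 \<in> H \<and>
     (\<forall>a b n. pair a n \<in> H \<and> pair a b \<in> F \<longrightarrow> pair b (n + 1) \<in> H))"

text \<open>Shaped after the unfolding of \<open>tr peano_sentence\<close>, including intermediate
  witnesses such as \<open>b'\<close> and the membership conditions of relativized quantifiers, so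
  that simplification identifies the two.\<close>

definition peano :: "model set \<Rightarrow> model set \<Rightarrow> model \<Rightarrow> bool" where
  "peano A F c \<longleftrightarrow> (\<forall>P\<in>Sets. (\<forall>p. p \<in> P \<longrightarrow> (\<exists>a. a \<in> A \<and> (\<exists>b. b \<in> A \<and> p = pair a b))) \<longrightarrow>
     (\<forall>a. a \<in> A \<longrightarrow> (\<forall>b. b \<in> A \<longrightarrow>
       (\<forall>d. pair a d \<in> F \<longrightarrow> d \<in> A \<longrightarrow> pair b d \<notin> F) \<or> a = b)) \<and>
     (\<forall>a. a \<in> A \<longrightarrow> c \<in> A \<longrightarrow> pair a c \<notin> F) \<and>
     ((\<exists>b. b \<in> A \<and> (\<exists>y. y \<in> A \<and> (\<exists>b'. b' \<in> A \<and> (\<exists>z. pair y z \<in> F \<and> b' = b \<and> z \<in> A \<and> pair b z \<in> P)) \<and>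
        pair b y \<notin> P)) \<or>
      (\<exists>b. b \<in> A \<and> (\<exists>b'. b' \<in> A \<and> b \<noteq> b' \<and>
        (\<forall>y. y \<in> A \<longrightarrow> (pair b y \<in> P \<longrightarrow> pair b' y \<in> P) \<and> (pair b' y \<in> P \<longrightarrow> pair b y \<in> P)))) \<or>
      (\<forall>y. y \<in> A \<longrightarrow> (\<exists>b. b \<in> A \<and> pair b y \<in> P))))"

definition prefix_of :: "model \<Rightarrow> model \<Rightarrow> model \<Rightarrow> bool" where
  "prefix_of x n e \<longleftrightarrow> (\<exists>w. in_set (pair (n + 1) e) w \<and> (\<forall>i y. in_set (pair i y) w \<longrightarrow>
     i = 0 \<and> y = x \<or> (\<exists>j. i = j + 1 \<and> in_set (pair j (16 * pair j y + 7)) w)))"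

definition assigns :: "model set \<Rightarrow> model \<Rightarrow> model \<Rightarrow> bool" where
  "assigns A n s \<longleftrightarrow> (\<forall>p. in_set p s \<longrightarrow> (\<exists>i. i \<le> n \<and> (\<exists>a. a \<in> A \<and> p = pair i a))) \<and>
     (\<forall>i. i \<le> n \<longrightarrow> (\<exists>a. in_set (pair i a) s \<and> (\<forall>b. in_set (pair i b) s \<longrightarrow> b = a)))"

definition term_vals :: "model set \<Rightarrow> model \<Rightarrow> model \<Rightarrow> model \<Rightarrow> bool" where
  "term_vals F c s T \<longleftrightarrow> (\<forall>y r. in_set (pair y r) T \<longrightarrow>
     (\<exists>i. y = 16 * i \<and> in_set (pair i r) s) \<or> y = 1 \<and> r = c \<or>
     (\<exists>t. y = 16 * t + 2 \<and> (\<exists>q. in_set (pair t q) T \<and> pair q r \<in> F)))"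

definition truth_vals :: "model \<Rightarrow> model \<Rightarrow> bool" where
  "truth_vals T V \<longleftrightarrow> (\<forall>y r. in_set (pair y r) V \<longrightarrow> (r = 0 \<or> r = 1) \<and>
     ((\<exists>t t'. y = 16 * pair t t' + 3 \<and>
        (\<exists>q. in_set (pair t q) T \<and> (\<exists>q'. in_set (pair t' q') T \<and> (r = 1) = (q = q')))) \<or>
      (\<exists>t. y = 16 * t + 5 \<and> (\<exists>q. in_set (pair t q) V \<and> (r = 1) = (q = 0))) \<or>
      (\<exists>t t'. y = 16 * pair t t' + 6 \<and>
        (\<exists>q. in_set (pair t q) V \<and> (\<exists>q'. in_set (pair t' q') V \<and> (r = 1) = (q = 1 \<and> q' = 1))))))"

definition sat_ex :: "model set \<Rightarrow> model set \<Rightarrow> model \<Rightarrow> model \<Rightarrow> bool" where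
  "sat_ex A F c x \<longleftrightarrow> (\<exists>n e s T V. prefix_of x n e \<and> assigns A n s \<and> term_vals F c s T \<and>
     truth_vals T V \<and> in_set (pair e 1) V)"

lemma holds_is_structure:
  "holds \<MM> \<rho> S is_structure \<longleftrightarrow> is_str (S (sv ''A'')) (S (sv ''F'')) (\<rho> (sv ''c''))"
  by (simp add: is_structure_def is_str_def)

lemma holds_isomorphic:
  "holds \<MM> \<rho> S isomorphic_to_N \<longleftrightarrow> iso_N (S (sv ''A'')) (S (sv ''F'')) (\<rho> (sv ''c''))"
  by (simp add: isomorphic_to_N_def iso_N_def)

lemma holds_peano:
  "holds \<MM> \<rho> S (tr peano_sentence) \<longleftrightarrow> peano (S (sv ''A'')) (S (sv ''F'')) (\<rho> (sv ''c''))"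
  by (simp add: peano_sentence_def relation_on_A_def ex_tuple_in_A_def upt_rec peano_def)

lemma holds_sat_existential:
  "holds \<MM> \<rho> S sat_existential \<longleftrightarrow> sat_ex (S (sv ''A'')) (S (sv ''F'')) (\<rho> (sv ''c'')) (\<rho> (sv ''x''))"
proof -
  have "holds \<MM> \<rho> S existential_prefix \<longleftrightarrow> prefix_of (\<rho> (sv ''x'')) (\<rho> (sv ''n'')) (\<rho> (sv ''e''))" for \<rho>
    by (simp add: existential_prefix_def prefix_of_def)
  moreover have "holds \<MM> \<rho> S assignment \<longleftrightarrow> assigns (S (sv ''A'')) (\<rho> (sv ''n'')) (\<rho> (sv ''s''))" for \<rho>
    by (simp add: assignment_def assigns_def)
  moreover have "holds \<MM> \<rho> S term_values \<longleftrightarrow>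
      term_vals (S (sv ''F'')) (\<rho> (sv ''c'')) (\<rho> (sv ''s'')) (\<rho> (sv ''T''))" for \<rho>
    by (simp add: term_values_def term_vals_def)
  moreover have "holds \<MM> \<rho> S truth_values \<longleftrightarrow> truth_vals (\<rho> (sv ''T'')) (\<rho> (sv ''V''))" for \<rho>
    by (simp add: truth_values_def truth_vals_def)
  ultimately show ?thesis by (simp add: sat_existential_def sat_ex_def)
qed

section \<open>Codes and satisfaction of the reachability sentences\<close>

definition reach_code :: "model \<Rightarrow> model" where
  "reach_code n = 16 * pair 0 (16 * pair 0 (term_code n) + 3) + 7"

lemma less_reach_code: "t < 16 * pair 0 (16 * pair 0 t + 3) + 7"
proof -
  have "t \<le> pair 0 t" by (rule le_pair)
  also have "\<dots> \<le> 16 * pair 0 t" using mult_right_mono[of 1 16 "pair 0 t"] by simp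
  also have "\<dots> \<le> 16 * pair 0 t + 3" by simp
  also have "\<dots> \<le> pair 0 (16 * pair 0 t + 3)" by (rule le_pair)
  also have "\<dots> \<le> 16 * pair 0 (16 * pair 0 t + 3)" using mult_right_mono[of 1 16 "pair 0 (16 * pair 0 t + 3)"] by simp
  also have "\<dots> < 16 * pair 0 (16 * pair 0 t + 3) + 7" by simp
  finally show ?thesis .
qed

lemma holds_reach_fm: "holds \<MM> \<rho> S reach_fm \<longleftrightarrow> (\<exists>n. \<rho> (sv ''x'') = reach_code n)"
proof -
  have "holds \<MM> \<rho> S reach_fm \<longleftrightarrow> (\<exists>t. t < \<rho> (sv ''x'') \<and> (\<exists>q. q < \<rho> (sv ''x'') \<and> power_of_two q \<and>
      15 * t + 2 = 17 * (q * q * (q * q)) \<and> \<rho> (sv ''x'') = 16 * pair 0 (16 * pair 0 t + 3) + 7))"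
    by (simp add: reach_fm_def power_of_two_fm_def power_of_two_def)
  also have "\<dots> \<longleftrightarrow> (\<exists>n. \<rho> (sv ''x'') = reach_code n)"
  proof
    assume "\<exists>t. t < \<rho> (sv ''x'') \<and> (\<exists>q. q < \<rho> (sv ''x'') \<and> power_of_two q \<and>
      15 * t + 2 = 17 * (q * q * (q * q)) \<and> \<rho> (sv ''x'') = 16 * pair 0 (16 * pair 0 t + 3) + 7)"
    then obtain t q where tq: "power_of_two q" "15 * t + 2 = 17 * (q * q * (q * q))"
      "\<rho> (sv ''x'') = 16 * pair 0 (16 * pair 0 t + 3) + 7" by blast
    then obtain n where "q = exp2 n" using power_of_twoD by blast
    then have "t = term_code n" using tq(2) by (simp add: term_code_iff pow16_def)
    then show "\<exists>n. \<rho> (sv ''x'') = reach_code n" using tq(3) by (auto simp: reach_code_def)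
  next
    assume "\<exists>n. \<rho> (sv ''x'') = reach_code n"
    then obtain n where n: "\<rho> (sv ''x'') = reach_code n" by blast
    let ?t = "term_code n" and ?q = "exp2 n"
    have eq: "15 * ?t + 2 = 17 * (?q * ?q * (?q * ?q))" using term_code_iff[of ?t n] by (simp add: pow16_def)
    \<comment> \<open>The bound on q in \<open>reach_fm\<close> loses no solution: t < q would give
      15 t + 2 < 17 (t + 1) \<le> 17 q \<le> 17 q^4.\<close>
    have "?q \<le> ?t"
    proof (rule ccontr)
      assume "\<not> ?q \<le> ?t"
      then have "?t + 1 \<le> ?q" by simp
      have "15 * ?t + 2 < 17 * ?t + 17" by (intro add_le_less_mono mult_right_mono) simp_all
      also have "\<dots> = 17 * (?t + 1)" by (simp add: distrib_left)
      also have "\<dots> \<le> 17 * (?q * ?q * (?q * ?q))"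
        by (rule mult_left_mono[OF order_trans[OF \<open>?t + 1 \<le> ?q\<close> order_trans[OF square_ge_self square_ge_self]]]) simp
      finally show False using eq by simp
    qed
    moreover have "?t < \<rho> (sv ''x'')" unfolding n reach_code_def by (rule less_reach_code)
    ultimately show "\<exists>t. t < \<rho> (sv ''x'') \<and> (\<exists>q. q < \<rho> (sv ''x'') \<and> power_of_two q \<and>
      15 * t + 2 = 17 * (q * q * (q * q)) \<and> \<rho> (sv ''x'') = 16 * pair 0 (16 * pair 0 t + 3) + 7)"
      using eq n power_of_two_exp2[of n] by (intro exI[of _ ?t] conjI exI[of _ ?q]) (auto simp: reach_code_def)
  qed
  finally show ?thesis .
qed

lemma holds_Xi: "holds \<MM> \<rho> S Xi \<longleftrightarrow>
    \<rho> (sv ''x'') = of_nat (code_ofm peano_sentence) \<or> (\<exists>n. \<rho> (sv ''x'') = reach_code n)"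
  by (simp add: Xi_def holds_reach_fm)

text \<open>Its tag 10 differs from the tag 7 of existential codes. Hence
  \<open>peano_sentence\<close> can be satisfied only through its own disjunct of
  \<open>sat\<close>, and the reachability sentences only through the existential one.\<close>

lemma code_peano: "\<exists>b. (of_nat (code_ofm peano_sentence) :: model) = 16 * b + 10"
  \<comment> \<open>Only the outermost clause of the coding is unfolded; by iterated squaring the
    number is far too large to be evaluated.\<close>
  unfolding peano_sentence_def code_ofm.simps(8) of_nat_add of_nat_mult by auto

text \<open>The least positive index in w must be 1, because a positive predecessor would be
  smaller; so x begins with a quantifier. If the formula left after stripping it is an equation, its
  tag 3 allows no further stripping, and no index above 1 can occur, whence n = 0.\<close>

lemma prefix_ofE:
  assumes "prefix_of x n e"
  obtains b where "x = 16 * b + 7"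
    "\<And>y. x = 16 * pair 0 (16 * y + 3) + 7 \<Longrightarrow> n = 0 \<and> e = 16 * y + 3"
proof -
  obtain w where w: "in_set (pair (n + 1) e) w" and clause: "\<And>i y. in_set (pair i y) w \<Longrightarrow>
      i = 0 \<and> y = x \<or> (\<exists>j. i = j + 1 \<and> in_set (pair j (16 * pair j y + 7)) w)"
    using assms unfolding prefix_of_def by blast
  have bound: "y \<le> w" if "in_set (pair i y) w" for i y
    using in_set_less[OF that] le_pair(2)[of y i] by (meson le_less_trans less_imp_le)
  have zero: "y = x" if "in_set (pair 0 y) w" for y
    using clause[OF that] basic_facts(1) by metis
  have one: "x = 16 * pair 0 y + 7" if y: "in_set (pair 1 y) w" for y
  proof -
    obtain j where j: "1 = j + 1" "in_set (pair j (16 * pair j y + 7)) w"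
      using clause[OF y] by auto
    then have "j = 0" by (metis add_cancel_left_left)
    then show ?thesis using zero[of "16 * pair 0 y + 7"] j(2) by simp
  qed
  have descend: "\<exists>y. in_set (pair 1 y) w"
  proof -
    have "dec (\<lambda>e. 0 < e 0 \<and> (\<exists>y. y \<le> w \<and> in_set (pair (e 0) y) w))" by (intro dec_intros)
    moreover have "0 < n + 1 \<and> (\<exists>y. y \<le> w \<and> in_set (pair (n + 1) y) w)"
      using w bound[OF w] zero_less_add_one_model by blast
    ultimately obtain m where m: "0 < m \<and> (\<exists>y. y \<le> w \<and> in_set (pair m y) w)"
      "\<And>y. y < m \<Longrightarrow> \<not> (0 < y \<and> (\<exists>y'. y' \<le> w \<and> in_set (pair y y') w))"
      by (rule dec_least[where P = "\<lambda>m. 0 < m \<and> (\<exists>y. y \<le> w \<and> in_set (pair m y) w)"]) blast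
    obtain y where y: "in_set (pair m y) w" using m(1) by blast
    obtain j where j: "m = j + 1" "in_set (pair j (16 * pair j y + 7)) w"
      using clause[OF y] m(1) by auto
    have "j = 0"
    proof (rule ccontr)
      assume "j \<noteq> 0"
      then have "0 < j" by (simp add: zero_less_iff_neq_zero)
      moreover have "j < m" using j(1) by simp
      ultimately show False using m(2)[of j] j(2) bound by blast
    qed
    then show ?thesis using y j(1) by auto
  qed
  then obtain b where b: "x = 16 * b + 7" using one by blast
  moreover have "n = 0 \<and> e = 16 * y + 3" if x: "x = 16 * pair 0 (16 * y + 3) + 7" for y
  proof -
    have one': "z = 16 * y + 3" if "in_set (pair 1 z) w" for z
    proof -
      have "16 * pair 0 z + 7 = 16 * pair 0 (16 * y + 3) + 7" using one[OF that] x by simp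
      then have "pair 0 z = pair 0 (16 * y + 3)" by simp
      then show ?thesis by simp
    qed
    have "\<not> (1 < i \<and> (\<exists>z. z \<le> w \<and> in_set (pair i z) w))" for i
    proof (rule dec_less_induct[where P = "\<lambda>i. \<not> (1 < i \<and> (\<exists>z. z \<le> w \<and> in_set (pair i z) w))"])
      show "dec (\<lambda>e. \<not> (1 < e 0 \<and> (\<exists>z. z \<le> w \<and> in_set (pair (e 0) z) w)))" by (intro dec_intros)
      fix i assume IH: "\<And>i'. i' < i \<Longrightarrow> \<not> (1 < i' \<and> (\<exists>z. z \<le> w \<and> in_set (pair i' z) w))"
      show "\<not> (1 < i \<and> (\<exists>z. z \<le> w \<and> in_set (pair i z) w))"
      proof
        assume "1 < i \<and> (\<exists>z. z \<le> w \<and> in_set (pair i z) w)"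
        then obtain z where i: "1 < i" and z: "in_set (pair i z) w" by blast
        obtain j where j: "i = j + 1" "in_set (pair j (16 * pair j z + 7)) w"
          using clause[OF z] i by auto
        have "1 \<le> j" using i j(1) add_one_le_iff[of 0 j] by simp
        then consider "j = 1" | "1 < j" by (auto simp: le_less)
        then show False
        proof cases
          case 1
          then have "16 * pair 1 z + 7 = 16 * y + 3" using one' j(2) by simp
          then show False using mod16(2)[of "pair 1 z" 7 y 3] by simp
        next
          case 2
          moreover have "j < i" using j(1) by simp
          ultimately show False using IH[of j] j(2) bound by blast
        qed
      qed
    qed
    then have "\<not> 1 < n + 1" using w bound[OF w] by blast
    then have "n = 0" by (simp add: not_less)
    then show ?thesis using one'[of e] w by simp
  qed
  ultimately show ?thesis using that by blast
qed

lemma sat_ex_form: "sat_ex A F c x \<Longrightarrow> \<exists>b. x = 16 * b + 7"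
  unfolding sat_ex_def using prefix_ofE by metis

text \<open>The truth value of the equation must be justified by values of both its sides, so
  \<open>T\<close> contains a value of f^n c. The clauses for terms then lead down to values of all
  shorter terms.\<close>

lemma sat_ex_reach_code:
  assumes "sat_ex A F c (reach_code n)"
  obtains s T a where "term_vals F c s T" "in_set (pair (term_code n) a) T"
proof -
  obtain m e s T V where *: "prefix_of (reach_code n) m e" "term_vals F c s T" "truth_vals T V"
    "in_set (pair e 1) V" using assms unfolding sat_ex_def by blast
  have "e = 16 * pair 0 (term_code n) + 3"
    using prefix_ofE[OF *(1)] unfolding reach_code_def by metis
  then have V: "in_set (pair (16 * pair 0 (term_code n) + 3) 1) V" using *(4) by simp
  let ?y = "16 * pair 0 (term_code n) + 3"
  have no: "?y \<noteq> 16 * t + 5" "?y \<noteq> 16 * t + 6" for t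
    using mod16(2)[of "pair 0 (term_code n)" 3 t 5] mod16(2)[of "pair 0 (term_code n)" 3 t 6] by auto
  obtain t t' q' where "?y = 16 * pair t t' + 3" "in_set (pair t' q') T"
    using *(3)[unfolded truth_vals_def, rule_format, OF V] no by blast
  then have "in_set (pair (term_code n) q') T" by simp
  then show ?thesis using that *(2) by blast
qed

locale model_structure =
  fixes A F :: "model set" and c :: model
  assumes A: "A \<in> Sets" and F: "F \<in> Sets" and str: "is_str A F c"
begin

lemma F_in: "pair a b \<in> F \<Longrightarrow> a \<in> A \<and> b \<in> A"
proof -
  assume "pair a b \<in> F"
  then have "\<exists>a'. a' \<in> A \<and> (\<exists>b'. b' \<in> A \<and> pair a b = pair a' b')"
    using str unfolding is_str_def by blast
  then show ?thesis by auto
qed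

lemma F_total: "a \<in> A \<Longrightarrow> \<exists>b. pair a b \<in> F"
  using str unfolding is_str_def by blast

lemma F_fun: "pair a b \<in> F \<Longrightarrow> pair a d \<in> F \<Longrightarrow> b = d"
proof -
  assume *: "pair a b \<in> F" "pair a d \<in> F"
  then have "a \<in> A" using F_in by blast
  then obtain b' where "\<And>d. pair a d \<in> F \<Longrightarrow> d = b'" using str unfolding is_str_def by blast
  then show "b = d" using * by blast
qed

subsection \<open>Structures isomorphic to the numbers\<close>

context
  fixes H assumes H: "H \<in> Sets"
    and H_in: "\<And>a n. pair a n \<in> H \<Longrightarrow> a \<in> A"
    and H_total: "\<And>a. a \<in> A \<Longrightarrow> \<exists>n. pair a n \<in> H"
    and H_fun: "\<And>a n m. pair a n \<in> H \<Longrightarrow> pair a m \<in> H \<Longrightarrow> n = m"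
    and H_inj: "\<And>a b n. pair a n \<in> H \<Longrightarrow> pair b n \<in> H \<Longrightarrow> a = b"
    and H_surj: "\<And>n. \<exists>a. pair a n \<in> H"
    and H_zero: "pair c 0 \<in> H"
    and H_step: "\<And>a b n. pair a n \<in> H \<Longrightarrow> pair a b \<in> F \<Longrightarrow> pair b (n + 1) \<in> H"
begin

definition elem :: "model \<Rightarrow> model" where
  "elem n = (THE a. pair a n \<in> H)"

lemma elem_iff: "a = elem n \<longleftrightarrow> pair a n \<in> H"
proof -
  have "\<exists>!a. pair a n \<in> H" using H_surj[of n] H_inj by blast
  from theI'[OF this, folded elem_def] show ?thesis using H_inj by blast
qed

lemma df_elem: "df f \<Longrightarrow> df (\<lambda>e. elem (f e))"
  by (rule df_unary[where F = elem]) (simp only: elem_iff, intro dec_intros H)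

lemma elem_in: "elem n \<in> A"
  using elem_iff H_in by blast

lemma elem_inj: "elem m = elem n \<Longrightarrow> m = n"
  using elem_iff H_fun by metis

lemma elem_zero: "elem 0 = c"
  using elem_iff H_zero by metis

lemma elem_surj: "a \<in> A \<Longrightarrow> \<exists>n. a = elem n"
  using elem_iff H_total by blast

lemma elem_step: "pair (elem n) b \<in> F \<longleftrightarrow> b = elem (n + 1)"
proof -
  obtain d where d: "pair (elem n) d \<in> F" using F_total[OF elem_in] by blast
  have *: "b = elem (n + 1)" if "pair (elem n) b \<in> F" for b
    using H_step[OF elem_iff[THEN iffD1, OF refl] that] elem_iff by blast
  show ?thesis using d * by blast
qed

lemma peano_family:
  assumes P: "P \<in> Sets"
    and closed: "\<And>b y z. b \<in> A \<Longrightarrow> y \<in> A \<Longrightarrow> pair y z \<in> F \<Longrightarrow> pair b z \<in> P \<Longrightarrow> pair b y \<in> P"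
    and distinct: "\<And>b b'. b \<in> A \<Longrightarrow> b' \<in> A \<Longrightarrow> b \<noteq> b' \<Longrightarrow>
      \<exists>y. y \<in> A \<and> \<not> (pair b y \<in> P \<longleftrightarrow> pair b' y \<in> P)"
    and "y \<in> A"
  shows "\<exists>b. b \<in> A \<and> pair b y \<in> P"
proof (rule ccontr)
  assume no: "\<nexists>b. b \<in> A \<and> pair b y \<in> P"
  obtain m where m: "y = elem m" using elem_surj[OF \<open>y \<in> A\<close>] by blast
  define X where "X n k \<longleftrightarrow> pair (elem n) (elem k) \<in> P" for n k
  have dec_X: "dec (\<lambda>e. X (e i) (e j))" for i j
    unfolding X_def by (intro dec_intros df_elem P)
  have down1: "X n k" if "X n (k + 1)" for n k
    using closed[OF elem_in elem_in, of k "elem (k + 1)" n] elem_step that unfolding X_def by blast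
  have down: "X n (k + i) \<longrightarrow> X n k" for n k i
  proof (rule dec_induct[where P = "\<lambda>i. X n (k + i) \<longrightarrow> X n k"])
    show "dec (\<lambda>e. X n (k + e 0) \<longrightarrow> X n k)" unfolding X_def by (intro dec_intros df_elem P)
    fix i assume "X n (k + i) \<longrightarrow> X n k"
    then show "X n (k + (i + 1)) \<longrightarrow> X n k" using down1[of n "k + i"] by (simp only: add.assoc) blast
  qed simp
  have not_m: "\<not> X n m" for n using no elem_in unfolding X_def m by blast
  \<comment> \<open>The length of the initial segment X n: the least index outside it, which exists
    and is at most m because m is outside.\<close>
  define j where "j n = (THE k. k \<le> m \<and> \<not> X n k \<and> (\<forall>i. i < k \<longrightarrow> X n i))" for n
  have ex1: "\<exists>!k. k \<le> m \<and> \<not> X n k \<and> (\<forall>i. i < k \<longrightarrow> X n i)" for n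
  proof -
    have "dec (\<lambda>e. \<not> X n (e 0))" unfolding X_def by (intro dec_intros df_elem P)
    then obtain k where k: "\<not> X n k" "\<And>i. i < k \<Longrightarrow> \<not> \<not> X n i"
      using dec_least[where P = "\<lambda>k. \<not> X n k" and x = m] not_m by blast
    then have "k \<le> m" using not_m[of n] by (meson not_less)
    show ?thesis
    proof (rule ex1I[of _ k])
      show "k \<le> m \<and> \<not> X n k \<and> (\<forall>i. i < k \<longrightarrow> X n i)" using k \<open>k \<le> m\<close> by blast
      fix k' assume "k' \<le> m \<and> \<not> X n k' \<and> (\<forall>i. i < k' \<longrightarrow> X n i)"
      then show "k' = k" using k by (meson linorder_cases)
    qed
  qed
  have j_iff: "k = j n \<longleftrightarrow> k \<le> m \<and> \<not> X n k \<and> (\<forall>i. i < k \<longrightarrow> X n i)" for n k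
    using theI'[OF ex1[of n], folded j_def] ex1[of n] by blast
  have "df (\<lambda>e. j (e 0))"
  proof (rule df_unary[where F = j])
    show "dec (\<lambda>e. e 0 = j (e (Suc 0)))"
      unfolding j_iff X_def by (intro dec_intros df_elem P)
  qed (intro dec_intros)
  \<comment> \<open>The length m is possible too, so there are m + 1 values.\<close>
  moreover have "j n < m + 1" for n using j_iff[of "j n" n] by simp
  ultimately obtain n n' where nn: "n \<noteq> n'" "j n = j n'" by (rule pigeonhole)
  have X_iff: "X n k \<longleftrightarrow> k < j n" for n k
  proof
    assume "X n k"
    show "k < j n"
    proof (rule ccontr)
      assume "\<not> k < j n"
      then obtain i where "k = j n + i" using le_iff_model[of "j n" k] by auto
      then have "X n (j n)" using \<open>X n k\<close> down by blast
      then show False using j_iff[of "j n" n] by blast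
    qed
  qed (use j_iff[of "j n" n] in blast)
  have "elem n \<noteq> elem n'" using nn(1) elem_inj by blast
  then obtain z where "z \<in> A" "\<not> (pair (elem n) z \<in> P \<longleftrightarrow> pair (elem n') z \<in> P)"
    using distinct[OF elem_in elem_in] by blast
  moreover obtain k where "z = elem k" using elem_surj[OF \<open>z \<in> A\<close>] by blast
  ultimately have "\<not> (X n k \<longleftrightarrow> X n' k)" unfolding X_def by blast
  then show False unfolding X_iff nn(2) by blast
qed

lemma peano_iso: "peano A F c"
  unfolding peano_def
proof (intro ballI impI conjI allI)
  fix a b assume "a \<in> A" "b \<in> A"
  then obtain m n where mn: "a = elem m" "b = elem n" using elem_surj by blast
  have "m = n" if "pair a d \<in> F" "pair b d \<in> F" for d
  proof -
    have "elem (m + 1) = elem (n + 1)" using that unfolding mn elem_step by simp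
    then show ?thesis using elem_inj[of "m + 1" "n + 1"] by simp
  qed
  then show "(\<forall>d. pair a d \<in> F \<longrightarrow> d \<in> A \<longrightarrow> pair b d \<notin> F) \<or> a = b" using mn by blast
next
  fix a assume "a \<in> A"
  then obtain m where m: "a = elem m" using elem_surj by blast
  show "pair a c \<notin> F"
  proof
    assume "pair a c \<in> F"
    then have "elem 0 = elem (m + 1)" unfolding m elem_step elem_zero .
    then show False using elem_inj[of 0 "m + 1"] basic_facts(1)[of m] by simp
  qed
next
  fix P assume P: "P \<in> Sets"
  show "(\<exists>b. b \<in> A \<and> (\<exists>y. y \<in> A \<and> (\<exists>b'. b' \<in> A \<and> (\<exists>z. pair y z \<in> F \<and> b' = b \<and> z \<in> A \<and> pair b z \<in> P)) \<and>
        pair b y \<notin> P)) \<or>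
      (\<exists>b. b \<in> A \<and> (\<exists>b'. b' \<in> A \<and> b \<noteq> b' \<and>
        (\<forall>y. y \<in> A \<longrightarrow> (pair b y \<in> P \<longrightarrow> pair b' y \<in> P) \<and> (pair b' y \<in> P \<longrightarrow> pair b y \<in> P)))) \<or>
      (\<forall>y. y \<in> A \<longrightarrow> (\<exists>b. b \<in> A \<and> pair b y \<in> P))" (is "?N \<or> ?E \<or> ?C")
  proof (rule ccontr)
    assume neg: "\<not> (?N \<or> ?E \<or> ?C)"
    have "\<exists>b. b \<in> A \<and> pair b y \<in> P" if "y \<in> A" for y
    proof (rule peano_family[OF P _ _ that])
      fix b y z assume "b \<in> A" "y \<in> A" "pair y z \<in> F" "pair b z \<in> P"
      moreover have "z \<in> A" using F_in \<open>pair y z \<in> F\<close> by blast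
      ultimately show "pair b y \<in> P" using neg by blast
    next
      fix b b' assume "b \<in> A" "b' \<in> A" "b \<noteq> b'"
      then show "\<exists>y. y \<in> A \<and> \<not> (pair b y \<in> P \<longleftrightarrow> pair b' y \<in> P)" using neg by blast
    qed
    then show False using neg by blast
  qed
qed

lemma finite_code:
  assumes "dec (\<lambda>e. P (e 0))" and "\<And>s. P s \<Longrightarrow> s \<le> b"
  shows "\<exists>T. \<forall>s. in_set s T \<longleftrightarrow> P s"
proof -
  obtain T where T: "\<And>s. in_set s T \<longleftrightarrow> s < b + 1 \<and> P s"
    using finite_coding[OF assms(1), of "b + 1"] by blast
  have "in_set s T \<longleftrightarrow> P s" for s unfolding T using assms(2) by (simp add: less_add_one_iff) blast
  then show ?thesis by blast
qed

text \<open>The evaluation assigns \<open>elem n\<close> to v_0 and \<open>elem k\<close> to f^k c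
  for k \<le> n. As these pairs are decidable, a code for them exists once they are bounded.\<close>

lemma sat_ex_iso: "sat_ex A F c (reach_code n)"
proof -
  let ?e = "16 * pair 0 (term_code n) + 3"
  have single: "\<exists>T. \<forall>s. in_set s T \<longleftrightarrow> s = p" for p
  proof -
    have "dec (\<lambda>e. e 0 = p)" by (intro dec_intros)
    then show ?thesis using finite_code[where P = "\<lambda>s. s = p" and b = p] by blast
  qed
  obtain s where s: "\<And>p. in_set p s \<longleftrightarrow> p = pair 0 (elem n)" using single by blast
  obtain V where V: "\<And>p. in_set p V \<longleftrightarrow> p = pair ?e 1" using single by blast
  have "dec (\<lambda>e. e 0 = pair 0 (reach_code n) \<or> e 0 = pair 1 ?e)" by (intro dec_intros)
  moreover have "p \<le> pair 0 (reach_code n) + pair 1 ?e" if "p = pair 0 (reach_code n) \<or> p = pair 1 ?e" for p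
    using that by (elim disjE) simp_all
  ultimately have "\<exists>w. \<forall>p. in_set p w \<longleftrightarrow> p = pair 0 (reach_code n) \<or> p = pair 1 ?e"
    by (rule finite_code[where P = "\<lambda>p. p = pair 0 (reach_code n) \<or> p = pair 1 ?e"])
  then obtain w where w: "\<And>p. in_set p w \<longleftrightarrow> p = pair 0 (reach_code n) \<or> p = pair 1 ?e" by blast
  \<comment> \<open>The bound is the maximum of the coded pairs up to n; no explicit bound on
    \<open>elem\<close> is at hand.\<close>
  have "df (\<lambda>e. pair (term_code (e 0)) (elem (e 0)))" by (intro dec_intros df_elem)
  then obtain B where B: "\<And>k. k \<le> n \<Longrightarrow> pair (term_code k) (elem k) \<le> B"
    using df_bounded[where f = "\<lambda>k. pair (term_code k) (elem k)"] by blast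
  \<comment> \<open>The first component 0 is the code of the variable v_0, whose tag and index are
    both 0.\<close>
  have "dec (\<lambda>e. e 0 = pair 0 (elem n) \<or> (\<exists>k. k \<le> n \<and> e 0 = pair (term_code k) (elem k)))"
    by (intro dec_intros df_elem)
  moreover have "p \<le> pair 0 (elem n) + B"
    if "p = pair 0 (elem n) \<or> (\<exists>k. k \<le> n \<and> p = pair (term_code k) (elem k))" for p
    using that B by (auto intro: add_increasing)
  ultimately have "\<exists>T. \<forall>p. in_set p T \<longleftrightarrow>
      p = pair 0 (elem n) \<or> (\<exists>k. k \<le> n \<and> p = pair (term_code k) (elem k))"
    by (rule finite_code[where P = "\<lambda>p. p = pair 0 (elem n) \<or> (\<exists>k. k \<le> n \<and> p = pair (term_code k) (elem k))"])
  then obtain T where T: "\<And>p. in_set p T \<longleftrightarrow>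
      p = pair 0 (elem n) \<or> (\<exists>k. k \<le> n \<and> p = pair (term_code k) (elem k))" by blast
  have "prefix_of (reach_code n) 0 ?e" unfolding prefix_of_def
  proof (intro exI[of _ w] conjI allI impI)
    show "in_set (pair (0 + 1) ?e) w" unfolding w by simp
    fix i y assume "in_set (pair i y) w"
    then consider "i = 0" "y = reach_code n" | "i = 0 + 1" "y = ?e" unfolding w by auto
    then show "i = 0 \<and> y = reach_code n \<or> (\<exists>j. i = j + 1 \<and> in_set (pair j (16 * pair j y + 7)) w)"
    proof cases
      case 2
      have "in_set (pair 0 (16 * pair 0 y + 7)) w" unfolding w 2(2) reach_code_def by blast
      then show ?thesis using 2(1) by blast
    qed blast
  qed
  moreover have "assigns A 0 s" unfolding assigns_def s using elem_in by auto
  moreover have "term_vals F c s T" unfolding term_vals_def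
  proof (intro allI impI)
    fix y r assume "in_set (pair y r) T"
    then consider "y = 0" "r = elem n" | k where "k \<le> n" "y = term_code k" "r = elem k"
      unfolding T by auto
    then show "(\<exists>i. y = 16 * i \<and> in_set (pair i r) s) \<or> y = 1 \<and> r = c \<or>
        (\<exists>t. y = 16 * t + 2 \<and> (\<exists>q. in_set (pair t q) T \<and> pair q r \<in> F))"
    proof cases
      case 1
      then have "y = 16 * 0 \<and> in_set (pair 0 r) s" unfolding s by simp
      then show ?thesis by blast
    next
      case 2
      show ?thesis
      proof (cases "k = 0")
        case True
        then show ?thesis using 2 elem_zero by simp
      next
        case False
        then have "0 < k" by (simp add: zero_less_iff_neq_zero)
        then obtain l where l: "k = l + 1" unfolding less_iff_model by auto
        have "l \<le> n" using 2(1) unfolding l by (intro less_imp_le) simp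
        then have "in_set (pair (term_code l) (elem l)) T" unfolding T by blast
        moreover have "pair (elem l) r \<in> F" unfolding elem_step 2(3) l ..
        moreover have "y = 16 * term_code l + 2" unfolding 2(2) l by simp
        ultimately show ?thesis by blast
      qed
    qed
  qed
  moreover have "truth_vals T V" unfolding truth_vals_def
  proof (intro allI impI conjI)
    fix y r assume "in_set (pair y r) V"
    then have yr: "y = ?e" "r = 1" unfolding V by simp_all
    then show "r = 0 \<or> r = 1" by simp
    have "in_set (pair 0 (elem n)) T" "in_set (pair (term_code n) (elem n)) T" unfolding T by auto
    moreover have "(r = 1) = (elem n = elem n)" using yr by simp
    ultimately have "\<exists>t t'. y = 16 * pair t t' + 3 \<and>
        (\<exists>q. in_set (pair t q) T \<and> (\<exists>q'. in_set (pair t' q') T \<and> (r = 1) = (q = q')))"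
      using yr(1) by blast
    then show "(\<exists>t t'. y = 16 * pair t t' + 3 \<and>
        (\<exists>q. in_set (pair t q) T \<and> (\<exists>q'. in_set (pair t' q') T \<and> (r = 1) = (q = q')))) \<or>
      (\<exists>t. y = 16 * t + 5 \<and> (\<exists>q. in_set (pair t q) V \<and> (r = 1) = (q = 0))) \<or>
      (\<exists>t t'. y = 16 * pair t t' + 6 \<and>
        (\<exists>q. in_set (pair t q) V \<and> (\<exists>q'. in_set (pair t' q') V \<and> (r = 1) = (q = 1 \<and> q' = 1))))" ..
  qed
  moreover have "in_set (pair ?e 1) V" unfolding V ..
  ultimately show ?thesis unfolding sat_ex_def by blast
qed

end

lemma iso_imp: "iso_N A F c \<Longrightarrow> peano A F c \<and> (\<forall>n. sat_ex A F c (reach_code n))"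
proof -
  assume "iso_N A F c"
  then obtain H where H: "H \<in> Sets" "\<forall>p. p \<in> H \<longrightarrow> (\<exists>a. a \<in> A \<and> (\<exists>n. p = pair a n))"
     "\<forall>a. a \<in> A \<longrightarrow> (\<exists>n. pair a n \<in> H \<and> (\<forall>m. pair a m \<in> H \<longrightarrow> m = n))"
     "\<forall>a b. (\<exists>n. pair a n \<in> H \<and> pair b n \<in> H) \<longrightarrow> a = b"
     "\<forall>n. \<exists>a. pair a n \<in> H" "pair c 0 \<in> H"
     "\<forall>a b n. pair a n \<in> H \<and> pair a b \<in> F \<longrightarrow> pair b (n + 1) \<in> H"
    unfolding iso_N_def by blast
  have 1: "a \<in> A" if "pair a n \<in> H" for a n
  proof -
    have "\<exists>a'. a' \<in> A \<and> (\<exists>n'. pair a n = pair a' n')" using H(2) that by blast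
    then show ?thesis by auto
  qed
  have 2: "\<exists>n. pair a n \<in> H" if "a \<in> A" for a using H(3) that by blast
  have 3: "n = m" if "pair a n \<in> H" "pair a m \<in> H" for a n m using H(3) 1[OF that(1)] that by blast
  have 4: "a = b" if "pair a n \<in> H" "pair b n \<in> H" for a b n using H(4) that by blast
  have 5: "\<exists>a. pair a n \<in> H" for n using H(5) by blast
  have 7: "pair b (n + 1) \<in> H" if "pair a n \<in> H" "pair a b \<in> F" for a b n using H(7) that by blast
  have "peano A F c" by (rule peano_iso[where H = H]) (use H(1,6) 1 2 3 4 5 7 in blast)+
  moreover have "sat_ex A F c (reach_code n)" for n
    by (rule sat_ex_iso[where H = H]) (use H(1,6) 1 2 3 4 5 7 in blast)+
  ultimately show ?thesis by blast
qed

end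

subsection \<open>Structures satisfying the sentences\<close>

context model_structure
begin

text \<open>A table of values of f^k c for k \<le> n, indexed by term codes so that the
  \<open>T\<close> of \<open>sat_existential\<close> can serve directly. Entries in \<open>T\<close>
  are at most \<open>T\<close>, so all quantifiers can be bounded and the notion is
  decidable.\<close>

definition chain :: "model \<Rightarrow> model \<Rightarrow> model \<Rightarrow> bool" where
  "chain T n a \<longleftrightarrow> in_set (pair (term_code n) a) T \<and>
     (\<forall>k. k \<le> n \<longrightarrow> (\<forall>r. r \<le> T \<longrightarrow> in_set (pair (term_code k) r) T \<longrightarrow> k = 0 \<and> r = c \<or>
       (\<exists>j. j \<le> k \<and> k = j + 1 \<and> (\<exists>q. q \<le> T \<and> in_set (pair (term_code j) q) T \<and> pair q r \<in> F))))"

lemma dec_chain: "dec (\<lambda>e. chain (e i) (e j) (e k))"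
  unfolding chain_def by (intro dec_intros F)

lemma in_set_pair_le: "in_set (pair y r) T \<Longrightarrow> r \<le> T"
  using in_set_less le_pair(2) by (meson le_less_trans less_imp_le)

lemma chainD:
  assumes "chain T n a" "k \<le> n" "in_set (pair (term_code k) r) T"
  shows "k = 0 \<and> r = c \<or> (\<exists>j q. k = j + 1 \<and> in_set (pair (term_code j) q) T \<and> pair q r \<in> F)"
  using assms in_set_pair_le[OF assms(3)] unfolding chain_def by blast

text \<open>Modulo 16 the code of c is 1, that of an application of f is 2 and that of a variable is
  0.\<close>

lemma term_code_cases:
  "term_code k = 16 * i \<Longrightarrow> False" "term_code k = 1 \<Longrightarrow> k = 0"
  "term_code k = 16 * t + 2 \<Longrightarrow> \<exists>j. k = j + 1 \<and> t = term_code j"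
proof -
  consider "k = 0" | j where "k = j + 1"
    using less_iff_model[of 0 k] by (auto simp: zero_less_iff_neq_zero)
  note cases = this
  show "term_code k = 16 * i \<Longrightarrow> False"
    using mod16(2)[of 0 1 i 0] mod16(2)[of "term_code j" 2 i 0 for j] by (cases rule: cases) auto
  show "term_code k = 1 \<Longrightarrow> k = 0"
    using mod16(2)[of "term_code j" 2 0 1 for j] by (cases rule: cases) auto
  show "term_code k = 16 * t + 2 \<Longrightarrow> \<exists>j. k = j + 1 \<and> t = term_code j"
    using mod16(2)[of 0 1 t 2] by (cases rule: cases) auto
qed

lemma chain_exists:
  assumes "sat_ex A F c (reach_code n)"
  shows "\<exists>T a. chain T n a"
proof -
  obtain s T a where T: "term_vals F c s T" and a: "in_set (pair (term_code n) a) T"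
    using sat_ex_reach_code[OF assms] by metis
  have "chain T n a" unfolding chain_def
  proof (intro conjI allI impI)
    fix k r assume "k \<le> n" and in_T: "in_set (pair (term_code k) r) T"
    consider i where "term_code k = 16 * i" | "term_code k = 1" "r = c"
      | t q where "term_code k = 16 * t + 2" "in_set (pair t q) T" "pair q r \<in> F"
      using T[unfolded term_vals_def, rule_format, OF in_T] by blast
    then show "k = 0 \<and> r = c \<or> (\<exists>j. j \<le> k \<and> k = j + 1 \<and>
        (\<exists>q. q \<le> T \<and> in_set (pair (term_code j) q) T \<and> pair q r \<in> F))"
    proof cases
      case 1
      then show ?thesis using term_code_cases(1) by blast
    next
      case 2
      then show ?thesis using term_code_cases(2) by blast
    next
      case (3 t q)
      obtain j where j: "k = j + 1" "t = term_code j" using term_code_cases(3)[OF 3(1)] by blast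
      have "j \<le> k" using j(1) by (intro less_imp_le) simp
      then show ?thesis using 3(2,3) j in_set_pair_le[OF 3(2)] by blast
    qed
  qed (rule a)
  then show ?thesis by blast
qed

text \<open>Both tables justify their entries by earlier ones, so they agree by induction on k \<le>
  n; the codes themselves bound the entries compared.\<close>

lemma chain_unique:
  assumes ch: "chain T n a" "chain T' n a'"
  shows "a = a'"
proof -
  have "k \<le> n \<longrightarrow> (\<forall>r. r \<le> T \<longrightarrow> (\<forall>r'. r' \<le> T' \<longrightarrow> in_set (pair (term_code k) r) T \<longrightarrow>
      in_set (pair (term_code k) r') T' \<longrightarrow> r = r'))" for k
  proof (rule dec_induct[where P = "\<lambda>k. k \<le> n \<longrightarrow> (\<forall>r. r \<le> T \<longrightarrow> (\<forall>r'. r' \<le> T' \<longrightarrow>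
      in_set (pair (term_code k) r) T \<longrightarrow> in_set (pair (term_code k) r') T' \<longrightarrow> r = r'))"])
    show "dec (\<lambda>e. e 0 \<le> n \<longrightarrow> (\<forall>r. r \<le> T \<longrightarrow> (\<forall>r'. r' \<le> T' \<longrightarrow>
      in_set (pair (term_code (e 0)) r) T \<longrightarrow> in_set (pair (term_code (e 0)) r') T' \<longrightarrow> r = r')))"
      by (intro dec_intros)
    have "r = c" if "in_set (pair (term_code 0) r) U" "chain U n u" for r u U
      using chainD[OF that(2) zero_le that(1)] basic_facts(1) by metis
    then show "0 \<le> n \<longrightarrow> (\<forall>r. r \<le> T \<longrightarrow> (\<forall>r'. r' \<le> T' \<longrightarrow> in_set (pair (term_code 0) r) T \<longrightarrow>
      in_set (pair (term_code 0) r') T' \<longrightarrow> r = r'))" using ch by blast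
  next
    fix k assume IH: "k \<le> n \<longrightarrow> (\<forall>r. r \<le> T \<longrightarrow> (\<forall>r'. r' \<le> T' \<longrightarrow> in_set (pair (term_code k) r) T \<longrightarrow>
      in_set (pair (term_code k) r') T' \<longrightarrow> r = r'))"
    show "k + 1 \<le> n \<longrightarrow> (\<forall>r. r \<le> T \<longrightarrow> (\<forall>r'. r' \<le> T' \<longrightarrow> in_set (pair (term_code (k + 1)) r) T \<longrightarrow>
      in_set (pair (term_code (k + 1)) r') T' \<longrightarrow> r = r'))"
    proof (intro allI impI)
      fix r r' assume kn: "k + 1 \<le> n" and r: "in_set (pair (term_code (k + 1)) r) T"
        and r': "in_set (pair (term_code (k + 1)) r') T'"
      have pre: "\<exists>q. in_set (pair (term_code k) q) U \<and> pair q u \<in> F"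
        if u: "in_set (pair (term_code (k + 1)) u) U" "chain U n u'" for u u' U
      proof -
        obtain j q where "k + 1 = j + 1" "in_set (pair (term_code j) q) U" "pair q u \<in> F"
          using chainD[OF u(2) kn u(1)] basic_facts(1)[of k] by blast
        then show ?thesis by auto
      qed
      obtain q where q: "in_set (pair (term_code k) q) T" "pair q r \<in> F" using pre[OF r ch(1)] by blast
      obtain q' where q': "in_set (pair (term_code k) q') T'" "pair q' r' \<in> F" using pre[OF r' ch(2)] by blast
      have "k \<le> n" using kn by (simp add: less_imp_le)
      then have "q = q'" using IH q(1) q'(1) in_set_pair_le by blast
      then show "r = r'" using q(2) q'(2) F_fun by blast
    qed
  qed
  moreover have "in_set (pair (term_code n) a) T" "in_set (pair (term_code n) a') T'"
    using ch by (simp_all add: chain_def)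
  ultimately show ?thesis using in_set_pair_le by blast
qed

context
  assumes peano: "peano A F c" and sat: "\<And>n. sat_ex A F c (reach_code n)"
begin

lemma F_inj: "pair a d \<in> F \<Longrightarrow> pair b d \<in> F \<Longrightarrow> a = b"
  and F_zero: "pair a c \<notin> F"
proof -
  \<comment> \<open>Injectivity and the clause for c do not mention the quantified relation, so the
    empty set is enough to extract them from the sentence.\<close>
  have "{x :: model. False} \<in> Sets" by (rule dec_Collect) (intro dec_intros)
  then have "{} \<in> Sets" by simp
  from peano[unfolded peano_def, rule_format, OF this]
  have *: "\<And>a b. a \<in> A \<Longrightarrow> b \<in> A \<Longrightarrow> (\<forall>d. pair a d \<in> F \<longrightarrow> d \<in> A \<longrightarrow> pair b d \<notin> F) \<or> a = b"
    "\<And>a. a \<in> A \<Longrightarrow> c \<in> A \<Longrightarrow> pair a c \<notin> F" by simp_all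
  show "pair a d \<in> F \<Longrightarrow> pair b d \<in> F \<Longrightarrow> a = b" using *(1)[of a b] F_in by blast
  show "pair a c \<notin> F" using *(2)[of a] F_in by blast
qed

definition val_at :: "model \<Rightarrow> model" where
  "val_at n = (THE a. \<exists>T. chain T n a)"

lemma val_at_iff: "a = val_at n \<longleftrightarrow> (\<exists>T. chain T n a)"
proof -
  have "\<exists>!a. \<exists>T. chain T n a" using chain_exists[OF sat] chain_unique by blast
  from theI'[OF this, folded val_at_def] show ?thesis using chain_unique by blast
qed

text \<open>That some table gives the value is equivalent to all tables giving it, because tables
  exist and agree. The competing value is bounded by the table, which leaves one unbounded
  quantifier on each side.\<close>

lemma df_val_at: "df f \<Longrightarrow> df (\<lambda>e. val_at (f e))"
proof (rule df_unary[where F = val_at])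
  have *: "(\<forall>T. \<forall>a'. a' \<le> T \<longrightarrow> chain T n a' \<longrightarrow> a' = a) \<longleftrightarrow> a = val_at n" for n a
  proof
    assume all: "\<forall>T. \<forall>a'. a' \<le> T \<longrightarrow> chain T n a' \<longrightarrow> a' = a"
    obtain T where T: "chain T n (val_at n)" using val_at_iff by blast
    then have "val_at n \<le> T" using in_set_pair_le unfolding chain_def by blast
    then show "a = val_at n" using all T by blast
  next
    assume "a = val_at n"
    then show "\<forall>T. \<forall>a'. a' \<le> T \<longrightarrow> chain T n a' \<longrightarrow> a' = a" using val_at_iff by blast
  qed
  have "dec (\<lambda>e. \<exists>T. chain T (e (Suc 0)) (e 0))"
  proof (rule dec_Delta1[where P = "\<lambda>T e. chain T (e (Suc 0)) (e 0)"
        and Q = "\<lambda>T e. \<forall>a'. a' \<le> T \<longrightarrow> chain T (e (Suc 0)) a' \<longrightarrow> a' = e 0"])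
    show "dec (\<lambda>e. chain (e 0) (e (Suc (Suc 0))) (e (Suc 0)))" by (rule dec_chain)
    show "dec (\<lambda>e. \<forall>a'. a' \<le> e 0 \<longrightarrow> chain (e 0) (e (Suc (Suc 0))) a' \<longrightarrow> a' = e (Suc 0))"
      by (intro dec_intros dec_chain)
  qed (simp only: * val_at_iff[symmetric])
  then show "dec (\<lambda>e. e 0 = val_at (e (Suc 0)))" by (simp only: val_at_iff)
qed

lemma val_at_zero: "val_at 0 = c"
proof -
  obtain T where T: "chain T 0 (val_at 0)" using val_at_iff by blast
  then have "in_set (pair (term_code 0) (val_at 0)) T" by (simp add: chain_def)
  from chainD[OF T order_refl this] basic_facts(1) show ?thesis by metis
qed

lemma val_at_step: "pair (val_at n) (val_at (n + 1)) \<in> F"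
proof -
  obtain T where T: "chain T (n + 1) (val_at (n + 1))" using val_at_iff by blast
  then have "in_set (pair (term_code (n + 1)) (val_at (n + 1))) T" by (simp only: chain_def)
  from chainD[OF T order_refl this] obtain j q where
    "n + 1 = j + 1" "in_set (pair (term_code j) q) T" "pair q (val_at (n + 1)) \<in> F"
    using basic_facts(1)[of n] by blast
  then have q: "in_set (pair (term_code n) q) T" "pair q (val_at (n + 1)) \<in> F" by simp_all
  \<comment> \<open>The table for n + 1 is also one for n, so its entry q at n is the value
    there.\<close>
  have "k \<le> n \<Longrightarrow> k \<le> n + 1" for k by (simp add: less_imp_le)
  then have "chain T n q" using T q(1) unfolding chain_def by blast
  then have "q = val_at n" using val_at_iff by blast
  then show ?thesis using q(2) by simp
qed

lemma val_at_in: "val_at n \<in> A"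
  using val_at_step F_in by blast

text \<open>Induction on m with the gap i + 1 fixed: the base holds because c is not a value of f,
  the step because f is injective.\<close>

lemma val_at_neq: "val_at m \<noteq> val_at (m + (i + 1))"
proof (rule dec_induct[where P = "\<lambda>m. val_at m \<noteq> val_at (m + (i + 1))"])
  show "dec (\<lambda>e. val_at (e 0) \<noteq> val_at (e 0 + (i + 1)))" by (intro dec_intros df_val_at)
  show "val_at 0 \<noteq> val_at (0 + (i + 1))" using val_at_step[of i] F_zero val_at_zero by auto
  fix m assume IH: "val_at m \<noteq> val_at (m + (i + 1))"
  show "val_at (m + 1) \<noteq> val_at (m + 1 + (i + 1))"
  proof
    assume eq: "val_at (m + 1) = val_at (m + 1 + (i + 1))"
    have "pair (val_at (m + (i + 1))) (val_at (m + 1)) \<in> F"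
      using val_at_step[of "m + (i + 1)"] unfolding eq by (simp only: ac_simps)
    then show False using val_at_step[of m] F_inj IH by blast
  qed
qed

lemma val_at_inj: "val_at m = val_at n \<Longrightarrow> m = n"
proof -
  have *: "val_at m \<noteq> val_at n" if "m < n" for m n
    using that val_at_neq[of m] unfolding less_iff_model add.assoc by blast
  show "val_at m = val_at n \<Longrightarrow> m = n" using *[of m n] *[of n m] by (cases m n rule: linorder_cases) auto
qed

text \<open>
  An element \<open>b\<close> is a number, so it can serve as the length of an initial segment of the sequence of
  values; this makes the values below \<open>b\<close> a set for each \<open>b\<close>, uniformly, although all the values need not form one.
\<close>

lemma val_at_surj:
  assumes "y \<in> A" shows "\<exists>n. y = val_at n"
proof -
  define P where "P = {p. \<exists>b. b \<le> p \<and> (\<exists>y. y \<le> p \<and> p = pair b y \<and> b \<in> A \<and> (\<exists>k. k \<le> b \<and> y = val_at k))}"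
  have P: "P \<in> Sets" unfolding P_def by (rule dec_Collect) (intro dec_intros df_val_at A)
  have mem: "pair b y \<in> P \<longleftrightarrow> b \<in> A \<and> (\<exists>k. k \<le> b \<and> y = val_at k)" for b y
    unfolding P_def using le_pair[of b y] le_pair[of y b] le_pair(2)[of y b] by auto
  have sub: "\<forall>p. p \<in> P \<longrightarrow> (\<exists>a. a \<in> A \<and> (\<exists>b. b \<in> A \<and> p = pair a b))"
    unfolding P_def using val_at_in by blast
  have closed: "pair b y \<in> P" if "pair y z \<in> F" "pair b z \<in> P" for b y z
  proof -
    obtain k where k: "b \<in> A" "k \<le> b" "z = val_at k" using \<open>pair b z \<in> P\<close> mem by blast
    have "k \<noteq> 0" using that(1) k(3) val_at_zero F_zero by auto
    then obtain l where l: "k = l + 1" using less_iff_model[of 0 k] by (auto simp: zero_less_iff_neq_zero)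
    have "y = val_at l" using that(1) val_at_step[of l] F_inj k(3) l by blast
    moreover have "l \<le> b" using k(2) l by (simp add: less_imp_le)
    ultimately show ?thesis using mem k(1) by blast
  qed
  \<comment> \<open>For b < b' the value at b' separates the two segments, by injectivity of
    \<open>val_at\<close>.\<close>
  have distinct: "pair b' (val_at b') \<in> P \<and> pair b (val_at b') \<notin> P" if "b < b'" "b' \<in> A" for b b'
  proof
    show "pair b' (val_at b') \<in> P" using mem that by blast
    show "pair b (val_at b') \<notin> P"
    proof
      assume "pair b (val_at b') \<in> P"
      then obtain k where "k \<le> b" "val_at b' = val_at k" using mem by blast
      then show False using val_at_inj[of b' k] that(1) by simp
    qed
  qed
  have separated: "\<not> (\<forall>y. y \<in> A \<longrightarrow> (pair b y \<in> P \<longrightarrow> pair b' y \<in> P) \<and> (pair b' y \<in> P \<longrightarrow> pair b y \<in> P))"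
    if "b \<in> A" "b' \<in> A" "b \<noteq> b'" for b b'
  proof (cases b b' rule: linorder_cases)
    case less
    then show ?thesis using distinct[of b b'] that val_at_in[of b'] by blast
  next
    case greater
    then show ?thesis using distinct[of b' b] that val_at_in[of b] by blast
  qed (use that in blast)
  have "\<exists>b. b \<in> A \<and> pair b y \<in> P"
    using bspec[OF peano[unfolded peano_def] P, THEN mp, OF sub, THEN conjunct2, THEN conjunct2]
      closed separated assms by blast
  then show ?thesis using mem by blast
qed

lemma sat_imp_iso: "iso_N A F c"
proof -
  define H where "H = {p. \<exists>a. a \<le> p \<and> (\<exists>n. n \<le> p \<and> p = pair a n \<and> a = val_at n)}"
  have H: "H \<in> Sets" unfolding H_def by (rule dec_Collect) (intro dec_intros df_val_at)
  have mem: "pair a n \<in> H \<longleftrightarrow> a = val_at n" for a n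
    unfolding H_def using le_pair[of a n] le_pair(2)[of n a] by auto
  show ?thesis unfolding iso_N_def
  proof (intro bexI[of _ H] H conjI allI impI)
    fix p assume "p \<in> H"
    then show "\<exists>a. a \<in> A \<and> (\<exists>n. p = pair a n)" unfolding H_def using val_at_in by blast
  next
    fix a assume "a \<in> A"
    then obtain n where "a = val_at n" using val_at_surj by blast
    then show "\<exists>n. pair a n \<in> H \<and> (\<forall>m. pair a m \<in> H \<longrightarrow> m = n)"
      unfolding mem using val_at_inj by blast
  next
    fix a b assume "\<exists>n. pair a n \<in> H \<and> pair b n \<in> H"
    then show "a = b" unfolding mem by blast
  next
    fix n show "\<exists>a. pair a n \<in> H" unfolding mem by blast
  next
    show "pair c 0 \<in> H" unfolding mem val_at_zero ..
  next
    fix a b n assume "pair a n \<in> H \<and> pair a b \<in> F"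
    then show "pair b (n + 1) \<in> H" unfolding mem using val_at_step[of n] F_fun by blast
  qed
qed

end

end

theorem characterization_valid: "valid_in \<MM> characterization"
proof -
  have main: "iso_N A F c \<longleftrightarrow> (\<forall>x. x = of_nat (code_ofm peano_sentence) \<or> (\<exists>n. x = reach_code n) \<longrightarrow>
      x = of_nat (code_ofm peano_sentence) \<and> peano A F c \<or> sat_ex A F c x)"
    (is "_ \<longleftrightarrow> ?sat")
    if "A \<in> Sets" "F \<in> Sets" "is_str A F c" for A F c
  proof -
    interpret model_structure A F c using that by unfold_locales
    obtain b where b: "(of_nat (code_ofm peano_sentence) :: model) = 16 * b + 10" using code_peano by blast
    have diff: "of_nat (code_ofm peano_sentence) \<noteq> 16 * x + (7 :: model)" for x
      unfolding b using mod16(2)[of b 10 x 7] by auto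
    show ?thesis
    proof
      assume "iso_N A F c"
      then show ?sat using iso_imp by blast
    next
      assume sat: ?sat
      have "peano A F c" using sat sat_ex_form diff by blast
      moreover have "sat_ex A F c (reach_code n)" for n
        using sat diff[of "pair 0 (16 * pair 0 (term_code n) + 3)", folded reach_code_def] by metis
      ultimately show "iso_N A F c" by (rule sat_imp_iso)
    qed
  qed
  show ?thesis unfolding valid_in_def characterization_def characterizes_N_def
    by (simp add: holds_is_structure holds_isomorphic holds_Xi sat_def holds_peano
        holds_sat_existential main)
qed

theorem RCA_star_characterization: "RCA_star \<turnstile> characterization"
  using characterization_valid valid_in_MM counter_model(4) by blast

section \<open>The defined set\<close>

lemma code_otm_inj: "code_otm s = code_otm t \<Longrightarrow> s = t"
proof (induction s arbitrary: t)
  case (OVar i)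
  then show ?case by (cases t; simp; (presburger)?)
next
  case OC
  then show ?case by (cases t; simp; (presburger)?)
next
  case (OF s)
  then show ?case by (cases t; simp; (presburger)?)
qed

lemma code_list_inj:
  "foldr (\<lambda>t c. Suc (pr_nat (code_otm t) c)) ts 0 = foldr (\<lambda>t c. Suc (pr_nat (code_otm t) c)) us 0 \<Longrightarrow> ts = us"
proof (induction ts arbitrary: us)
  case Nil
  then show ?case by (cases us) auto
next
  case (Cons t ts)
  then show ?case by (cases us) (auto simp: pr_nat_inj dest: code_otm_inj)
qed

text \<open>Tags settle different constructors by their residues modulo 16, and injectivity of
  pairing settles equal ones. This leads from the numbers satisfying \<open>Xi\<close> back to
  sentences, and so to their words.\<close>

lemma code_ofm_inj: "code_ofm \<phi> = code_ofm \<psi> \<Longrightarrow> \<phi> = \<psi>"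
proof (induction \<phi> arbitrary: \<psi>)
  case (OEq s t)
  then show ?case by (cases \<psi>; auto simp: pr_nat_inj dest: code_otm_inj; presburger)
next
  case (ORel i ts)
  then show ?case by (cases \<psi>; auto simp: pr_nat_inj dest: code_list_inj; presburger)
next
  case (ONot \<phi>)
  show ?case using ONot.prems by (cases \<psi>; auto simp: pr_nat_inj dest: ONot.IH; presburger)
next
  case (OAnd \<phi>1 \<phi>2)
  show ?case using OAnd.prems by (cases \<psi>; auto simp: pr_nat_inj dest: OAnd.IH; presburger)
next
  case (OEx i \<phi>)
  show ?case using OEx.prems by (cases \<psi>; auto simp: pr_nat_inj dest: OEx.IH; presburger)
next
  case (OAll i \<phi>)
  show ?case using OAll.prems by (cases \<psi>; auto simp: pr_nat_inj dest: OAll.IH; presburger)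
next
  case (OExR k i \<phi>)
  show ?case using OExR.prems by (cases \<psi>; auto simp: pr_nat_inj dest: OExR.IH; presburger)
next
  case (OAllR k i \<phi>)
  show ?case using OAllR.prems by (cases \<psi>; auto simp: pr_nat_inj dest: OAllR.IH; presburger)
qed

section \<open>The set defined by \<open>Xi\<close> in the standard model\<close>

lemma standard_truth_holds: "standard_truth e E \<phi> \<longleftrightarrow> holds standard e E \<phi>"
proof -
  have "val_trm e t = val standard e t" for e t by (induction t) auto
  then show ?thesis by (induction \<phi> arbitrary: e E) auto
qed

lemma val_standard [simp]:
  "val standard \<rho> (numeral_trm n) = n" "val standard \<rho> (tag d t) = 16 * val standard \<rho> t + d"
  "val standard \<rho> (pr s t) = pr_nat (val standard \<rho> s) (val standard \<rho> t)"
proof -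
  show *: "val standard \<rho> (numeral_trm n) = n" for n by (induction n) auto
  show "val standard \<rho> (tag d t) = 16 * val standard \<rho> t + d"
    unfolding tag_def by (simp only: val.simps standard_simps *)
  show "val standard \<rho> (pr s t) = pr_nat (val standard \<rho> s) (val standard \<rho> t)"
    by (simp add: pr_def pr_nat_def)
qed

text \<open>The counterpart, for ordinary natural numbers, of the criterion in \<open>model\<close>;
  the latter may be nonstandard, so its facts do not transfer.\<close>

lemma nat_power_of_two_iff:
  "(\<forall>d\<le>q. \<forall>k\<le>q. d * k = q \<longrightarrow> d = 1 \<or> (\<exists>j<d. d = j + j)) \<longleftrightarrow> (\<exists>n. q = 2 ^ n)" for q :: nat
proof
  assume "\<forall>d\<le>q. \<forall>k\<le>q. d * k = q \<longrightarrow> d = 1 \<or> (\<exists>j<d. d = j + j)"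
  then show "\<exists>n. q = 2 ^ n"
  proof (induction q rule: less_induct)
    case (less q)
    show ?case
    proof (cases "q \<le> 1")
      case True
      have "q \<noteq> 0" using less.prems[rule_format, of 0 0] by auto
      then show ?thesis using True by (intro exI[of _ 0]) simp
    next
      case False
      then obtain h where h: "h < q" "q = h + h"
        using less.prems[rule_format, of q 1] by auto
      have "d = 1 \<or> (\<exists>j<d. d = j + j)" if "d \<le> h" "k \<le> h" "d * k = h" for d k
      proof -
        have "d * (k + k) = q" using that(3) h(2) by (simp add: distrib_left)
        moreover have "d \<le> q" "k + k \<le> q" using that(1,2) h by simp_all
        ultimately show ?thesis using less.prems by blast
      qed
      then obtain n where "h = 2 ^ n" using less.IH[OF h(1)] by blast
      then show ?thesis using h(2) by (intro exI[of _ "Suc n"]) simp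
    qed
  qed
next
  assume "\<exists>n. q = 2 ^ n"
  then obtain n where q: "q = 2 ^ n" by blast
  have odd: "d = 1" if "odd d" "d * k = 2 ^ n" for d k :: nat
    using that(2)
  proof (induction n arbitrary: k)
    case (Suc n)
    then have "even k" using \<open>odd d\<close> by (metis dvd_triv_left even_mult_iff power_Suc)
    then obtain k' where "k = 2 * k'" by blast
    then show ?case using Suc by simp
  qed simp
  show "\<forall>d\<le>q. \<forall>k\<le>q. d * k = q \<longrightarrow> d = 1 \<or> (\<exists>j<d. d = j + j)"
  proof (intro allI impI)
    fix d k assume dk: "d * k = q"
    show "d = 1 \<or> (\<exists>j<d. d = j + j)"
    proof (cases "odd d")
      case False
      moreover have "d \<noteq> 0" using dk q by (cases "d = 0") simp_all
      ultimately show ?thesis by (intro disjI2 exI[of _ "d div 2"]) auto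
    qed (use odd dk q in blast)
  qed
qed

lemma code_iterated: "15 * code_otm ((OF ^^ n) OC) + 2 = 17 * 16 ^ n"
  by (induction n) simp_all

lemma code_reach_sentence:
  "code_ofm (reach_sentence n) = 16 * pr_nat 0 (16 * pr_nat 0 (code_otm ((OF ^^ n) OC)) + 3) + 7"
  by (simp add: reach_sentence_def)

lemma defined_set_Xi: "defined_set (''x'', []) Xi = {code_ofm peano_sentence} \<union> range (\<lambda>n. code_ofm (reach_sentence n))"
proof -
  have reach: "(\<exists>t<x. \<exists>q<x. (\<exists>n. q = 2 ^ n) \<and> 15 * t + 2 = 17 * (q * q * (q * q)) \<and>
      x = 16 * pr_nat 0 (16 * pr_nat 0 t + 3) + 7) \<longleftrightarrow> (\<exists>n. x = code_ofm (reach_sentence n))" (is "?L \<longleftrightarrow> ?R") for x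
  proof
    assume ?L
    then obtain t n where t: "15 * t + 2 = 17 * ((2 ^ n * 2 ^ n) * (2 ^ n * 2 ^ n))"
      and x: "x = 16 * pr_nat 0 (16 * pr_nat 0 t + 3) + 7" by blast
    have "(2 ^ n * 2 ^ n) * (2 ^ n * 2 ^ n) = (16 :: nat) ^ n"
      by (simp flip: power_mult_distrib)
    then have "t = code_otm ((OF ^^ n) OC)" using t code_iterated[of n] by simp
    then show ?R using x code_reach_sentence by auto
  next
    assume ?R
    then obtain n where n: "x = code_ofm (reach_sentence n)" by blast
    let ?t = "code_otm ((OF ^^ n) OC)" and ?q = "2 ^ n :: nat"
    have eq: "15 * ?t + 2 = 17 * (?q * ?q * (?q * ?q))"
      using code_iterated[of n] by (simp flip: power_mult_distrib)
    have "z \<le> z * z" for z :: nat by (rule le_square)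
    then have "?q \<le> ?q * ?q * (?q * ?q)" by (meson order_trans)
    then have "?q \<le> ?t" using eq by linarith
    moreover have "?t < x"
    proof -
      have "?t \<le> pr_nat 0 ?t" by (simp add: pr_nat_def le_square)
      moreover have "16 * pr_nat 0 ?t + 3 \<le> pr_nat 0 (16 * pr_nat 0 ?t + 3)"
        by (simp only: pr_nat_def[of 0 "16 * pr_nat 0 ?t + 3"] add_0 add_0_right le_square)
      ultimately show ?thesis unfolding n code_reach_sentence by linarith
    qed
    ultimately have "?t < x" "?q < x" by simp_all
    moreover have "x = 16 * pr_nat 0 (16 * pr_nat 0 ?t + 3) + 7" unfolding n by (rule code_reach_sentence)
    ultimately show ?L using eq by blast
  qed
  have "n \<in> defined_set (''x'', []) Xi \<longleftrightarrow> n = code_ofm peano_sentence \<or> (\<exists>m. n = code_ofm (reach_sentence m))" for n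
  proof -
    have "n \<in> defined_set (''x'', []) Xi \<longleftrightarrow> n = code_ofm peano_sentence \<or> (\<exists>t<n. \<exists>q<n.
        (\<forall>d\<le>q. \<forall>k\<le>q. d * k = q \<longrightarrow> d = 1 \<or> (\<exists>j<d. d = j + j)) \<and>
        15 * t + 2 = 17 * (q * q * (q * q)) \<and> n = 16 * pr_nat 0 (16 * pr_nat 0 t + 3) + 7)"
      unfolding defined_set_def standard_truth_holds mem_Collect_eq Xi_def reach_fm_def power_of_two_fm_def
      by (simp add: less_Suc_eq_le)
    then show ?thesis unfolding nat_power_of_two_iff reach .
  qed
  then show ?thesis by auto
qed

lemma sentences_Xi: "sigma11_pi11_sentence peano_sentence" "sigma11_pi11_sentence (reach_sentence n)"
proof -
  show "sigma11_pi11_sentence peano_sentence"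
    unfolding sigma11_pi11_sentence_def peano_sentence_def
    by (intro conjI disjI2 disjI1 pi11.intros) auto
  have "otm_vars ((OF ^^ n) OC) = {}" by (induction n) auto
  then show "sigma11_pi11_sentence (reach_sentence n)"
    by (auto simp: sigma11_pi11_sentence_def reach_sentence_def intro: sigma11.intros)
qed

section \<open>Languages with finitely many derivatives\<close>

text \<open>Finitely many left derivatives form a finite automaton, run here as a machine that only
  moves to the right: its state records the derivative of \<open>L\<close> by the prefix read so
  far.\<close>

lemma polytime_recognizable_derivatives:
  fixes L :: "'a :: finite list set"
  assumes fin: "finite \<F>" and L: "L \<in> \<F>" and deriv: "\<And>K x. K \<in> \<F> \<Longrightarrow> {w. x # w \<in> K} \<in> \<F>"
  shows "polytime_recognizable L"
proof -
  obtain Ks where Ks: "set Ks = \<F>" using fin finite_list by blast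
  \<comment> \<open>Putting \<open>L\<close> in front gives it index 0. State q + 2 stands for f q,
    so the prescribed initial state 2 represents \<open>L\<close>.\<close>
  define f where "f i = (L # Ks) ! i" for i
  define N where "N = Suc (length Ks)"
  have f0: "f 0 = L" by (simp add: f_def)
  have f_in: "f i \<in> \<F>" if "i < N" for i
    using that L Ks nth_mem[of i "L # Ks"] by (auto simp: f_def N_def)
  have f_surj: "\<exists>i<N. f i = K" if "K \<in> \<F>" for K
  proof -
    have "K \<in> set Ks" using that Ks by simp
    then obtain i where "i < length Ks" "Ks ! i = K" unfolding in_set_conv_nth by blast
    then show ?thesis by (intro exI[of _ "Suc i"]) (simp add: f_def N_def)
  qed
  define index where "index K = (SOME i. i < N \<and> f i = K)" for K
  have index: "index K < N" "f (index K) = K" if "K \<in> \<F>" for K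
    using someI_ex[of "\<lambda>i. i < N \<and> f i = K"] f_surj[OF that] by (auto simp: index_def)
  define M :: "'a turing" where "M = \<lparr>n_states = N + 2, n_work = 1, trans = \<lambda>q a. if q < 2 then (0, Inr 0, True) else
    case a of Inl x \<Rightarrow> (index {w. x # w \<in> f (q - 2)} + 2, Inl x, True)
    | Inr _ \<Rightarrow> (if [] \<in> f (q - 2) then 0 else 1, Inr 0, True)\<rparr>"
  have "turing_ok M"
    using index f_in deriv by (auto simp: turing_ok_def M_def N_def tape_symbols_def split: sum.split)
  \<comment> \<open>One step for each letter and one at the blank, where membership of the empty
    word decides; hence the degree 1.\<close>
  moreover have "fst ((step M ^^ (length w ^ 1 + 1)) (initial w)) = (if w \<in> L then 0 else 1)" for w
  proof -
    define tape where "tape = (\<lambda>i. if 0 \<le> i \<and> i < int (length w) then Inl (w ! nat i) else Inr (0 :: nat))"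
    have run: "\<exists>q<N. (step M ^^ i) (initial w) = (q + 2, tape, int i) \<and> f q = {v. take i w @ v \<in> L}"
      if "i \<le> length w" for i
      using that
    proof (induction i)
      case 0
      show ?case by (rule exI[of _ 0]) (simp add: initial_def tape_def f0 N_def)
    next
      case (Suc i)
      then obtain q where q: "q < N" "(step M ^^ i) (initial w) = (q + 2, tape, int i)"
        "f q = {v. take i w @ v \<in> L}" by auto
      have tape_i: "tape (int i) = Inl (w ! i)" using Suc.prems by (simp add: tape_def)
      let ?q = "index {v. w ! i # v \<in> f q}"
      have "(step M ^^ Suc i) (initial w) = (?q + 2, tape(int i := tape (int i)), int i + 1)"
        using q by (simp add: step_def M_def tape_i)
      moreover have "{v. w ! i # v \<in> f q} \<in> \<F>" by (rule deriv[OF f_in[OF q(1)]])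
      ultimately show ?case using index Suc.prems q(3)
        by (intro exI[of _ ?q]) (simp add: take_Suc_conv_app_nth)
    qed
    obtain q where q: "q < N" "(step M ^^ length w) (initial w) = (q + 2, tape, int (length w))"
      "f q = {v. w @ v \<in> L}" using run[of "length w"] by auto
    have "tape (int (length w)) = Inr 0" by (simp add: tape_def)
    then show ?thesis using q by (simp add: step_def M_def)
  qed
  ultimately show ?thesis unfolding polytime_recognizable_def by blast
qed

text \<open>Keeping \<open>u\<close> abstract avoids handling the long word of
  \<open>peano_sentence\<close>: the derivatives of a single word are its suffixes or empty.\<close>

lemma polytime_words: "polytime_recognizable ({u} \<union> {[L_ex, L_v, L_eq, L_v] @ replicate n L_f @ [L_c] | n. True})"
proof -
  define S where "S = {replicate n L_f @ [L_c] | n. True}"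
  define \<F>1 where "\<F>1 = insert {} ((\<lambda>i. {drop i u}) ` {..length u})"
  define \<F>2 where "\<F>2 = {{}, {[]}, S, (#) L_v ` S, (#) L_eq ` (#) L_v ` S, (#) L_v ` (#) L_eq ` (#) L_v ` S,
    (#) L_ex ` (#) L_v ` (#) L_eq ` (#) L_v ` S}"
  \<comment> \<open>Derivatives distribute over unions, so unions of one member from each finite
    family form a finite closed family.\<close>
  define \<F> where "\<F> = (\<lambda>(K, K'). K \<union> K') ` (\<F>1 \<times> \<F>2)"
  have 1: "{w. x # w \<in> K} \<in> \<F>1" if "K \<in> \<F>1" for x K
  proof -
    have drop_deriv: "{w. x # w \<in> {drop i u}} \<in> \<F>1" if i: "i \<le> length u" for i
    proof (cases "i < length u \<and> x = u ! i")
      case True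
      then have "{w. x # w \<in> {drop i u}} = {drop (Suc i) u}" by (auto simp: Cons_nth_drop_Suc[symmetric])
      then show ?thesis using True by (auto simp: \<F>1_def)
    next
      case False
      then have "{w. x # w \<in> {drop i u}} = {}"
        using i by (cases "i < length u") (auto simp: Cons_nth_drop_Suc[symmetric])
      then show ?thesis by (simp add: \<F>1_def)
    qed
    consider "K = {}" | i where "i \<le> length u" "K = {drop i u}"
      using \<open>K \<in> \<F>1\<close> unfolding \<F>1_def by blast
    then show ?thesis
    proof cases
      case 1
      then show ?thesis by (simp add: \<F>1_def)
    next
      case 2
      then show ?thesis using drop_deriv by blast
    qed
  qed
  have S_deriv: "{w. x # w \<in> S} = (if x = L_f then S else if x = L_c then {[]} else {})" for x
  proof -
    have "x # w \<in> S \<longleftrightarrow> x = L_c \<and> w = [] \<or> x = L_f \<and> w \<in> S" for w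
    proof
      assume "x # w \<in> S"
      then obtain n where "x # w = replicate n L_f @ [L_c]" by (auto simp: S_def)
      then show "x = L_c \<and> w = [] \<or> x = L_f \<and> w \<in> S" by (cases n) (auto simp: S_def)
    next
      assume "x = L_c \<and> w = [] \<or> x = L_f \<and> w \<in> S"
      then show "x # w \<in> S"
      proof
        assume "x = L_c \<and> w = []"
        then show ?thesis by (auto simp: S_def intro: exI[of _ 0])
      next
        assume "x = L_f \<and> w \<in> S"
        then obtain n where "x # w = replicate (Suc n) L_f @ [L_c]" by (auto simp: S_def)
        then show ?thesis unfolding S_def by blast
      qed
    qed
    then show ?thesis by auto
  qed
  have Cons_deriv: "{w. x # w \<in> (#) y ` K} = (if x = y then K else {})" for x y :: letter and K by auto
  have Nil_deriv: "{w. x # w \<in> {[]}} = {}" "{w. x # w \<in> {}} = {}" for x :: letter by auto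
  have 2: "{w. x # w \<in> K} \<in> \<F>2" if "K \<in> \<F>2" for x K
    using that unfolding \<F>2_def
    by (elim insertE emptyE) (simp_all only: S_deriv Cons_deriv Nil_deriv split: if_split, simp_all)
  have "{w. x # w \<in> K} \<in> \<F>" if "K \<in> \<F>" for x K
  proof -
    obtain K1 K2 where K: "K1 \<in> \<F>1" "K2 \<in> \<F>2" "K = K1 \<union> K2" using \<open>K \<in> \<F>\<close> by (auto simp: \<F>_def)
    have "{w. x # w \<in> K} = {w. x # w \<in> K1} \<union> {w. x # w \<in> K2}" unfolding K(3) by auto
    then show ?thesis using 1[OF K(1)] 2[OF K(2)] by (auto simp: \<F>_def)
  qed
  moreover have "finite \<F>" by (simp add: \<F>_def \<F>1_def \<F>2_def)
  moreover have "{u} \<union> {[L_ex, L_v, L_eq, L_v] @ replicate n L_f @ [L_c] | n. True} \<in> \<F>"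
  proof -
    have "{[L_ex, L_v, L_eq, L_v] @ replicate n L_f @ [L_c] | n. True} = (#) L_ex ` (#) L_v ` (#) L_eq ` (#) L_v ` S"
      by (auto simp: S_def image_def)
    then have "{[L_ex, L_v, L_eq, L_v] @ replicate n L_f @ [L_c] | n. True} \<in> \<F>2"
      by (simp only: \<F>2_def insert_iff simp_thms)
    moreover have "{u} \<in> \<F>1" by (auto simp: \<F>1_def intro!: image_eqI[of _ _ 0])
    ultimately show ?thesis unfolding \<F>_def
      by (intro image_eqI[of _ _ "({u}, {[L_ex, L_v, L_eq, L_v] @ replicate n L_f @ [L_c] | n. True})"]) simp_all
  qed
  ultimately show ?thesis by (intro polytime_recognizable_derivatives[of \<F>])
qed

lemma words_Xi: "{word \<xi> | \<xi>. code_ofm \<xi> \<in> defined_set (''x'', []) Xi} =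
    {word peano_sentence} \<union> {[L_ex, L_v, L_eq, L_v] @ replicate n L_f @ [L_c] | n. True}"
proof -
  have "word_otm ((OF ^^ n) OC) = replicate n L_f @ [L_c]" for n by (induction n) auto
  then have W: "word (reach_sentence n) = [L_ex, L_v, L_eq, L_v] @ replicate n L_f @ [L_c]" for n
    by (simp add: reach_sentence_def word_var_def)
  have D: "code_ofm \<xi> \<in> defined_set (''x'', []) Xi \<longleftrightarrow> \<xi> = peano_sentence \<or> (\<exists>n. \<xi> = reach_sentence n)" for \<xi>
    unfolding defined_set_Xi using code_ofm_inj by blast
  have "{word \<xi> | \<xi>. \<xi> = peano_sentence \<or> (\<exists>n. \<xi> = reach_sentence n)} =
      {word peano_sentence} \<union> {word (reach_sentence n) | n. True}" by blast
  then show ?thesis unfolding D W .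
qed

theorem theorem2:
  shows "\<exists>(\<Xi> :: fm) (\<Phi> :: ofm list).
    delta0_in (''x'', []) \<Xi> \<and>
    (\<forall>n \<in> defined_set (''x'', []) \<Xi>. \<exists>\<xi>. sigma11_pi11_sentence \<xi> \<and> n = code_ofm \<xi>) \<and>
    polytime_recognizable {word \<xi> | \<xi>. code_ofm \<xi> \<in> defined_set (''x'', []) \<Xi>} \<and>
    (\<forall>\<xi> \<in> set \<Phi>. sigma11_pi11_sentence \<xi>) \<and>
    (RCA_star \<turnstile> characterizes_N \<Xi> \<Phi>)"
proof (intro exI[of _ Xi] exI[of _ "[peano_sentence]"] conjI)
  show "delta0_in (''x'', []) Xi" by (rule delta0_Xi)
  show "\<forall>n \<in> defined_set (''x'', []) Xi. \<exists>\<xi>. sigma11_pi11_sentence \<xi> \<and> n = code_ofm \<xi>"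
    unfolding defined_set_Xi using sentences_Xi by blast
  show "polytime_recognizable {word \<xi> | \<xi>. code_ofm \<xi> \<in> defined_set (''x'', []) Xi}"
    unfolding words_Xi by (rule polytime_words)
  show "\<forall>\<xi> \<in> set [peano_sentence]. sigma11_pi11_sentence \<xi>" by (simp add: sentences_Xi)
  show "RCA_star \<turnstile> characterizes_N Xi [peano_sentence]"
    using RCA_star_characterization by (simp only: characterization_def)
qed

end
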